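(* Let $s\in\mathbb{R}$, and let $\Omega$ be an open subset of $\mathbb{R}^n$ such that $\Omega^c=\mathbb{R}^n\setminus\Omega$ is $s$-null. Then the restriction operator $|_\Omega:\widetilde H^s(\Omega)\to H^s_0(\Omega)$ is a unitary isomorphism.
   Context: Here $n\in\mathbb{N}$. $\mathscr{D}(\mathbb{R}^n)$ is the space of compactly supported smooth functions on $\mathbb{R}^n$; for open $\Omega\subset\mathbb{R}^n$, $\mathscr{D}(\Omega)=\{u\in\mathscr{D}(\mathbb{R}^n):\operatorname{supp}u\subset\Omega\}$. $\mathscr{D}^*(\Omega)$ is the space of distributions on $\Omega$ (anti-linear continuous functionals on $\mathscr{D}(\Omega)$), and $\mathscr{S}^*(\mathbb{R}^n)$ is the space of tempered distributions (anti-linear continuous functionals on the Schwartz space). The Fourier transform is $\hat u(\xi)=(2\pi)^{-n/2}\int_{\mathbb{R}^n}e^{-i\xi\cdot x}u(x)\,dx$, extended to $\mathscr{S}^*(\mathbb{R}^n)$. For $s\in\mathbb{R}$, $H^s(\mathbb{R}^n)$ is the Hilbert space of $u\in\mathscr{S}^*(\mathbb{R}^n)$ with $\|u\|_{H^s(\mathbb{R}^n)}^2=\int_{\mathbb{R}^n}(1+|\xi|^2)^s|\hat u(\xi)|^2\,d\xi<\infty$, with inner product $(u,v)_{H^s(\mathbb{R}^n)}=\int_{\mathbb{R}^n}(1+|\xi|^2)^s\hat u(\xi)\overline{\hat v(\xi)}\,d\xi$. For closed $F\subset\mathbb{R}^n$, $H^s_F=\{u\in H^s(\mathbb{R}^n):\operatorname{supp}u\subset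 F\}$. A set $E\subset\mathbb{R}^n$ is $s$-null if $H^s_F=\{0\}$ for every closed set $F\subset E$. $\widetilde H^s(\Omega)$ is the closure of $\mathscr{D}(\Omega)$ in $H^s(\mathbb{R}^n)$, with the inner product of $H^s(\mathbb{R}^n)$. $H^s(\Omega)=\{u\in\mathscr{D}^*(\Omega):u=U|_\Omega\text{ for some }U\in H^s(\mathbb{R}^n)\}$, where $U|_\Omega$ is the restriction of the distribution $U$ to $\Omega$, with norm $\|u\|_{H^s(\Omega)}=\min\{\|U\|_{H^s(\mathbb{R}^n)}:U\in H^s(\mathbb{R}^n),\ U|_\Omega=u\}$; it is a Hilbert space with inner product $(u,v)_{H^s(\Omega)}=(Q_sU,Q_sV)_{H^s(\mathbb{R}^n)}$, where $U|_\Omega=u$, $V|_\Omega=v$ and $Q_s$ is the orthogonal projection of $H^s(\mathbb{R}^n)$ onto $(H^s_{\Omega^c})^\perp$. $H^s_0(\Omega)$ is the closure of $\{\phi|_\Omega:\phi\in\mathscr{D}(\Omega)\}$ in $H^s(\Omega)$. A unitary isomorphism is a surjective linear isometry between Hilbert spaces. *)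

theory Defs
  imports "HOL-Analysis.Analysis" "HOL-Library.Function_Algebras"
begin

section \<open>Smooth, test and Schwartz functions\<close>

text \<open>\<open>iter_pd [b\<^sub>1, \<dots>, b\<^sub>k] f\<close> is the iterated partial derivative
  of \<open>f\<close> in the directions \<open>b\<^sub>1, \<dots>, b\<^sub>k\<close>; lists over \<^const>\<open>Basis\<close> play the role of
  multi-indices. For total functions the definition is meaningful where the inner derivative is
  differentiable, which \<open>smooth\<close> below guarantees.\<close>

primrec iter_pd :: "'a list \<Rightarrow> ('a::euclidean_space \<Rightarrow> complex) \<Rightarrow> 'a \<Rightarrow> complex" where
  "iter_pd [] f = f"
| "iter_pd (b # bs) f = (\<lambda>x. frechet_derivative (iter_pd bs f) (at x) b)"

definition smooth :: "('a::euclidean_space \<Rightarrow> complex) \<Rightarrow> bool" where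
  "smooth f \<longleftrightarrow> (\<forall>bs\<in>lists Basis. \<forall>x. iter_pd bs f differentiable (at x))"

definition fun_supp :: "('a::euclidean_space \<Rightarrow> complex) \<Rightarrow> 'a set" where
  "fun_supp f = closure {x. f x \<noteq> 0}"

definition test_functions :: "'a::euclidean_space set \<Rightarrow> ('a \<Rightarrow> complex) set" where
  "test_functions \<Omega> = {f. smooth f \<and> compact (fun_supp f) \<and> fun_supp f \<subseteq> \<Omega>}"

definition schwartz_functions :: "('a::euclidean_space \<Rightarrow> complex) set" where
  "schwartz_functions =
     {f. smooth f \<and>
         (\<forall>bs\<in>lists Basis. \<forall>k::nat. bounded (range (\<lambda>x. (1 + norm x) ^ k *\<^sub>R iter_pd bs f x)))}"

definition test_converges ::
    "'a::euclidean_space set \<Rightarrow> (nat \<Rightarrow> 'a \<Rightarrow> complex) \<Rightarrow> ('a \<Rightarrow> complex) \<Rightarrow> bool" where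
  "test_converges \<Omega> \<phi> \<psi> \<longleftrightarrow>
     (\<forall>j. \<phi> j \<in> test_functions \<Omega>) \<and> \<psi> \<in> test_functions \<Omega> \<and>
     (\<exists>K. compact K \<and> K \<subseteq> \<Omega> \<and> (\<forall>j. fun_supp (\<phi> j) \<subseteq> K)) \<and>
     (\<forall>bs\<in>lists Basis. uniform_limit UNIV (\<lambda>j. iter_pd bs (\<phi> j)) (iter_pd bs \<psi>) sequentially)"

definition schwartz_converges ::
    "(nat \<Rightarrow> 'a::euclidean_space \<Rightarrow> complex) \<Rightarrow> ('a \<Rightarrow> complex) \<Rightarrow> bool" where
  "schwartz_converges \<phi> \<psi> \<longleftrightarrow>
     (\<forall>j. \<phi> j \<in> schwartz_functions) \<and> \<psi> \<in> schwartz_functions \<and>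
     (\<forall>bs\<in>lists Basis. \<forall>k::nat.
        uniform_limit UNIV (\<lambda>j x. (1 + norm x) ^ k *\<^sub>R iter_pd bs (\<phi> j) x)
          (\<lambda>x. (1 + norm x) ^ k *\<^sub>R iter_pd bs \<psi> x) sequentially)"


section \<open>Distributions\<close>

text \<open>Functionals on a space \<open>A\<close> of functions are total HOL functions that are set to \<open>0\<close> outside
  \<open>A\<close>. This makes equality of functionals on \<open>A\<close> coincide with HOL equality, and the vector space
  operations on functionals are the pointwise ones.

  Continuity is sequential continuity. On the Schwartz space (metrizable) and, for (anti-)linear
  functionals, on the space of test functions (bornological) this is the same as topological
  continuity.\<close>

type_synonym 'a functional = "('a \<Rightarrow> complex) \<Rightarrow> complex"

definition antilinear_on :: "('a \<Rightarrow> complex) set \<Rightarrow> 'a functional \<Rightarrow> bool" where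
  "antilinear_on A u \<longleftrightarrow>
     (\<forall>\<phi>\<in>A. \<forall>\<psi>\<in>A. u (\<phi> + \<psi>) = u \<phi> + u \<psi>) \<and>
     (\<forall>\<phi>\<in>A. \<forall>c. u (\<lambda>x. c * \<phi> x) = cnj c * u \<phi>)"

definition distributions :: "'a::euclidean_space set \<Rightarrow> 'a functional set" where
  "distributions \<Omega> =
     {u. (\<forall>\<phi>. \<phi> \<notin> test_functions \<Omega> \<longrightarrow> u \<phi> = 0) \<and> antilinear_on (test_functions \<Omega>) u \<and>
         (\<forall>\<phi> \<psi>. test_converges \<Omega> \<phi> \<psi> \<longrightarrow> (\<lambda>j. u (\<phi> j)) \<longlonglongrightarrow> u \<psi>)}"

definition tempered_distributions :: "'a::euclidean_space functional set" where
  "tempered_distributions =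
     {u. (\<forall>\<phi>. \<phi> \<notin> schwartz_functions \<longrightarrow> u \<phi> = 0) \<and> antilinear_on schwartz_functions u \<and>
         (\<forall>\<phi> \<psi>. schwartz_converges \<phi> \<psi> \<longrightarrow> (\<lambda>j. u (\<phi> j)) \<longlonglongrightarrow> u \<psi>)}"

definition restrict_dist :: "'a::euclidean_space set \<Rightarrow> 'a functional \<Rightarrow> 'a functional" where
  "restrict_dist \<Omega> u = (\<lambda>\<phi>. if \<phi> \<in> test_functions \<Omega> then u \<phi> else 0)"

text \<open>The support of \<open>u\<close> is the complement of the largest open set on which \<open>u\<close> vanishes.\<close>

definition dist_supp :: "'a::euclidean_space functional \<Rightarrow> 'a set" where
  "dist_supp u = - \<Union>{V. open V \<and> (\<forall>\<phi>\<in>test_functions V. u \<phi> = 0)}"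

text \<open>\<open>dist_density T g\<close>: the tempered distribution \<open>T\<close> is the function \<open>g\<close>, under the identification
  \<open>T \<psi> = \<integral> g \<cdot> cnj \<psi>\<close>. Integrability against all Schwartz functions makes \<open>g\<close> locally integrable, so
  that \<open>g\<close> is determined by \<open>T\<close> almost everywhere.\<close>

definition dist_density :: "'a::euclidean_space functional \<Rightarrow> ('a \<Rightarrow> complex) \<Rightarrow> bool" where
  "dist_density T g \<longleftrightarrow>
     g \<in> borel_measurable borel \<and>
     (\<forall>\<psi>\<in>schwartz_functions.
        integrable lborel (\<lambda>x. g x * cnj (\<psi> x)) \<and> T \<psi> = (LINT x|lborel. g x * cnj (\<psi> x)))"

definition fun_dist :: "('a::euclidean_space \<Rightarrow> complex) \<Rightarrow> 'a functional" where
  "fun_dist f = (\<lambda>\<psi>. if \<psi> \<in> schwartz_functions then LINT x|lborel. f x * cnj (\<psi> x) else 0)"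


section \<open>Fourier transform\<close>

definition fourier :: "('a::euclidean_space \<Rightarrow> complex) \<Rightarrow> 'a \<Rightarrow> complex" where
  "fourier u \<xi> =
     (2 * pi) powr (- real DIM('a) / 2) *\<^sub>R (LINT x|lborel. exp (- (\<i> * of_real (\<xi> \<bullet> x))) * u x)"

text \<open>For integrable \<open>u\<close>, Fubini gives \<open>\<integral> fourier u \<cdot> cnj \<phi> = \<integral> u \<cdot> cnj (\<lambda>x. fourier \<phi> (- x))\<close>. As
  functionals are anti-linear, the extension to tempered distributions is therefore by duality with
  the inverse transform \<open>x \<mapsto> fourier \<phi> (- x)\<close>.\<close>

definition fourier_dist :: "'a::euclidean_space functional \<Rightarrow> 'a functional" where
  "fourier_dist u =
     (\<lambda>\<phi>. if \<phi> \<in> schwartz_functions then u (\<lambda>x. fourier \<phi> (- x)) else 0)"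

definition fourier_density :: "'a::euclidean_space functional \<Rightarrow> 'a \<Rightarrow> complex" where
  "fourier_density u = (SOME g. dist_density (fourier_dist u) g)"


section \<open>Sobolev spaces on the whole space\<close>

definition H_space :: "real \<Rightarrow> 'a::euclidean_space functional set" where
  "H_space s =
     {u \<in> tempered_distributions.
        (\<exists>g. dist_density (fourier_dist u) g) \<and>
        integrable lborel (\<lambda>\<xi>. (1 + (norm \<xi>)\<^sup>2) powr s * (cmod (fourier_density u \<xi>))\<^sup>2)}"

definition H_inner :: "real \<Rightarrow> 'a::euclidean_space functional \<Rightarrow> 'a functional \<Rightarrow> complex" where
  "H_inner s u v =
     (LINT \<xi>|lborel. (1 + (norm \<xi>)\<^sup>2) powr s *\<^sub>R (fourier_density u \<xi> * cnj (fourier_density v \<xi>)))"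

definition H_norm :: "real \<Rightarrow> 'a::euclidean_space functional \<Rightarrow> real" where
  "H_norm s u =
     sqrt (LINT \<xi>|lborel. (1 + (norm \<xi>)\<^sup>2) powr s * (cmod (fourier_density u \<xi>))\<^sup>2)"

definition H_supp :: "real \<Rightarrow> 'a::euclidean_space set \<Rightarrow> 'a functional set" where
  "H_supp s F = {u \<in> H_space s. dist_supp u \<subseteq> F}"

definition s_null :: "real \<Rightarrow> 'a::euclidean_space set \<Rightarrow> bool" where
  "s_null s E \<longleftrightarrow> (\<forall>F. closed F \<and> F \<subseteq> E \<longrightarrow> H_supp s F = {0})"

definition H_perp :: "real \<Rightarrow> 'a::euclidean_space functional set \<Rightarrow> 'a functional set" where
  "H_perp s M = {u \<in> H_space s. \<forall>v\<in>M. H_inner s u v = 0}"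

text \<open>Orthogonal projection onto a closed subspace \<open>M\<close> of \<open>H_space s\<close>.\<close>

definition H_proj ::
    "real \<Rightarrow> 'a::euclidean_space functional set \<Rightarrow> 'a functional \<Rightarrow> 'a functional" where
  "H_proj s M u = (THE w. w \<in> M \<and> (\<forall>v\<in>M. H_inner s (u - w) v = 0))"


section \<open>Sobolev spaces on open sets\<close>

definition H_tilde :: "real \<Rightarrow> 'a::euclidean_space set \<Rightarrow> 'a functional set" where
  "H_tilde s \<Omega> =
     {u \<in> H_space s. \<forall>\<epsilon>>0. \<exists>\<phi>\<in>test_functions \<Omega>. H_norm s (u - fun_dist \<phi>) < \<epsilon>}"

definition H_dom :: "real \<Rightarrow> 'a::euclidean_space set \<Rightarrow> 'a functional set" where
  "H_dom s \<Omega> = {u \<in> distributions \<Omega>. \<exists>U\<in>H_space s. u = restrict_dist \<Omega> U}"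

text \<open>The infimum is attained, i.e. a minimum, for \<open>u \<in> H_dom s \<Omega>\<close>.\<close>

definition H_dom_norm :: "real \<Rightarrow> 'a::euclidean_space set \<Rightarrow> 'a functional \<Rightarrow> real" where
  "H_dom_norm s \<Omega> u = Inf {H_norm s U | U. U \<in> H_space s \<and> restrict_dist \<Omega> U = u}"

text \<open>The inner product below does not depend on the extensions chosen: two of them differ by an
  element of \<open>H_supp s (- \<Omega>)\<close>, which \<open>Q_proj s \<Omega>\<close> maps to \<open>0\<close>.\<close>

definition Q_proj :: "real \<Rightarrow> 'a::euclidean_space set \<Rightarrow> 'a functional \<Rightarrow> 'a functional" where
  "Q_proj s \<Omega> = H_proj s (H_perp s (H_supp s (- \<Omega>)))"

definition H_ext :: "real \<Rightarrow> 'a::euclidean_space set \<Rightarrow> 'a functional \<Rightarrow> 'a functional" where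
  "H_ext s \<Omega> u = (SOME U. U \<in> H_space s \<and> restrict_dist \<Omega> U = u)"

definition H_dom_inner ::
    "real \<Rightarrow> 'a::euclidean_space set \<Rightarrow> 'a functional \<Rightarrow> 'a functional \<Rightarrow> complex" where
  "H_dom_inner s \<Omega> u v =
     H_inner s (Q_proj s \<Omega> (H_ext s \<Omega> u)) (Q_proj s \<Omega> (H_ext s \<Omega> v))"

definition H_zero :: "real \<Rightarrow> 'a::euclidean_space set \<Rightarrow> 'a functional set" where
  "H_zero s \<Omega> =
     {u \<in> H_dom s \<Omega>. \<forall>\<epsilon>>0. \<exists>\<phi>\<in>test_functions \<Omega>.
        H_dom_norm s \<Omega> (u - restrict_dist \<Omega> (fun_dist \<phi>)) < \<epsilon>}"


section \<open>Unitary isomorphisms\<close>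

text \<open>\<open>hilbert_space V ip nrm\<close>: the set \<open>V\<close> of complex-valued functions is, under pointwise operations,
  a complex Hilbert space with inner product \<open>ip\<close> (linear in the first argument) and norm \<open>nrm\<close>.\<close>

definition hilbert_space ::
    "('x \<Rightarrow> complex) set \<Rightarrow> (('x \<Rightarrow> complex) \<Rightarrow> ('x \<Rightarrow> complex) \<Rightarrow> complex) \<Rightarrow>
     (('x \<Rightarrow> complex) \<Rightarrow> real) \<Rightarrow> bool" where
  "hilbert_space V ip nrm \<longleftrightarrow>
     0 \<in> V \<and> (\<forall>u\<in>V. \<forall>v\<in>V. u + v \<in> V) \<and> (\<forall>u\<in>V. \<forall>c. (\<lambda>x. c * u x) \<in> V) \<and>
     (\<forall>u\<in>V. \<forall>v\<in>V. \<forall>w\<in>V. ip (u + v) w = ip u w + ip v w) \<and>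
     (\<forall>u\<in>V. \<forall>v\<in>V. \<forall>c. ip (\<lambda>x. c * u x) v = c * ip u v) \<and>
     (\<forall>u\<in>V. \<forall>v\<in>V. ip v u = cnj (ip u v)) \<and>
     (\<forall>u\<in>V. u \<noteq> 0 \<longrightarrow> Re (ip u u) > 0) \<and>
     (\<forall>u\<in>V. nrm u = sqrt (Re (ip u u))) \<and>
     (\<forall>X :: nat \<Rightarrow> 'x \<Rightarrow> complex.
        (\<forall>j. X j \<in> V) \<and> (\<forall>\<epsilon>>0. \<exists>N. \<forall>i\<ge>N. \<forall>j\<ge>N. nrm (X i - X j) < \<epsilon>) \<longrightarrow>
        (\<exists>u\<in>V. (\<lambda>j. nrm (X j - u)) \<longlonglongrightarrow> 0))"

definition unitary_isomorphism ::
    "('x \<Rightarrow> complex) set \<Rightarrow> (('x \<Rightarrow> complex) \<Rightarrow> ('x \<Rightarrow> complex) \<Rightarrow> complex) \<Rightarrow>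
     (('x \<Rightarrow> complex) \<Rightarrow> real) \<Rightarrow>
     ('y \<Rightarrow> complex) set \<Rightarrow> (('y \<Rightarrow> complex) \<Rightarrow> ('y \<Rightarrow> complex) \<Rightarrow> complex) \<Rightarrow>
     (('y \<Rightarrow> complex) \<Rightarrow> real) \<Rightarrow>
     (('x \<Rightarrow> complex) \<Rightarrow> ('y \<Rightarrow> complex)) \<Rightarrow> bool" where
  "unitary_isomorphism V ipV nV W ipW nW T \<longleftrightarrow>
     hilbert_space V ipV nV \<and> hilbert_space W ipW nW \<and>
     T ` V = W \<and>
     (\<forall>u\<in>V. \<forall>v\<in>V. T (u + v) = T u + T v) \<and>
     (\<forall>u\<in>V. \<forall>c. T (\<lambda>x. c * u x) = (\<lambda>y. c * T u y)) \<and>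
     (\<forall>u\<in>V. nW (T u) = nV u)"

end

theory Submission
  imports Defs "HOL-Probability.Probability"
begin

text \<open>As \<open>- \<Omega>\<close> is \<open>s\<close>-null, two elements of \<open>H_space s\<close> with the same restriction to \<open>\<Omega>\<close> agree:
  their difference is supported in \<open>- \<Omega>\<close>. Extensions are therefore unique, \<open>Q_proj s \<Omega>\<close> is the
  identity, and the norm and inner product of the restrictions are those of the extensions, so
  restriction carries the closure of the test functions onto the closure of their restrictions.

  The analytic content lies in \<open>H_space s\<close> being a Hilbert space. Fourier inversion on the Schwartz
  space identifies it with a weighted \<open>L\<^sup>2\<close> space, which is complete. The density of a tempered
  distribution is unique almost everywhere because translates and dilates of Gaussians are Schwartz
  functions and form an approximate identity; the same kernels prove the inversion formula.\<close>

section \<open>Integrals over Euclidean space and Gauss kernels\<close>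

text \<open>\<open>fourier_density\<close> is an arbitrary choice among the densities of
  \<open>fourier_dist u\<close>. Identities between densities therefore hold only almost everywhere,
  and even the linear structure of \<open>H_space s\<close> has to wait for
  \<open>dist_density_unique\<close>. Gaussians are the probes because their products are again
  Gaussian and their transforms are explicit, so no cutoff function has to be constructed.

  Completeness has a second half beyond that of square-integrable functions: the limit must be shown
  to be the density of some tempered distribution. This rests on the continuity of the Fourier
  transform on the Schwartz space, which is why \<open>ft_bound\<close> keeps one constant for all
  functions. It also rests on inversion: one order of composition identifies the density of the
  functional built from the limit, and the other shows that a functional with vanishing density is
  0.

  The null hypothesis is applied to the set \<open>- \<Omega>\<close> itself, which is closed
  because \<open>\<Omega>\<close> is open.\<close>

lemma integrable_dominated:
  fixes g :: "'a \<Rightarrow> 'b::{banach, second_countable_topology}" and f :: "'a \<Rightarrow> real"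
  assumes "integrable M f" "g \<in> borel_measurable M" "\<And>x. norm (g x) \<le> f x"
  shows "integrable M g"
  using assms(1,2)
proof (rule Bochner_Integration.integrable_bound)
  show "AE x in M. norm (g x) \<le> norm (f x)"
    using assms(3) by (intro AE_I2) (metis abs_ge_self order_trans real_norm_def)
qed

lemma cnj_measurable [measurable]: "cnj \<in> borel_measurable borel"
  by (intro borel_measurable_continuous_onI continuous_intros)

lemma
  fixes f :: "'a::euclidean_space \<Rightarrow> real \<Rightarrow> 'c::{real_normed_field, banach, second_countable_topology}"
  assumes f: "\<And>b. b \<in> Basis \<Longrightarrow> integrable lborel (f b)"
  shows integrable_lborel_prod: "integrable lborel (\<lambda>x. \<Prod>b\<in>Basis. f b (x \<bullet> b))"
    and integral_lborel_prod:
      "(LINT x|lborel. (\<Prod>b\<in>Basis. f b (x \<bullet> b))) = (\<Prod>b\<in>Basis. LINT t|lborel. f b t)"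
proof -
  interpret product_sigma_finite "\<lambda>_::'a. lborel :: real measure" ..
  have [measurable]: "f b \<in> borel_measurable borel" if "b \<in> Basis" for b
    using f[OF that] by simp
  have [measurable]: "(\<lambda>x. \<Prod>b\<in>Basis. f b (x \<bullet> b)) \<in> borel_measurable borel"
    by measurable
  have *: "(\<Prod>b\<in>Basis. f b ((\<Sum>i\<in>Basis. x i *\<^sub>R i) \<bullet> b)) = (\<Prod>b\<in>Basis. f b (x b))" for x :: "'a \<Rightarrow> real"
    by (intro prod.cong refl) simp
  show "integrable lborel (\<lambda>x. \<Prod>b\<in>Basis. f b (x \<bullet> b))"
    by (subst lborel_eq, subst integrable_distr_eq)
       (auto simp: * intro!: product_integrable_prod f)
  show "(LINT x|lborel. (\<Prod>b\<in>Basis. f b (x \<bullet> b))) = (\<Prod>b\<in>Basis. LINT t|lborel. f b t)"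
    by (subst lborel_eq, subst integral_distr)
       (auto simp: * intro!: product_integral_prod f)
qed

text \<open>A fixed integrable majorant. The exponent allots a factor \<open>(1 + norm x)^2\<close>
  to each coordinate, so that \<open>decay\<close> lies below a product of one-dimensional functions
  \<open>1 / (1 + t^2)\<close>.\<close>

definition decay :: "'a::euclidean_space \<Rightarrow> real" where
  "decay x = 1 / (1 + norm x) ^ (2 * DIM('a))"

lemma decay_pos: "decay x > 0"
  by (simp add: decay_def add_pos_nonneg)

lemma integrable_decay: "integrable lborel (decay :: 'a::euclidean_space \<Rightarrow> real)"
proof (rule Bochner_Integration.integrable_bound)
  have "integrable lborel (\<lambda>x::real. inverse (1 + x\<^sup>2))"
    using integrable_inverse_1_plus_square by (simp add: set_integrable_def)
  then show "integrable lborel (\<lambda>x::'a. \<Prod>b\<in>Basis. inverse (1 + (x \<bullet> b)\<^sup>2))"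
    by (rule integrable_lborel_prod)
  show "(decay :: 'a \<Rightarrow> real) \<in> borel_measurable lborel"
    unfolding decay_def by measurable
  have "norm (decay x) \<le> norm (\<Prod>b\<in>Basis. inverse (1 + (x \<bullet> b)\<^sup>2))" for x :: 'a
  proof -
    have "(\<Prod>b\<in>Basis. 1 + (x \<bullet> b)\<^sup>2) \<le> (\<Prod>b\<in>(Basis::'a set). (1 + norm x)\<^sup>2)"
    proof (intro prod_mono conjI)
      fix b :: 'a assume "b \<in> Basis"
      then have "(x \<bullet> b)\<^sup>2 \<le> (norm x)\<^sup>2"
        by (metis Basis_le_norm abs_le_square_iff abs_norm_cancel)
      then show "1 + (x \<bullet> b)\<^sup>2 \<le> (1 + norm x)\<^sup>2"
        by (simp add: power2_sum add_increasing2)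
    qed auto
    also have "\<dots> = (1 + norm x) ^ (2 * DIM('a))"
      by (simp add: power_mult)
    finally have "1 / (1 + norm x) ^ (2 * DIM('a)) \<le> 1 / (\<Prod>b\<in>Basis. 1 + (x \<bullet> b)\<^sup>2)"
      by (intro divide_left_mono mult_pos_pos prod_pos) (auto simp: add_pos_nonneg)
    then show ?thesis
      by (simp add: decay_def prod_inversef[symmetric] comp_def inverse_eq_divide prod_dividef abs_prod)
  qed
  then show "AE x in lborel. norm (decay (x::'a)) \<le> norm (\<Prod>b\<in>Basis. inverse (1 + (x \<bullet> b)\<^sup>2))"
    by (intro AE_I2)
qed

lemma norm_le_decay:
  assumes "(1 + norm x) ^ (2 * DIM('a::euclidean_space)) * norm y \<le> C"
  shows "norm y \<le> C * decay (x::'a)"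
proof -
  have "(1 + norm x) ^ (2 * DIM('a)) > 0" by (simp add: add_pos_nonneg)
  then show ?thesis using assms by (simp add: decay_def field_simps)
qed

lemma
  fixes f :: "'a::euclidean_space \<Rightarrow> 'c::{banach, second_countable_topology}"
  assumes [measurable]: "f \<in> borel_measurable borel"
    and C: "\<And>x. (1 + norm x) ^ (2 * DIM('a)) * norm (f x) \<le> C"
  shows integrable_of_decay: "integrable lborel f"
    and integral_norm_le_decay: "(LINT x|lborel. norm (f x)) \<le> C * (LINT x|lborel. decay (x::'a))"
proof -
  have le: "norm (f x) \<le> C * decay x" for x
    by (rule norm_le_decay[OF C])
  show f: "integrable lborel f"
    by (rule Bochner_Integration.integrable_bound[of _ "\<lambda>x. C * decay x"])
      (auto intro!: integrable_mult_right integrable_decay order_trans[OF le])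
  have "(LINT x|lborel. norm (f x)) \<le> (LINT x|lborel. C * decay (x::'a))"
    by (intro integral_mono integrable_norm f integrable_mult_right integrable_decay le)
  then show "(LINT x|lborel. norm (f x)) \<le> C * (LINT x|lborel. decay (x::'a))"
    by simp
qed

lemma
  fixes f :: "'a::euclidean_space \<Rightarrow> 'c::{banach, second_countable_topology}"
  assumes c: "c \<noteq> 0"
  shows lborel_integrable_affine: "integrable lborel f \<Longrightarrow> integrable lborel (\<lambda>x. f (t + c *\<^sub>R x))"
    and lborel_integral_affine:
      "integrable lborel f \<Longrightarrow>
       (LINT x|lborel. f x) = \<bar>c\<bar> ^ DIM('a) *\<^sub>R (LINT x|lborel. f (t + c *\<^sub>R x))"
proof -
  assume f: "integrable lborel f"
  then have [measurable]: "f \<in> borel_measurable borel" by simp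
  have "integrable (density (distr lborel borel (\<lambda>x. t + c *\<^sub>R x)) (\<lambda>_. \<bar>c\<bar>^DIM('a))) f"
    using f lborel_affine[OF c, of t] by simp
  then have "integrable lborel (\<lambda>x. \<bar>c\<bar>^DIM('a) *\<^sub>R f (t + c *\<^sub>R x))"
    using c by (subst (asm) integrable_density) (auto simp: integrable_distr_eq)
  from integrable_scaleR_right[OF this, of "1 / \<bar>c\<bar>^DIM('a)"]
  show "integrable lborel (\<lambda>x. f (t + c *\<^sub>R x))"
    using c by simp
  have "(LINT x|lborel. f x) = (LINT x|density (distr lborel borel (\<lambda>x. t + c *\<^sub>R x)) (\<lambda>_. \<bar>c\<bar>^DIM('a)). f x)"
    using lborel_affine[OF c, of t] by simp
  also have "\<dots> = \<bar>c\<bar> ^ DIM('a) *\<^sub>R (LINT x|lborel. f (t + c *\<^sub>R x))"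
    using c by (subst integral_density) (auto simp: integral_distr)
  finally show "(LINT x|lborel. f x) = \<bar>c\<bar> ^ DIM('a) *\<^sub>R (LINT x|lborel. f (t + c *\<^sub>R x))" .
qed

text \<open>The left-hand integral is, up to normalisation, the characteristic function of the
  standard normal distribution. Integrals over Euclidean space follow from this one by splitting
  into coordinates.\<close>

lemma
  fixes t :: real
  shows integrable_char_gauss: "integrable lborel (\<lambda>x::real. iexp (t * x) * of_real (exp (- x\<^sup>2 / 2)))"
    and integral_char_gauss:
      "(LINT x|lborel. iexp (t * x) * of_real (exp (- x\<^sup>2 / 2))) = of_real (sqrt (2 * pi) * exp (- t\<^sup>2 / 2))"
proof -
  have "char std_normal_distribution t = (LINT x|lborel. std_normal_density x *\<^sub>R iexp (t * x))"
    unfolding char_def by (subst integral_density) auto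
  also have "\<dots> = (LINT x|lborel. of_real (1 / sqrt (2 * pi)) * (iexp (t * x) * of_real (exp (- x\<^sup>2 / 2))))"
    by (intro Bochner_Integration.integral_cong refl)
      (simp add: std_normal_density_def scaleR_conv_of_real mult.commute)
  also have "\<dots> = of_real (1 / sqrt (2 * pi)) * (LINT x|lborel. iexp (t * x) * of_real (exp (- x\<^sup>2 / 2)))"
    by simp
  finally show "(LINT x|lborel. iexp (t * x) * of_real (exp (- x\<^sup>2 / 2))) = of_real (sqrt (2 * pi) * exp (- t\<^sup>2 / 2))"
    by (simp add: char_std_normal_distribution field_simps)
  have "integrable lborel (\<lambda>x. std_normal_density x)"
    by simp
  then have "integrable lborel (\<lambda>x. sqrt (2 * pi) * std_normal_density x)"
    by (rule integrable_mult_right)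
  then have "integrable lborel (\<lambda>x. exp (- x\<^sup>2 / 2) :: real)"
    by (simp add: std_normal_density_def)
  then show "integrable lborel (\<lambda>x::real. iexp (t * x) * of_real (exp (- x\<^sup>2 / 2)))"
    by (rule Bochner_Integration.integrable_bound) (auto simp: norm_mult)
qed

section \<open>The standard Gaussian, its transform and its rescalings\<close>

definition gauss :: "'a::euclidean_space \<Rightarrow> real" where
  "gauss x = exp (- (norm x)\<^sup>2 / 2)"

lemma gauss_pos: "gauss x > 0" and gauss_le_1: "gauss x \<le> 1" and gauss_minus: "gauss (- x) = gauss x"
  by (auto simp: gauss_def)

lemma gauss_measurable [measurable]: "gauss \<in> borel_measurable borel"
  unfolding gauss_def[abs_def] by measurable

lemma gauss_prod: "gauss (x::'a::euclidean_space) = (\<Prod>b\<in>Basis. exp (- (x \<bullet> b)\<^sup>2 / 2))"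
  unfolding gauss_def norm_eq_sqrt_inner
  by (subst euclidean_inner)
    (simp add: exp_sum[symmetric] sum_nonneg sum_divide_distrib sum_negf power2_eq_square flip: minus_divide_left)

lemma
  fixes y :: "'a::euclidean_space"
  shows integrable_fourier_gauss: "integrable lborel (\<lambda>x. iexp (y \<bullet> x) * of_real (gauss x))"
    and integral_fourier_gauss:
      "(LINT x|lborel. iexp (y \<bullet> x) * of_real (gauss x)) = of_real (sqrt (2 * pi) ^ DIM('a) * gauss y)"
proof -
  have *: "iexp (y \<bullet> x) * of_real (gauss x) =
      (\<Prod>b\<in>Basis. iexp ((y \<bullet> b) * (x \<bullet> b)) * of_real (exp (- (x \<bullet> b)\<^sup>2 / 2)))" for x :: 'a
    by (subst euclidean_inner) (simp add: gauss_prod prod.distrib exp_sum sum_distrib_left)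
  show "integrable lborel (\<lambda>x. iexp (y \<bullet> x) * of_real (gauss x))"
    unfolding * by (rule integrable_lborel_prod) (rule integrable_char_gauss)
  show "(LINT x|lborel. iexp (y \<bullet> x) * of_real (gauss x)) = of_real (sqrt (2 * pi) ^ DIM('a) * gauss y)"
    unfolding * by (subst integral_lborel_prod[OF integrable_char_gauss])
      (simp only: integral_char_gauss, simp only: gauss_prod prod.distrib prod_constant of_real_mult of_real_prod of_real_power)
qed

lemma integrable_gauss: "integrable lborel (gauss :: 'a::euclidean_space \<Rightarrow> real)"
  using integrable_fourier_gauss[of "0::'a", THEN integrable_norm]
  by (simp add: norm_mult abs_of_pos[OF gauss_pos])

lemma integral_gauss: "(LINT x|lborel. gauss (x::'a::euclidean_space)) = sqrt (2 * pi) ^ DIM('a)"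
proof -
  have "of_real (LINT x|lborel. gauss (x::'a)) = (of_real (sqrt (2 * pi) ^ DIM('a)) :: complex)"
    using integral_fourier_gauss[of "0::'a"] by (simp add: gauss_def)
  then show ?thesis by (simp only: of_real_eq_iff)
qed

lemma
  fixes y :: "'a::euclidean_space"
  assumes e: "e > 0"
  shows integrable_fourier_gauss_scaled: "integrable lborel (\<lambda>x. iexp (y \<bullet> x) * of_real (gauss (e *\<^sub>R x)))"
    and integral_fourier_gauss_scaled:
      "(LINT x|lborel. iexp (y \<bullet> x) * of_real (gauss (e *\<^sub>R x))) =
        of_real (sqrt (2 * pi) ^ DIM('a) / e ^ DIM('a) * gauss (y /\<^sub>R e))"
proof -
  let ?f = "\<lambda>x. iexp ((y /\<^sub>R e) \<bullet> x) * of_real (gauss x)"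
  have *: "?f (0 + e *\<^sub>R x) = iexp (y \<bullet> x) * of_real (gauss (e *\<^sub>R x))" for x
    using e by (simp add: mult.assoc[symmetric] flip: of_real_inverse of_real_mult)
  show "integrable lborel (\<lambda>x. iexp (y \<bullet> x) * of_real (gauss (e *\<^sub>R x)))"
    using lborel_integrable_affine[OF _ integrable_fourier_gauss, of e "y /\<^sub>R e" 0] e
    by (simp only: *)
  have "of_real (sqrt (2 * pi) ^ DIM('a) * gauss (y /\<^sub>R e)) = 
     \<bar>e\<bar> ^ DIM('a) *\<^sub>R (LINT x|lborel. iexp (y \<bullet> x) * of_real (gauss (e *\<^sub>R x)))"
    unfolding *[symmetric] integral_fourier_gauss[symmetric]
    using e by (intro lborel_integral_affine integrable_fourier_gauss) simp
  then show "(LINT x|lborel. iexp (y \<bullet> x) * of_real (gauss (e *\<^sub>R x))) =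
        of_real (sqrt (2 * pi) ^ DIM('a) / e ^ DIM('a) * gauss (y /\<^sub>R e))"
    using e by (simp add: scaleR_conv_of_real field_simps)
qed

text \<open>Gaussians of width \<open>1 / Suc k\<close> form an approximate identity. The scaling
  sits in the argument of \<open>f\<close> instead of in the kernel, so that
  \<open>B * gauss z\<close> dominates the integrands for all \<open>k\<close> at once.\<close>

lemma gauss_kernel_limit:
  fixes f :: "'a::euclidean_space \<Rightarrow> complex"
  assumes f: "continuous_on UNIV f" and B: "\<And>x. cmod (f x) \<le> B"
  shows "(\<lambda>k. LINT z|lborel. f (x + (1 / real (Suc k)) *\<^sub>R z) * of_real (gauss z))
    \<longlonglongrightarrow> f x * of_real (sqrt (2 * pi) ^ DIM('a))"
proof -
  have [measurable]: "f \<in> borel_measurable borel"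
    using f by (rule borel_measurable_continuous_onI)
  have "(\<lambda>k. LINT z|lborel. f (x + (1 / real (Suc k)) *\<^sub>R z) * of_real (gauss z))
    \<longlonglongrightarrow> (LINT z|lborel. f x * of_real (gauss (z::'a)))"
  proof (rule integral_dominated_convergence[where w="\<lambda>z::'a. B * gauss z"])
    show "integrable lborel (\<lambda>z::'a. B * gauss z)"
      by (intro integrable_mult_right integrable_gauss)
    have "(\<lambda>k. f (x + (1 / real (Suc k)) *\<^sub>R z)) \<longlonglongrightarrow> f x" for z
    proof -
      have "isCont f x" using f by (simp add: continuous_on_eq_continuous_at)
      moreover have "(\<lambda>k. x + (1 / real (Suc k)) *\<^sub>R z) \<longlonglongrightarrow> x + 0 *\<^sub>R z"
        by (intro tendsto_intros LIMSEQ_inverse_real_of_nat[unfolded inverse_eq_divide])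
      ultimately show ?thesis
        using isCont_tendsto_compose[of x f "\<lambda>k. x + (1 / real (Suc k)) *\<^sub>R z" sequentially]
        by (simp del: of_nat_Suc)
    qed
    then show "AE z in lborel. (\<lambda>k. f (x + (1 / real (Suc k)) *\<^sub>R z) * of_real (gauss z)) \<longlonglongrightarrow> f x * of_real (gauss z)"
      by (auto intro!: tendsto_intros)
    show "AE z in lborel. norm (f (x + (1 / real (Suc k)) *\<^sub>R z) * of_real (gauss z)) \<le> B * gauss z" for k
      using B by (auto simp: norm_mult abs_of_pos[OF gauss_pos] intro!: mult_right_mono less_imp_le[OF gauss_pos])
  qed auto
  then show ?thesis
    by (simp add: integral_gauss)
qed

section \<open>Vanishing against Gaussians, and completeness of square-integrable functions\<close>

text \<open>The product \<open>f x * g y\<close> is already integrable on the product space, and a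
  bounded measurable factor preserves this. The Fubini rule derived from it is applied to Gaussian
  kernels and to complex exponentials.\<close>

lemma integrable_bounded_kernel:
  fixes f :: "'a::euclidean_space \<Rightarrow> complex" and g :: "'b::euclidean_space \<Rightarrow> complex"
  assumes f: "integrable lborel f" and g: "integrable lborel g"
    and [measurable]: "K \<in> borel_measurable (borel \<Otimes>\<^sub>M borel)"
    and B: "\<And>x y. cmod (K (x, y)) \<le> B"
  shows "integrable (lborel \<Otimes>\<^sub>M lborel) (\<lambda>(x, y). f x * g y * K (x, y))"
proof -
  have [measurable]: "f \<in> borel_measurable borel" "g \<in> borel_measurable borel"
    using f g by simp_all
  have *: "integrable (lborel \<Otimes>\<^sub>M lborel) (\<lambda>(x, y). f x * g y)"
  proof (rule lborel_pair.Fubini_integrable)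
    show "integrable lborel (\<lambda>x. LINT y|lborel. norm (case (x, y) of (x, y) \<Rightarrow> f x * g y))"
      using f by (simp add: norm_mult)
    show "AE x in lborel. integrable lborel (\<lambda>y. case (x, y) of (x, y) \<Rightarrow> f x * g y)"
      using g by simp
  qed measurable
  have "integrable (lborel \<Otimes>\<^sub>M lborel) (\<lambda>z. B * norm (case z of (x, y) \<Rightarrow> f x * g y))"
    by (intro integrable_mult_right integrable_norm *)
  then show ?thesis
  proof (rule Bochner_Integration.integrable_bound)
    show "AE z in lborel \<Otimes>\<^sub>M lborel. norm (case z of (x, y) \<Rightarrow> f x * g y * K (x, y))
        \<le> norm (B * norm (case z of (x, y) \<Rightarrow> f x * g y))"
    proof (rule AE_I2, clarify)
      fix x y
      have "0 \<le> B" using B[of x y] norm_ge_zero order_trans by blast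
      then show "norm (f x * g y * K (x, y)) \<le> norm (B * norm (f x * g y))"
        using B[of x y] by (simp add: norm_mult mult_left_mono mult.commute[of B])
    qed
  qed measurable
qed

lemma Fubini_bounded_kernel:
  fixes f :: "'a::euclidean_space \<Rightarrow> complex" and g :: "'b::euclidean_space \<Rightarrow> complex"
  assumes f: "integrable lborel f" and g: "integrable lborel g"
    and K: "K \<in> borel_measurable (borel \<Otimes>\<^sub>M borel)"
    and B: "\<And>x y. cmod (K (x, y)) \<le> B"
  shows "(LINT x|lborel. f x * (LINT y|lborel. g y * K (x, y))) =
    (LINT y|lborel. g y * (LINT x|lborel. f x * K (x, y)))"
proof -
  have "(LINT x|lborel. f x * (LINT y|lborel. g y * K (x, y))) =
      (LINT x|lborel. LINT y|lborel. f x * g y * K (x, y))"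
    by (simp add: mult.assoc)
  also have "\<dots> = (LINT y|lborel. LINT x|lborel. f x * g y * K (x, y))"
    using integrable_bounded_kernel[OF assms]
    by (intro lborel_pair.Fubini_integral[symmetric])
  also have "\<dots> = (LINT y|lborel. LINT x|lborel. g y * (f x * K (x, y)))"
    by (simp add: mult.assoc mult.left_commute)
  finally show ?thesis by simp
qed

text \<open>The hypothesis says that all Gaussian averages of \<open>h\<close> vanish. Fubini moves
  the averaging onto a continuous bounded integrable \<open>k\<close>, and narrowing the Gaussian
  gives a zero integral of \<open>h * k\<close>. Approximating indicators by such \<open>k\<close>
  gives zero integrals over boxes, and an induction over the generated sigma-algebra extends this to
  all Borel sets.\<close>

lemma AE_zero_if_gauss_integrals_zero:
  fixes h :: "'a::euclidean_space \<Rightarrow> complex"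
  assumes h: "integrable lborel h"
    and zero: "\<And>y e. e > 0 \<Longrightarrow> (LINT x|lborel. h x * of_real (gauss ((x - y) /\<^sub>R e))) = 0"
  shows "AE x in lborel. h x = 0"
proof -
  have [measurable]: "h \<in> borel_measurable borel" using h by simp
  have int: "(LINT x|lborel. h x * k x) = 0"
    if k: "continuous_on UNIV k" "integrable lborel k" and B: "\<And>x. cmod (k x) \<le> B" for k and B :: real
  proof -
    have [measurable]: "k \<in> borel_measurable borel" using k by simp
    let ?S = "\<lambda>m x. LINT z|lborel. k (x + (1 / real (Suc m)) *\<^sub>R z) * of_real (gauss z)"
    have smooth_zero: "(LINT x|lborel. h x * ?S m x) = 0" for m
    proof -
      define e where "e = 1 / real (Suc m)"
      have e: "e > 0" by (simp add: e_def)
      let ?g = "\<lambda>x y. k y * of_real (gauss ((x - y) /\<^sub>R e))"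
      \<comment> \<open>The substitution \<open>y = x + e * z\<close> puts the integration variable
        into \<open>k\<close>, after which Fubini isolates the Gaussian average of \<open>h\<close>
        around \<open>y\<close>.\<close>
      have "?S m x = of_real (1 / e ^ DIM('a)) * (LINT y|lborel. ?g x y)" for x
      proof -
        have "integrable lborel (?g x)"
          by (rule Bochner_Integration.integrable_bound[OF k(2)])
            (auto simp: norm_mult abs_of_pos[OF gauss_pos] intro!: mult_left_le gauss_le_1)
        from lborel_integral_affine[OF _ this, of e x]
        have "(LINT y|lborel. ?g x y) = e ^ DIM('a) *\<^sub>R (LINT z|lborel. ?g x (x + e *\<^sub>R z))"
          using e by simp
        moreover have "?g x (x + e *\<^sub>R z) = k (x + e *\<^sub>R z) * of_real (gauss z)" for z
          using e by (simp add: gauss_minus)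
        ultimately show ?thesis
          using e unfolding e_def[symmetric] by (simp add: scaleR_conv_of_real gauss_minus)
      qed
      then have "(LINT x|lborel. h x * ?S m x) =
          (LINT x|lborel. of_real (1 / e ^ DIM('a)) * (h x * (LINT y|lborel. ?g x y)))"
        by (simp add: mult.left_commute)
      also have "\<dots> = of_real (1 / e ^ DIM('a)) * (LINT x|lborel. h x * (LINT y|lborel. ?g x y))"
        by (rule integral_mult_right_zero)
      also have "(LINT x|lborel. h x * (LINT y|lborel. ?g x y)) =
          (LINT y|lborel. k y * (LINT x|lborel. h x * of_real (gauss ((x - y) /\<^sub>R e))))"
        using Fubini_bounded_kernel[OF h k(2), of "\<lambda>(x, y). of_real (gauss ((x - y) /\<^sub>R e))" 1]
        by (simp add: abs_of_pos[OF gauss_pos] gauss_le_1)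
      also have "\<dots> = 0"
        by (simp add: zero[OF e])
      finally show ?thesis by simp
    qed
    have "(\<lambda>m. LINT x|lborel. h x * ?S m x) \<longlonglongrightarrow>
        (LINT x|lborel. h x * (k x * of_real (sqrt (2 * pi) ^ DIM('a))))"
    proof (rule integral_dominated_convergence[where w="\<lambda>x. cmod (h x) * (B * sqrt (2 * pi) ^ DIM('a))"])
      show "integrable lborel (\<lambda>x. cmod (h x) * (B * sqrt (2 * pi) ^ DIM('a)))"
        using h by (intro integrable_mult_left integrable_norm) auto
      show "AE x in lborel. (\<lambda>m. h x * ?S m x) \<longlonglongrightarrow> h x * (k x * of_real (sqrt (2 * pi) ^ DIM('a)))"
        by (intro AE_I2 tendsto_mult tendsto_const gauss_kernel_limit[OF k(1) B])
      have "cmod (?S m x) \<le> B * sqrt (2 * pi) ^ DIM('a)" for m x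
      proof -
        have "integrable lborel (\<lambda>z::'a. B * gauss z)"
          by (intro integrable_mult_right integrable_gauss)
        moreover have le: "norm (k (x + (1 / real (Suc m)) *\<^sub>R z) * of_real (gauss z)) \<le> B * gauss z" for z
          using B gauss_pos[of z] by (auto simp: norm_mult abs_of_pos intro!: mult_right_mono)
        moreover from this have "integrable lborel (\<lambda>z. k (x + (1 / real (Suc m)) *\<^sub>R z) * of_real (gauss z))"
          by (intro integrable_dominated[OF _ _ le]) (simp_all add: integrable_gauss)
        ultimately have "cmod (?S m x) \<le> (LINT z|lborel. B * gauss (z::'a))"
          by (intro Bochner_Integration.integral_norm_bound_integral)
        then show ?thesis by (simp add: integral_gauss)
      qed
      then show "AE x in lborel. norm (h x * ?S m x) \<le> cmod (h x) * (B * sqrt (2 * pi) ^ DIM('a))" for m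
        by (intro AE_I2) (simp add: norm_mult mult_left_mono)
    qed measurable
    then have "(LINT x|lborel. (h x * k x) * of_real (sqrt (2 * pi) ^ DIM('a))) = 0"
      unfolding smooth_zero mult.assoc by (simp add: LIMSEQ_const_iff)
    then show ?thesis by (simp del: of_real_power)
  qed
  have box: "(LINT x|lborel. indicator (box a b) x *\<^sub>R h x) = 0" for a b :: 'a
  proof -
    \<comment> \<open>These continuous functions increase with \<open>m\<close> to the indicator of
      the open box, since the distance to its complement is positive inside and 0 outside.\<close>
    let ?k = "\<lambda>m x. of_real (min 1 (real m * infdist x (- box a b))) :: complex"
    have [measurable]: "(\<lambda>x. infdist x (- box a b)) \<in> borel_measurable borel"
      by (intro borel_measurable_continuous_onI continuous_intros)
    \<comment> \<open>\<open>infdist\<close> from the empty set is 0 by convention, so the positive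
      distance inside the box depends on the complement being nonempty.\<close>
    have ne: "- box a b \<noteq> {}"
      using bounded_box[of a b] not_bounded_UNIV by (metis Compl_empty_eq double_compl)
    have out: "?k m x = 0" if "x \<notin> box a b" for m x
      using that by simp
    have norm_le: "cmod (?k m x) \<le> indicator (box a b) x" for m x
      using out[of x m] by (cases "x \<in> box a b") (auto simp: infdist_nonneg)
    have "(LINT x|lborel. h x * ?k m x) = 0" for m
    proof (rule int[of _ 1])
      show "continuous_on UNIV (?k m)"
        by (intro continuous_intros)
      then have [measurable]: "?k m \<in> borel_measurable borel"
        by (rule borel_measurable_continuous_onI)
      have "integrable lborel (indicator (box a b) :: 'a \<Rightarrow> real)"
        by (simp add: emeasure_lborel_box_eq)
      then show "integrable lborel (?k m)"
        by (rule integrable_dominated[OF _ _ norm_le]) simp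
      show "cmod (?k m x) \<le> 1" for x
        using norm_le[of m x] by (auto split: split_indicator_asm)
    qed
    moreover have "(\<lambda>m. LINT x|lborel. h x * ?k m x) \<longlonglongrightarrow> (LINT x|lborel. indicator (box a b) x *\<^sub>R h x)"
    proof (rule integral_dominated_convergence[where w="\<lambda>x. cmod (h x)"])
      show "integrable lborel (\<lambda>x. cmod (h x))" using h by (rule integrable_norm)
      show "AE x in lborel. norm (h x * ?k m x) \<le> cmod (h x)" for m
        unfolding norm_mult
        by (intro AE_I2 mult_left_le) (use norm_le[of m] in \<open>auto intro: order_trans split: split_indicator_asm\<close>)
      have "(\<lambda>m. ?k m x) \<longlonglongrightarrow> indicator (box a b) x" for x
      proof (cases "x \<in> box a b")
        case True
        then have "infdist x (- box a b) > 0"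
          using ne by (intro infdist_pos_not_in_closed) (auto simp: open_box closed_Compl)
        then obtain M where M: "1 < real M * infdist x (- box a b)"
          using reals_Archimedean3 by blast
        have "eventually (\<lambda>m. ?k m x = 1) sequentially"
          using eventually_ge_at_top[of M]
        proof eventually_elim
          case (elim m)
          then have "real M * infdist x (- box a b) \<le> real m * infdist x (- box a b)"
            by (intro mult_right_mono) (auto simp: infdist_nonneg)
          with M show ?case by simp
        qed
        then show ?thesis using True by (simp add: tendsto_eventually)
      next
        case False
        then show ?thesis using out[OF False] by simp
      qed
      then have "(\<lambda>m. h x * ?k m x) \<longlonglongrightarrow> h x * indicator (box a b) x" for x
        by (intro tendsto_mult tendsto_const)
      moreover have "h x * indicator (box a b) x = indicator (box a b) x *\<^sub>R h x" for x
        by (simp split: split_indicator)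
      ultimately show "AE x in lborel. (\<lambda>m. h x * ?k m x) \<longlonglongrightarrow> indicator (box a b) x *\<^sub>R h x"
        by simp
    qed measurable
    ultimately show ?thesis by (simp add: LIMSEQ_const_iff)
  qed
  \<comment> \<open>Complements in the induction below are subtracted from the whole space. Here the
    Gaussians become wide instead of narrow and tend to the constant 1.\<close>
  have total: "(LINT x|lborel. h x) = 0"
  proof -
    have "(\<lambda>m. LINT x|lborel. h x * of_real (gauss ((x - 0) /\<^sub>R real (Suc m)))) \<longlonglongrightarrow> (LINT x|lborel. h x)"
    proof (rule integral_dominated_convergence[where w="\<lambda>x. cmod (h x)"])
      show "integrable lborel (\<lambda>x. cmod (h x))" using h by (rule integrable_norm)
      show "AE x in lborel. norm (h x * of_real (gauss ((x - 0) /\<^sub>R real (Suc m)))) \<le> cmod (h x)" for m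
        by (auto simp: norm_mult abs_of_pos[OF gauss_pos] intro!: mult_left_le gauss_le_1)
      have "(\<lambda>m. gauss ((x - 0) /\<^sub>R real (Suc m))) \<longlonglongrightarrow> 1" for x :: 'a
      proof -
        have "(\<lambda>m. exp (- (norm (inverse (real (Suc m)) *\<^sub>R x))\<^sup>2 / 2)) \<longlonglongrightarrow> exp (- (norm (0 *\<^sub>R x))\<^sup>2 / 2)"
          by (intro tendsto_intros LIMSEQ_inverse_real_of_nat) simp
        then show ?thesis by (simp add: gauss_def)
      qed
      then have "(\<lambda>m. h x * of_real (gauss ((x - 0) /\<^sub>R real (Suc m)))) \<longlonglongrightarrow> h x * of_real 1" for x
        by (intro tendsto_mult tendsto_const tendsto_of_real)
      then show "AE x in lborel. (\<lambda>m. h x * of_real (gauss ((x - 0) /\<^sub>R real (Suc m)))) \<longlonglongrightarrow> h x"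
        by simp
    qed measurable
    moreover have "(LINT x|lborel. h x * of_real (gauss ((x - 0) /\<^sub>R real (Suc m)))) = 0" for m
      by (rule zero) simp
    ultimately show ?thesis by (simp only: LIMSEQ_const_iff)
  qed
  have "(LINT x|lborel. indicator A x *\<^sub>R h x) = 0" if "A \<in> sets lborel" for A
  proof -
    have ind: "integrable lborel (\<lambda>x. indicator A x *\<^sub>R h x)" if "A \<in> sets borel" for A
      using that h by (intro integrable_mult_indicator) auto
    have sets_eq: "sets borel = sigma_sets UNIV (range (\<lambda>(a, b). box a b :: 'a set))"
      by (subst borel_eq_box) (auto simp: sets_measure_of_conv)
    have "Int_stable (range (\<lambda>(a, b). box a b :: 'a set))"
      by (auto simp: Int_stable_def box_Int_box)
    moreover have "range (\<lambda>(a, b). box a b :: 'a set) \<subseteq> Pow UNIV"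
      by simp
    moreover have "A \<in> sigma_sets UNIV (range (\<lambda>(a, b). box a b))"
      using that unfolding sets_lborel sets_eq .
    ultimately show ?thesis
    proof (induction rule: sigma_sets_induct_disjoint)
      case (basic A)
      then show ?case using box by auto
    next
      case (compl A)
      then have "A \<in> sets borel" by (simp add: sets_eq)
      moreover have "indicator (UNIV - A) x *\<^sub>R h x = h x - indicator A x *\<^sub>R h x" for x
        by (auto split: split_indicator)
      ultimately show ?case using compl total ind h by simp
    next
      case (union A)
      then have A: "A i \<in> sets borel" for i by (auto simp: sets_eq)
      have "(LINT x:(\<Union>i. A i)|lborel. h x) = (\<Sum>i. (LINT x:(A i)|lborel. h x))"
        using union(1) A ind[of "\<Union>i. A i"]
        by (intro lebesgue_integral_countable_add) (auto simp: disjoint_family_on_def set_integrable_def)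
      then show ?case using union by (simp add: set_lebesgue_integral_def)
    qed auto
  qed
  then show ?thesis
    by (intro sigma_finite_measure.density_zero[OF sigma_finite_lborel h]) (simp add: set_lebesgue_integral_def)
qed

section \<open>Completeness of square-integrable functions\<close>

lemma cmod_add_square_le: "(cmod (a + b))\<^sup>2 \<le> 2 * (cmod a)\<^sup>2 + 2 * (cmod b)\<^sup>2"
proof -
  have "(cmod (a + b))\<^sup>2 \<le> (cmod a + cmod b)\<^sup>2"
    by (intro power_mono norm_triangle_ineq) simp
  also have "\<dots> \<le> 2 * (cmod a)\<^sup>2 + 2 * (cmod b)\<^sup>2"
    using sum_squares_bound[of "cmod a" "cmod b"] by (simp add: power2_sum)
  finally show ?thesis .
qed

lemma cmod_diff_square_le: "(cmod (a - b))\<^sup>2 \<le> 2 * (cmod a)\<^sup>2 + 2 * (cmod b)\<^sup>2"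
  using cmod_add_square_le[of a "- b"] by (simp only: diff_conv_add_uminus norm_minus_cancel)

text \<open>The Riesz-Fischer argument: a subsequence with quickly shrinking steps converges almost
  everywhere, and Fatou's lemma carries the Cauchy estimate over to its limit.\<close>

lemma L2_complete:
  fixes h :: "nat \<Rightarrow> 'a \<Rightarrow> complex"
  assumes meas [measurable]: "\<And>j. h j \<in> borel_measurable M"
    and int: "\<And>j. integrable M (\<lambda>x. (cmod (h j x))\<^sup>2)"
    and Cauchy: "\<And>e. e > 0 \<Longrightarrow> \<exists>N. \<forall>i\<ge>N. \<forall>j\<ge>N. (LINT x|M. (cmod (h i x - h j x))\<^sup>2) < e"
  obtains H where "H \<in> borel_measurable M" "integrable M (\<lambda>x. (cmod (H x))\<^sup>2)"
    "(\<lambda>j. LINT x|M. (cmod (h j x - H x))\<^sup>2) \<longlonglongrightarrow> 0"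
proof -
  have int_diff: "integrable M (\<lambda>x. (cmod (f x - g x))\<^sup>2)"
    if [measurable]: "f \<in> borel_measurable M" "g \<in> borel_measurable M"
      and "integrable M (\<lambda>x. (cmod (f x))\<^sup>2)" "integrable M (\<lambda>x. (cmod (g x))\<^sup>2)" for f g :: "'a \<Rightarrow> complex"
    by (rule Bochner_Integration.integrable_bound[of _ "\<lambda>x. 2 * (cmod (f x))\<^sup>2 + 2 * (cmod (g x))\<^sup>2"])
      (use that cmod_diff_square_le in auto)
  obtain N where N: "\<And>k i j. i \<ge> N k \<Longrightarrow> j \<ge> N k \<Longrightarrow> (LINT x|M. (cmod (h i x - h j x))\<^sup>2) < (1/4)^k"
  proof -
    have "\<forall>k. \<exists>N. \<forall>i\<ge>N. \<forall>j\<ge>N. (LINT x|M. (cmod (h i x - h j x))\<^sup>2) < (1/4)^k"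
      by (intro allI Cauchy) simp
    then show ?thesis
      using that by (auto dest!: choice)
  qed
  \<comment> \<open>The thresholds \<open>N\<close> need not be monotone; their partial sums
    dominate all earlier ones.\<close>
  define n where "n k = (\<Sum>i\<le>k. N i)" for k
  have n_ge: "n k \<ge> N m" if "m \<le> k" for m k
    unfolding n_def using that by (intro member_le_sum) auto
  have nn: "(\<integral>\<^sup>+x. ennreal ((cmod (h i x - h j x))\<^sup>2) \<partial>M) \<le> ennreal ((1/4)^k)" if "i \<ge> N k" "j \<ge> N k" for i j k
    using N[OF that] by (subst nn_integral_eq_integral) (auto intro!: int_diff int ennreal_leI)
  \<comment> \<open>The squared steps have integrals of at most \<open>(1/4)^k\<close>. A weight
    \<open>2^k\<close> can thus be inserted and still leaves a summable series, and this weight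
    makes the steps themselves summable pointwise.\<close>
  define d where "d k x = h (n (Suc k)) x - h (n k) x" for k x
  have [measurable]: "d k \<in> borel_measurable M" for k
    unfolding d_def by measurable
  have "(\<integral>\<^sup>+x. (\<Sum>k. ennreal (2^k * (cmod (d k x))\<^sup>2)) \<partial>M) = (\<Sum>k. \<integral>\<^sup>+x. ennreal (2^k * (cmod (d k x))\<^sup>2) \<partial>M)"
    by (rule nn_integral_suminf) simp
  also have "\<dots> \<le> (\<Sum>k. ennreal ((1/2)^k))"
  proof (intro suminf_le)
    fix k
    have "(\<integral>\<^sup>+x. ennreal (2^k * (cmod (d k x))\<^sup>2) \<partial>M) = ennreal (2^k) * (\<integral>\<^sup>+x. ennreal ((cmod (d k x))\<^sup>2) \<partial>M)"
      by (subst nn_integral_cmult[symmetric]) (auto simp: ennreal_mult)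
    also have "\<dots> \<le> ennreal (2^k) * ennreal ((1/4)^k)"
      unfolding d_def by (intro mult_left_mono nn n_ge) auto
    also have "\<dots> = ennreal ((1/2)^k)"
      by (simp add: ennreal_mult[symmetric] power_mult_distrib[symmetric] del: ennreal_power)
    finally show "(\<integral>\<^sup>+x. ennreal (2^k * (cmod (d k x))\<^sup>2) \<partial>M) \<le> ennreal ((1/2)^k)" .
  qed auto
  also have "\<dots> < \<infinity>"
    by (subst suminf_ennreal2) (auto simp: summable_geometric)
  finally have "AE x in M. (\<Sum>k. ennreal (2^k * (cmod (d k x))\<^sup>2)) \<noteq> \<infinity>"
    by (intro nn_integral_PInf_AE) auto
  then have conv: "AE x in M. convergent (\<lambda>k. h (n k) x)"
  proof eventually_elim
    case (elim x)
    then have s: "summable (\<lambda>k. 2^k * (cmod (d k x))\<^sup>2)"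
      by (intro summable_suminf_not_top) auto
    have "summable (\<lambda>k. (2^k * (cmod (d k x))\<^sup>2 + (1/2)^k) / 2)"
      by (intro summable_divide summable_add s) (simp add: summable_geometric)
    moreover have "norm (d k x) \<le> (2^k * (cmod (d k x))\<^sup>2 + (1/2)^k) / 2" for k
    proof -
      \<comment> \<open>The arithmetic-geometric mean inequality bounds a step by its weighted
        square plus a geometric term, in place of the Cauchy-Schwarz inequality for series.\<close>
      have "0 \<le> (2^k * cmod (d k x) - 1)\<^sup>2 / 2^k" by simp
      also have "\<dots> = 2^k * (cmod (d k x))\<^sup>2 + (1/2)^k - 2 * cmod (d k x)"
        by (simp add: power2_diff power_divide field_simps power2_eq_square)
      finally show ?thesis by simp
    qed
    ultimately have "summable (\<lambda>k. d k x)"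
      by (rule summable_comparison_test'[where N=0])
    then have "convergent (\<lambda>k. \<Sum>j<k. d j x)"
      by (simp add: summable_iff_convergent)
    moreover have "(\<Sum>j<k. d j x) = h (n k) x - h (n 0) x" for k
      unfolding d_def by (rule sum_lessThan_telescope)
    ultimately have "convergent (\<lambda>k. h (n k) x - h (n 0) x)"
      by simp
    from convergent_add[OF this convergent_const[of "h (n 0) x"]] show ?case
      by simp
  qed
  define H where "H x = lim (\<lambda>k. h (n k) x)" for x
  have [measurable]: "H \<in> borel_measurable M"
    unfolding H_def by measurable
  have "(\<integral>\<^sup>+x. ennreal ((cmod (h i x - H x))\<^sup>2) \<partial>M) \<le> ennreal ((1/4)^m)" if i: "i \<ge> N m" for i m
  proof -
    have "(\<integral>\<^sup>+x. ennreal ((cmod (h i x - H x))\<^sup>2) \<partial>M) =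
        (\<integral>\<^sup>+x. liminf (\<lambda>k. ennreal ((cmod (h i x - h (n k) x))\<^sup>2)) \<partial>M)"
    proof (intro nn_integral_cong_AE, use conv in eventually_elim)
      case (elim x)
      then have "(\<lambda>k. h (n k) x) \<longlonglongrightarrow> H x"
        by (simp add: H_def convergent_LIMSEQ_iff)
      then have "(\<lambda>k. ennreal ((cmod (h i x - h (n k) x))\<^sup>2)) \<longlonglongrightarrow> ennreal ((cmod (h i x - H x))\<^sup>2)"
        by (intro tendsto_intros)
      then show ?case
        by (intro lim_imp_Liminf[symmetric]) auto
    qed
    also have "\<dots> \<le> liminf (\<lambda>k. \<integral>\<^sup>+x. ennreal ((cmod (h i x - h (n k) x))\<^sup>2) \<partial>M)"
      by (rule nn_integral_liminf) simp
    also have "\<dots> \<le> ennreal ((1/4)^m)"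
    proof -
      have "eventually (\<lambda>k. (\<integral>\<^sup>+x. ennreal ((cmod (h i x - h (n k) x))\<^sup>2) \<partial>M) \<le> ennreal ((1/4)^m)) sequentially"
        using eventually_ge_at_top[of m] by eventually_elim (intro nn n_ge i)
      from Liminf_mono[OF this] show ?thesis by (simp add: Liminf_const)
    qed
    finally show ?thesis .
  qed
  then have intH: "integrable M (\<lambda>x. (cmod (h i x - H x))\<^sup>2)"
    and leH: "(LINT x|M. (cmod (h i x - H x))\<^sup>2) \<le> (1/4)^m" if "i \<ge> N m" for i m
  proof -
    note le = \<open>\<And>m i. N m \<le> i \<Longrightarrow> (\<integral>\<^sup>+x. ennreal ((cmod (h i x - H x))\<^sup>2) \<partial>M) \<le> ennreal ((1/4)^m)\<close>[OF that]
    show *: "integrable M (\<lambda>x. (cmod (h i x - H x))\<^sup>2)"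
      using le by (intro integrableI_nonneg) (auto simp: less_top intro: le_less_trans)
    show "(LINT x|M. (cmod (h i x - H x))\<^sup>2) \<le> (1/4)^m"
      using le by (subst (asm) nn_integral_eq_integral[OF *]) auto
  qed
  show ?thesis
  proof
    have "integrable M (\<lambda>x. (cmod (h (N 0) x - (h (N 0) x - H x)))\<^sup>2)"
      by (rule int_diff) (simp_all add: int intH[of 0])
    then show "integrable M (\<lambda>x. (cmod (H x))\<^sup>2)" by simp
    show "(\<lambda>j. LINT x|M. (cmod (h j x - H x))\<^sup>2) \<longlonglongrightarrow> 0"
    proof (rule LIMSEQ_I)
      fix r :: real assume "0 < r"
      then obtain m where m: "(1/4)^m < r"
        using real_arch_pow_inv[of r "1/4"] by auto
      show "\<exists>no. \<forall>j\<ge>no. norm ((LINT x|M. (cmod (h j x - H x))\<^sup>2) - 0) < r"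
        using leH m by (intro exI[of _ "N m"]) (auto intro: le_less_trans)
    qed
  qed measurable
qed

section \<open>The Schwartz space\<close>

definition rapid :: "('a::euclidean_space \<Rightarrow> complex) \<Rightarrow> bool" where
  "rapid f \<longleftrightarrow> (\<forall>k::nat. \<exists>C. \<forall>x. (1 + norm x) ^ k * cmod (f x) \<le> C)"

abbreviation pd :: "'a::euclidean_space \<Rightarrow> ('a \<Rightarrow> complex) \<Rightarrow> 'a \<Rightarrow> complex" where
  "pd b f \<equiv> \<lambda>x. frechet_derivative f (at x) b"

lemma pd_eq: "(f has_derivative f') (at x) \<Longrightarrow> pd b f x = f' b"
  using frechet_derivative_at by metis

lemma has_derivative_pd:
  "f differentiable (at x) \<Longrightarrow> (f has_derivative (\<lambda>b. pd b f x)) (at x)"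
  by (simp add: frechet_derivative_works)

lemma iter_pd_append: "iter_pd (as @ bs) f = iter_pd as (iter_pd bs f)"
  by (induction as) auto

lemma schwartz_iff:
  "f \<in> schwartz_functions \<longleftrightarrow>
    (\<forall>bs\<in>lists Basis. (\<forall>x. iter_pd bs f differentiable (at x)) \<and> rapid (iter_pd bs f))"
proof -
  have "bounded (range (\<lambda>x. (1 + norm x) ^ k *\<^sub>R g x)) \<longleftrightarrow> (\<exists>C. \<forall>x. (1 + norm x) ^ k * cmod (g x) \<le> C)"
    for k and g :: "'a \<Rightarrow> complex"
    by (simp add: bounded_iff)
  then show ?thesis
    unfolding schwartz_functions_def smooth_def rapid_def by blast
qed

text \<open>The Schwartz space is the largest set of differentiable, rapidly decreasing functions
  that is closed under partial derivatives. Membership can thus be shown by computing one derivative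
  at a time, without formulas for iterated derivatives.\<close>

lemma schwartz_coinduct:
  assumes "f \<in> S"
    and diff: "\<And>g x. g \<in> S \<Longrightarrow> g differentiable (at x)"
    and rapid: "\<And>g. g \<in> S \<Longrightarrow> rapid g"
    and pd: "\<And>g b. g \<in> S \<Longrightarrow> b \<in> Basis \<Longrightarrow> pd b g \<in> S"
  shows "f \<in> schwartz_functions"
proof -
  have "iter_pd bs f \<in> S" if "bs \<in> lists Basis" for bs
    using that \<open>f \<in> S\<close> by (induction bs) (auto intro: pd)
  then show ?thesis
    unfolding schwartz_iff using diff rapid by blast
qed

lemma schwartz_pd: "f \<in> schwartz_functions \<Longrightarrow> b \<in> Basis \<Longrightarrow> pd b f \<in> schwartz_functions"
  unfolding schwartz_iff
proof (intro ballI)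
  fix bs :: "'a list" assume f: "\<forall>bs\<in>lists Basis. (\<forall>x. iter_pd bs f differentiable at x) \<and> rapid (iter_pd bs f)"
    and b: "b \<in> Basis" and bs: "bs \<in> lists Basis"
  \<comment> \<open>\<open>iter_pd\<close> applies the last entry of the list first, so a derivative
    that is taken beforehand goes to the end.\<close>
  have "bs @ [b] \<in> lists Basis" using b bs by simp
  from f[rule_format, OF this] show "(\<forall>x. iter_pd bs (pd b f) differentiable at x) \<and> rapid (iter_pd bs (pd b f))"
    by (simp add: iter_pd_append)
qed

lemma schwartz_differentiable: "f \<in> schwartz_functions \<Longrightarrow> f differentiable (at x)"
  unfolding schwartz_iff by (metis iter_pd.simps(1) lists.Nil)

lemma schwartz_rapid: "f \<in> schwartz_functions \<Longrightarrow> rapid f"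
  unfolding schwartz_iff by (metis iter_pd.simps(1) lists.Nil)

lemma schwartz_continuous: "f \<in> schwartz_functions \<Longrightarrow> continuous_on UNIV f"
  by (simp add: schwartz_differentiable continuous_at_imp_continuous_on differentiable_imp_continuous_within)

lemma schwartz_measurable: "f \<in> schwartz_functions \<Longrightarrow> f \<in> borel_measurable borel"
  by (intro borel_measurable_continuous_onI schwartz_continuous)

lemma rapid_bound:
  assumes "rapid f" obtains C where "C \<ge> 0" "\<And>x. (1 + norm x) ^ k * cmod (f x) \<le> C"
proof -
  obtain C where C: "\<And>x. (1 + norm x) ^ k * cmod (f x) \<le> C"
    using assms unfolding rapid_def by blast
  moreover have "C \<ge> 0" using C[of 0] by (simp add: order_trans[OF norm_ge_zero])
  ultimately show ?thesis using that by blast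
qed

lemma rapid_add: "rapid f \<Longrightarrow> rapid g \<Longrightarrow> rapid (\<lambda>x. f x + g x)"
  unfolding rapid_def
proof
  fix k assume "\<forall>k. \<exists>C. \<forall>x. (1 + norm x) ^ k * cmod (f x) \<le> C" "\<forall>k. \<exists>C. \<forall>x. (1 + norm x) ^ k * cmod (g x) \<le> C"
  then obtain C D where C: "\<And>x. (1 + norm x) ^ k * cmod (f x) \<le> C" and D: "\<And>x. (1 + norm x) ^ k * cmod (g x) \<le> D"
    by meson
  have "(1 + norm x) ^ k * cmod (f x + g x) \<le> C + D" for x
  proof -
    have "(1 + norm x) ^ k * cmod (f x + g x) \<le> (1 + norm x) ^ k * (cmod (f x) + cmod (g x))"
      by (intro mult_left_mono norm_triangle_ineq) simp
    then show ?thesis using C[of x] D[of x] by (simp add: distrib_left)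
  qed
  then show "\<exists>C. \<forall>x. (1 + norm x) ^ k * cmod (f x + g x) \<le> C" by blast
qed

lemma rapid_mult_polynomial_growth:
  assumes f: "rapid f" and m: "\<And>x. cmod (m x) \<le> B * (1 + norm x) ^ j"
  shows "rapid (\<lambda>x. m x * f x)"
  unfolding rapid_def
proof
  fix k
  obtain C where C: "\<And>x. (1 + norm x) ^ (k + j) * cmod (f x) \<le> C"
    using rapid_bound[OF f] by metis
  have B: "B \<ge> 0" using m[of 0] by (simp add: order_trans[OF norm_ge_zero])
  have "(1 + norm x) ^ k * cmod (m x * f x) \<le> B * C" for x
  proof -
    have "(1 + norm x) ^ k * cmod (m x * f x) \<le> (1 + norm x) ^ k * ((B * (1 + norm x) ^ j) * cmod (f x))"
      unfolding norm_mult by (intro mult_left_mono mult_right_mono m) auto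
    also have "\<dots> = B * ((1 + norm x) ^ (k + j) * cmod (f x))"
      by (simp add: power_add)
    also have "\<dots> \<le> B * C" by (intro mult_left_mono C B)
    finally show ?thesis .
  qed
  then show "\<exists>C. \<forall>x. (1 + norm x) ^ k * cmod (m x * f x) \<le> C" by blast
qed

lemma rapid_scale: "rapid f \<Longrightarrow> rapid (\<lambda>x. c * f x)"
  by (rule rapid_mult_polynomial_growth[of f "\<lambda>_. c" "cmod c" 0]) auto

lemma rapid_coord:
  assumes "b \<in> Basis" "rapid f" shows "rapid (\<lambda>x. of_real (x \<bullet> b) * f x)"
proof (rule rapid_mult_polynomial_growth[where B = 1 and j = 1])
  show "cmod (of_real (x \<bullet> b)) \<le> 1 * (1 + norm x) ^ 1" for x
    using Basis_le_norm[OF assms(1), of x] by simp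
qed fact

text \<open>The estimate is made for the \<open>k\<close>-th root: \<open>1 + norm x\<close> is at
  most a constant times \<open>exp (a * r^2 / k)\<close>, where \<open>r\<close> is the distance to
  the centre, by \<open>1 + u \<le> exp u\<close>. The case \<open>k = 0\<close> is split off
  because of the division.\<close>

lemma rapid_gaussian:
  fixes c :: "'a::euclidean_space"
  assumes a: "a > 0"
  shows "rapid (\<lambda>x. of_real (exp (- a * ((x - c) \<bullet> (x - c)))))"
  unfolding rapid_def
proof
  fix k :: nat
  \<comment> \<open>The first factor passes from \<open>1 + norm x\<close> to \<open>1 + r\<close>.
    The second makes \<open>(2 + k / a) * (1 + a * r^2 / k)\<close> exceed \<open>2 + r^2\<close>,
    which in turn exceeds \<open>1 + r\<close>.\<close>
  define M where "M = (1 + norm c) * (2 + real k / a)"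
  have "(1 + norm x) ^ k * exp (- a * ((x - c) \<bullet> (x - c))) \<le> M ^ k" for x :: 'a
  proof (cases "k = 0")
    case False
    define r where "r = norm (x - c)"
    have r: "r \<ge> 0" by (simp add: r_def)
    have "1 + norm x \<le> (1 + norm c) * (1 + r)"
    proof -
      have "norm x \<le> norm c + r" unfolding r_def by (rule norm_triangle_sub)
      moreover have "0 \<le> norm c * r" using r by simp
      moreover have "(1 + norm c) * (1 + r) = 1 + norm c + r + norm c * r" by (simp add: algebra_simps)
      ultimately show ?thesis by linarith
    qed
    also have "1 + r \<le> (2 + real k / a) * (1 + a * r\<^sup>2 / real k)"
    proof -
      have "0 \<le> (r - 1)\<^sup>2" "0 \<le> r\<^sup>2" by simp_all
      then have "1 + r \<le> 2 + r\<^sup>2" using r by (simp add: power2_eq_square algebra_simps)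
      also have "\<dots> \<le> 2 + real k / a + (2 * a * r\<^sup>2 / real k + r\<^sup>2)"
        using a by simp
      also have "\<dots> = (2 + real k / a) * (1 + a * r\<^sup>2 / real k)"
        using a False by (simp add: field_simps)
      finally show ?thesis .
    qed
    also have "1 + a * r\<^sup>2 / real k \<le> exp (a * r\<^sup>2 / real k)"
      by (rule exp_ge_add_one_self)
    finally have "1 + norm x \<le> M * exp (a * r\<^sup>2 / real k)"
      unfolding M_def using a by (simp add: mult_left_mono mult.assoc)
    then have "(1 + norm x) ^ k \<le> (M * exp (a * r\<^sup>2 / real k)) ^ k"
      by (intro power_mono) auto
    also have "\<dots> = M ^ k * exp (a * r\<^sup>2)"
      using False by (simp add: power_mult_distrib exp_of_nat_mult[symmetric])
    finally have "(1 + norm x) ^ k * exp (- (a * r\<^sup>2)) \<le> M ^ k * exp (a * r\<^sup>2) * exp (- (a * r\<^sup>2))"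
      by (rule mult_right_mono) simp
    also have "\<dots> = M ^ k" by (simp add: mult.assoc flip: exp_add)
    finally show ?thesis by (simp add: r_def power2_norm_eq_inner)
  qed (use a in simp)
  then show "\<exists>C. \<forall>x. (1 + norm x) ^ k * cmod (of_real (exp (- a * ((x - c) \<bullet> (x - c))))) \<le> C"
    by auto
qed

text \<open>Coinduction needs a set closed under partial derivatives, and the derivative of a product with a
  coordinate or of a Gaussian involves the other operations; so all of them are adjoined at once.\<close>

inductive_set schwartz_closure :: "('a::euclidean_space \<Rightarrow> complex) set" where
  base: "f \<in> schwartz_functions \<Longrightarrow> f \<in> schwartz_closure"
| gaussian: "a > 0 \<Longrightarrow> (\<lambda>x. of_real (exp (- a * ((x - c) \<bullet> (x - c))))) \<in> schwartz_closure"
| add: "f \<in> schwartz_closure \<Longrightarrow> g \<in> schwartz_closure \<Longrightarrow> (\<lambda>x. f x + g x) \<in> schwartz_closure"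
| scale: "f \<in> schwartz_closure \<Longrightarrow> (\<lambda>x. c * f x) \<in> schwartz_closure"
| coord: "f \<in> schwartz_closure \<Longrightarrow> b \<in> Basis \<Longrightarrow> (\<lambda>x. of_real (x \<bullet> b) * f x) \<in> schwartz_closure"

text \<open>The three conjuncts are the premises of \<open>schwartz_coinduct\<close> for the set
  \<open>schwartz_closure\<close>. They are proved together because \<open>rapid\<close> for a sum
  or a multiple comes from the same induction hypothesis as the derivative.\<close>

lemma schwartz_closure_step:
  "f \<in> schwartz_closure \<Longrightarrow>
    (\<forall>x. f differentiable (at x)) \<and> rapid f \<and> (\<forall>b\<in>Basis. pd b f \<in> schwartz_closure)"
proof (induction rule: schwartz_closure.induct)
  case (base f)
  then show ?case
    by (auto intro: schwartz_closure.base schwartz_pd schwartz_differentiable schwartz_rapid)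
next
  case (gaussian a c)
  let ?E = "\<lambda>x. of_real (exp (- a * ((x - c) \<bullet> (x - c)))) :: complex"
  have D: "(?E has_derivative (\<lambda>h. of_real (- 2 * a * ((x - c) \<bullet> h)) * ?E x)) (at x)" for x
    by (rule has_derivative_eq_rhs, (rule derivative_intros)+)
      (auto simp: fun_eq_iff inner_commute algebra_simps)
  have "pd b ?E = (\<lambda>x. of_real (- 2 * a) * (of_real (x \<bullet> b) * ?E x) + of_real (2 * a * (c \<bullet> b)) * ?E x)" for b
    by (rule ext, subst pd_eq[OF D]) (simp add: inner_diff_left algebra_simps)
  moreover have "(\<lambda>x. of_real (- 2 * a) * (of_real (x \<bullet> b) * ?E x) + of_real (2 * a * (c \<bullet> b)) * ?E x) \<in> schwartz_closure"
    if "b \<in> Basis" for b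
    using gaussian that
    by (intro schwartz_closure.add schwartz_closure.scale schwartz_closure.coord schwartz_closure.gaussian)
  ultimately show ?case
    using D rapid_gaussian[OF gaussian, of c] unfolding differentiable_def by auto
next
  case (add f g)
  then have *: "((\<lambda>x. f x + g x) has_derivative (\<lambda>b. pd b f x + pd b g x)) (at x)" for x
    by (intro has_derivative_add has_derivative_pd) auto
  have "pd b (\<lambda>x. f x + g x) = (\<lambda>x. pd b f x + pd b g x)" for b
    by (rule ext) (rule pd_eq[OF *])
  then show ?case
    using add * by (auto intro: schwartz_closure.add rapid_add simp: differentiable_def)
next
  case (scale f c)
  then have *: "((\<lambda>x. c * f x) has_derivative (\<lambda>b. c * pd b f x)) (at x)" for x
    by (intro has_derivative_mult_right has_derivative_pd) auto
  have "pd b (\<lambda>x. c * f x) = (\<lambda>x. c * pd b f x)" for b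
    by (rule ext) (rule pd_eq[OF *])
  then show ?case
    using scale * by (auto intro: schwartz_closure.scale rapid_scale simp: differentiable_def)
next
  case (coord f b')
  then have *: "((\<lambda>x. of_real (x \<bullet> b') * f x) has_derivative
      (\<lambda>b. of_real (x \<bullet> b') * pd b f x + of_real (b \<bullet> b') * f x)) (at x)" for x
    by (intro has_derivative_mult has_derivative_pd has_derivative_of_real has_derivative_inner_left has_derivative_ident) auto
  have "pd b (\<lambda>x. of_real (x \<bullet> b') * f x) = (\<lambda>x. of_real (x \<bullet> b') * pd b f x + of_real (b \<bullet> b') * f x)" for b
    by (rule ext) (rule pd_eq[OF *])
  moreover have "(\<lambda>x. of_real (x \<bullet> b') * pd b f x + of_real (b \<bullet> b') * f x) \<in> schwartz_closure"
    if "b \<in> Basis" for b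
    using coord that by (intro schwartz_closure.add schwartz_closure.coord schwartz_closure.scale) auto
  ultimately show ?case
    using coord * by (auto intro: rapid_coord simp: differentiable_def)
qed

text \<open>By coinduction the closure adds nothing new, so each of its introduction rules becomes a
  closure property of the Schwartz space.\<close>

lemma schwartz_closure_eq: "schwartz_closure = schwartz_functions"
proof
  show "schwartz_closure \<subseteq> schwartz_functions"
    by (rule subsetI, erule schwartz_coinduct) (use schwartz_closure_step in blast)+
qed (auto intro: schwartz_closure.base)

lemmas schwartz_gaussian = schwartz_closure.gaussian[unfolded schwartz_closure_eq]
  and schwartz_add = schwartz_closure.add[unfolded schwartz_closure_eq]
  and schwartz_scale = schwartz_closure.scale[unfolded schwartz_closure_eq]
  and schwartz_coord = schwartz_closure.coord[unfolded schwartz_closure_eq]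

lemma schwartz_diff:
  assumes "f \<in> schwartz_functions" "g \<in> schwartz_functions"
  shows "(\<lambda>x. f x - g x) \<in> schwartz_functions"
  using schwartz_add[OF assms(1) schwartz_scale[OF assms(2), of "-1"]] by simp

lemma iter_pd_diff:
  assumes "f \<in> schwartz_functions" "g \<in> schwartz_functions" "bs \<in> lists Basis"
  shows "iter_pd bs (\<lambda>x. f x - g x) = (\<lambda>x. iter_pd bs f x - iter_pd bs g x)"
  using assms(3)
proof (induction bs)
  case (Cons b bs)
  have "((\<lambda>x. iter_pd bs f x - iter_pd bs g x) has_derivative
      (\<lambda>b. pd b (iter_pd bs f) x - pd b (iter_pd bs g) x)) (at x)" for x
    using assms Cons by (intro has_derivative_diff has_derivative_pd) (auto simp: schwartz_iff)
  from pd_eq[OF this] show ?case using Cons by auto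
qed simp

lemma schwartz_reflect:
  assumes "f \<in> schwartz_functions" shows "(\<lambda>x. f (- x)) \<in> schwartz_functions"
proof (rule schwartz_coinduct)
  let ?S = "{\<lambda>x. g (- x) |g. g \<in> schwartz_functions}"
  show "(\<lambda>x. f (- x)) \<in> ?S" using assms by blast
  fix h assume "h \<in> ?S"
  then obtain g where h: "h = (\<lambda>x. g (- x))" and g: "g \<in> schwartz_functions" by blast
  have *: "(h has_derivative (\<lambda>b. pd (- b) g (- x))) (at x)" for x
    unfolding h using has_derivative_compose[OF _ has_derivative_pd, of uminus uminus x UNIV g] g
    by (auto intro!: derivative_eq_intros simp: schwartz_differentiable)
  then show "h differentiable at x" for x by (auto simp: differentiable_def)
  show "rapid h" using schwartz_rapid[OF g] unfolding h rapid_def by (metis norm_minus_cancel)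
  show "pd b h \<in> ?S" if "b \<in> Basis" for b
  proof -
    have "pd b h x = - 1 * pd b g (- x)" for x
    proof -
      have "linear (\<lambda>b. pd b g (- x))"
        using has_derivative_pd[OF schwartz_differentiable[OF g]] by (rule has_derivative_linear)
      from linear_neg[OF this] show ?thesis by (simp add: pd_eq[OF *])
    qed
    moreover have "(\<lambda>x. - 1 * pd b g x) \<in> schwartz_functions"
      by (intro schwartz_scale schwartz_pd g that)
    ultimately show ?thesis
      by (intro CollectI exI[of _ "\<lambda>x. - 1 * pd b g x"]) auto
  qed
qed

lemma schwartz_integrable:
  assumes "f \<in> schwartz_functions" shows "integrable lborel f"
proof -
  obtain C where "\<And>x. (1 + norm x) ^ (2 * DIM('a)) * cmod (f x) \<le> C"
    using rapid_bound[OF schwartz_rapid[OF assms]] by metis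
  then show ?thesis
    by (intro integrable_of_decay schwartz_measurable[OF assms])
qed

lemma rapid_bounded:
  assumes "rapid f" obtains B where "\<And>x. cmod (f x) \<le> B"
  using rapid_bound[OF assms, of 0] by auto

section \<open>Fourier inversion on the Schwartz space\<close>

text \<open>Difference quotients integrate to \<open>0\<close> by translation invariance.\<close>

lemma integral_pd_eq_0:
  fixes h :: "'a::euclidean_space \<Rightarrow> complex"
  assumes b: "b \<in> Basis" and h: "integrable lborel h"
    and diff: "\<And>x. h differentiable (at x)"
    and C: "\<And>x. (1 + norm x) ^ (2 * DIM('a)) * cmod (pd b h x) \<le> C"
  shows "(LINT x|lborel. pd b h x) = 0"
proof -
  let ?n = "2 * DIM('a)"
  have [measurable]: "h \<in> borel_measurable borel" using h by simp
  have line: "((\<lambda>s. h (x + s *\<^sub>R b)) has_derivative (\<lambda>r. r *\<^sub>R pd b h (x + s *\<^sub>R b))) (at s)" for x s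
  proof -
    have "((\<lambda>s. h (x + s *\<^sub>R b)) has_derivative (\<lambda>r. pd (r *\<^sub>R b) h (x + s *\<^sub>R b))) (at s)"
      by (rule has_derivative_compose[OF _ has_derivative_pd[OF diff]]) (auto intro!: derivative_eq_intros)
    moreover have "pd (r *\<^sub>R b) h (x + s *\<^sub>R b) = r *\<^sub>R pd b h (x + s *\<^sub>R b)" for r
      by (intro linear_cmul has_derivative_linear[OF has_derivative_pd[OF diff]])
    ultimately show ?thesis by simp
  qed
  define t where "t m = inverse (real (Suc m))" for m
  have t: "0 < t m" "t m \<le> 1" for m by (auto simp: t_def field_simps)
  define q where "q m x = (h (x + t m *\<^sub>R b) - h x) /\<^sub>R t m" for m x
  have [measurable]: "q m \<in> borel_measurable borel" for m unfolding q_def by measurable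
  have lim: "(\<lambda>m. q m x) \<longlonglongrightarrow> pd b h x" for x
  proof -
    have "((\<lambda>s. h (x + s *\<^sub>R b)) has_vector_derivative pd b h x) (at 0)"
      using line[of x 0] by (simp add: has_vector_derivative_def)
    then have "((\<lambda>s. norm (h (x + s *\<^sub>R b) - h x - s *\<^sub>R pd b h x) / norm s) \<longlongrightarrow> 0) (at 0)"
      by (simp add: has_vector_derivative_def has_derivative_at)
    moreover have "norm (h (x + s *\<^sub>R b) - h x - s *\<^sub>R pd b h x) / norm s =
        norm ((h (x + s *\<^sub>R b) - h x) /\<^sub>R s - pd b h x)" if "s \<noteq> 0" for s
    proof -
      have "(h (x + s *\<^sub>R b) - h x) /\<^sub>R s - pd b h x = (h (x + s *\<^sub>R b) - h x - s *\<^sub>R pd b h x) /\<^sub>R s"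
        using that by (simp add: scaleR_diff_right)
      then show ?thesis by (simp add: divide_inverse mult.commute)
    qed
    then have "\<forall>\<^sub>F s in at 0. norm (h (x + s *\<^sub>R b) - h x - s *\<^sub>R pd b h x) / norm s =
        norm ((h (x + s *\<^sub>R b) - h x) /\<^sub>R s - pd b h x)"
      by (auto simp: eventually_at_filter)
    ultimately have "((\<lambda>s. norm ((h (x + s *\<^sub>R b) - h x) /\<^sub>R s - pd b h x)) \<longlongrightarrow> 0) (at 0)"
      by (rule Lim_transform_eventually)
    then have "((\<lambda>s. (h (x + s *\<^sub>R b) - h x) /\<^sub>R s) \<longlongrightarrow> pd b h x) (at 0)"
      by (simp add: tendsto_norm_zero_iff LIM_zero_iff)
    moreover have "filterlim t (at 0) sequentially"
      unfolding filterlim_at using LIMSEQ_inverse_real_of_nat t by (auto simp: t_def[abs_def])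
    ultimately show ?thesis unfolding q_def by (rule filterlim_compose)
  qed
  \<comment> \<open>The mean value inequality on a segment of length at most 1 yields one integrable
    majorant for all difference quotients.\<close>
  have q_le: "cmod (q m x) \<le> C * 2 ^ ?n * decay x" for m x
  proof -
    have "cmod (pd b h (x + s *\<^sub>R b)) \<le> C * 2 ^ ?n * decay x" if s: "s \<in> {0..t m}" for s
    proof (rule norm_le_decay)
      \<comment> \<open>Moving by at most 1 changes \<open>1 + norm x\<close> by at most a factor of
        2, which accounts for \<open>2 ^ ?n\<close>.\<close>
      have "norm (s *\<^sub>R b) \<le> 1" using s t(2)[of m] b by simp
      then have "1 + norm x \<le> 2 * (1 + norm (x + s *\<^sub>R b))"
        using norm_triangle_ineq4[of "x + s *\<^sub>R b" "s *\<^sub>R b"] norm_ge_zero[of "x + s *\<^sub>R b"]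
        unfolding add_diff_cancel_right' by (smt (verit))
      then have "(1 + norm x) ^ ?n \<le> (2 * (1 + norm (x + s *\<^sub>R b))) ^ ?n"
        by (intro power_mono) auto
      then have "(1 + norm x) ^ ?n * cmod (pd b h (x + s *\<^sub>R b)) \<le>
          (2 * (1 + norm (x + s *\<^sub>R b))) ^ ?n * cmod (pd b h (x + s *\<^sub>R b))"
        by (rule mult_right_mono) simp
      also have "\<dots> = 2 ^ ?n * ((1 + norm (x + s *\<^sub>R b)) ^ ?n * cmod (pd b h (x + s *\<^sub>R b)))"
        by (simp only: power_mult_distrib mult.assoc)
      also have "\<dots> \<le> 2 ^ ?n * C"
        by (intro mult_left_mono C) simp
      finally show "(1 + norm x) ^ ?n * cmod (pd b h (x + s *\<^sub>R b)) \<le> C * 2 ^ ?n"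
        by (simp add: mult.commute)
    qed
    then have "onorm (\<lambda>r. r *\<^sub>R pd b h (x + s *\<^sub>R b)) \<le> C * 2 ^ ?n * decay x" if "s \<in> {0..t m}" for s
      using that by (intro onorm_le) (simp add: mult.commute mult_left_mono)
    from differentiable_bound[OF convex_real_interval(5) has_derivative_at_withinI[OF line] this, where x = "t m" and y = 0]
    have "cmod (h (x + t m *\<^sub>R b) - h x) \<le> C * 2 ^ ?n * decay x * t m"
      using t(1)[of m] by simp
    moreover have "cmod (q m x) = cmod (h (x + t m *\<^sub>R b) - h x) / t m"
      using t(1)[of m] unfolding q_def norm_scaleR by (simp add: divide_inverse mult.commute)
    ultimately show ?thesis
      using t(1)[of m] by (simp add: divide_le_eq)
  qed
  have "(LINT x|lborel. q m x) = 0" for m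
  proof -
    have "integrable lborel (\<lambda>x. h (t m *\<^sub>R b + 1 *\<^sub>R x))"
      by (rule lborel_integrable_affine) (auto intro: h)
    moreover have "(LINT x|lborel. h (t m *\<^sub>R b + 1 *\<^sub>R x)) = (LINT x|lborel. h x)"
      using lborel_integral_affine[of 1 h "t m *\<^sub>R b"] h by simp
    ultimately show ?thesis
      using h by (simp add: q_def add.commute)
  qed
  moreover have "(\<lambda>m. LINT x|lborel. q m x) \<longlonglongrightarrow> (LINT x|lborel. pd b h x)"
  proof (rule integral_dominated_convergence[where w="\<lambda>x. C * 2 ^ ?n * decay (x::'a)"])
    show "pd b h \<in> borel_measurable lborel"
      by (rule borel_measurable_LIMSEQ_metric[of q]) (use lim in simp_all)
    show "integrable lborel (\<lambda>x. C * 2 ^ ?n * decay (x::'a))"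
      by (intro integrable_mult_right integrable_decay)
  qed (use lim q_le in auto)
  ultimately show ?thesis by (simp add: LIMSEQ_const_iff)
qed

text \<open>The inverse transform without its normalising factor: the sign is the one of the transform
  that acts on test functions in the definition of the Fourier transform of a distribution.\<close>

definition ft :: "('a::euclidean_space \<Rightarrow> complex) \<Rightarrow> 'a \<Rightarrow> complex" where
  "ft f \<xi> = (LINT x|lborel. iexp (\<xi> \<bullet> x) * f x)"

section \<open>The transform on the Schwartz space: derivatives, decay and inversion\<close>

lemma integrable_iexp_mult:
  fixes \<xi> :: "'a::euclidean_space"
  assumes "integrable lborel f" shows "integrable lborel (\<lambda>x. iexp (\<xi> \<bullet> x) * f x)"
  by (rule integrable_dominated[OF integrable_norm[OF assms]]) (use assms in \<open>auto simp: norm_mult\<close>)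

lemma ft_diff:
  assumes "integrable lborel f" "integrable lborel g"
  shows "ft (\<lambda>x. f x - g x) \<xi> = ft f \<xi> - ft g \<xi>"
  unfolding ft_def right_diff_distrib
  by (intro Bochner_Integration.integral_diff integrable_iexp_mult assms)

lemma norm_ft_le:
  assumes "integrable lborel f" shows "cmod (ft f \<xi>) \<le> (LINT x|lborel. cmod (f x))"
  using integral_norm_bound[of lborel "\<lambda>x. iexp (\<xi> \<bullet> x) * f x"] by (simp add: ft_def norm_mult)

text \<open>The remainder is estimated directly: the second-order bound on
  \<open>iexp t - (1 + i t)\<close>, at \<open>t = (y - \<xi>) \<bullet> x\<close>, makes its
  integrand at most \<open>norm (y - \<xi>)^2 * G x\<close>. The second moment \<open>G\<close> is
  integrable because \<open>f\<close> decreases rapidly.\<close>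

lemma ft_has_derivative:
  fixes f :: "'a::euclidean_space \<Rightarrow> complex"
  assumes f: "f \<in> schwartz_functions"
  shows "(ft f has_derivative (\<lambda>\<eta>. \<Sum>b\<in>Basis. (\<eta> \<bullet> b) *\<^sub>R ft (\<lambda>x. \<i> * (of_real (x \<bullet> b) * f x)) \<xi>)) (at \<xi>)"
proof -
  note [measurable] = schwartz_measurable[OF f]
  have intf: "integrable lborel f" by (rule schwartz_integrable[OF f])
  have intb: "integrable lborel (\<lambda>x. \<i> * (of_real (x \<bullet> b) * f x))" if "b \<in> Basis" for b
    using that by (intro schwartz_integrable schwartz_scale schwartz_coord f)
  define G where "G x = (norm x)\<^sup>2 / 2 * cmod (f x)" for x
  have G: "integrable lborel G"
  proof -
    have "rapid (\<lambda>x. of_real ((norm x)\<^sup>2 / 2) * f x)"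
    proof (rule rapid_mult_polynomial_growth[OF schwartz_rapid[OF f]])
      fix x :: 'a
      have "(norm x)\<^sup>2 / 2 \<le> (norm x)\<^sup>2" by simp
      also have "\<dots> \<le> (1 + norm x)\<^sup>2" by (intro power_mono) auto
      finally show "cmod (of_real ((norm x)\<^sup>2 / 2)) \<le> 1 * (1 + norm x) ^ 2"
        by (simp add: norm_power norm_divide)
    qed
    then obtain C where "C \<ge> 0" "\<And>x. (1 + norm x) ^ (2 * DIM('a)) * cmod (of_real ((norm x)\<^sup>2 / 2) * f x) \<le> C"
      by (rule rapid_bound[where k = "2 * DIM('a)"]) (rule that)
    then have "integrable lborel (\<lambda>x. of_real ((norm x)\<^sup>2 / 2) * f x)"
      by (intro integrable_of_decay) auto
    from integrable_norm[OF this] show ?thesis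
      unfolding G_def by (simp add: norm_mult norm_divide norm_power)
  qed
  let ?D = "\<lambda>\<eta>. \<Sum>b\<in>Basis. (\<eta> \<bullet> b) *\<^sub>R ft (\<lambda>x. \<i> * (of_real (x \<bullet> b) * f x)) \<xi>"
  have D_eq: "?D \<eta> = (LINT x|lborel. \<i> * of_real (\<eta> \<bullet> x) * (iexp (\<xi> \<bullet> x) * f x))"
    and D_int: "integrable lborel (\<lambda>x. \<i> * of_real (\<eta> \<bullet> x) * (iexp (\<xi> \<bullet> x) * f x))" for \<eta>
  proof -
    have *: "\<i> * of_real (\<eta> \<bullet> x) * (iexp (\<xi> \<bullet> x) * f x) =
        (\<Sum>b\<in>Basis. (\<eta> \<bullet> b) *\<^sub>R (iexp (\<xi> \<bullet> x) * (\<i> * (of_real (x \<bullet> b) * f x))))" for x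
    proof -
      have "(of_real (\<eta> \<bullet> x) :: complex) = (\<Sum>b\<in>Basis. of_real (\<eta> \<bullet> b) * of_real (x \<bullet> b))"
        by (subst euclidean_inner) simp
      then show ?thesis
        by (simp only: sum_distrib_left sum_distrib_right scaleR_conv_of_real mult_ac)
    qed
    have i: "integrable lborel (\<lambda>x. (\<eta> \<bullet> b) *\<^sub>R (iexp (\<xi> \<bullet> x) * (\<i> * (of_real (x \<bullet> b) * f x))))"
      if "b \<in> Basis" for b
      using that by (intro integrable_scaleR_right integrable_iexp_mult intb)
    show "integrable lborel (\<lambda>x. \<i> * of_real (\<eta> \<bullet> x) * (iexp (\<xi> \<bullet> x) * f x))"
      unfolding * by (intro Bochner_Integration.integrable_sum i)
    show "?D \<eta> = (LINT x|lborel. \<i> * of_real (\<eta> \<bullet> x) * (iexp (\<xi> \<bullet> x) * f x))"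
      unfolding * ft_def by (subst Bochner_Integration.integral_sum[OF i]) simp_all
  qed
  show ?thesis
  proof (rule has_derivativeI_sandwich[of 1 _ _ _ _ "\<lambda>y. norm (y - \<xi>) * (LINT x|lborel. G x)"])
    show "bounded_linear ?D"
      by (intro bounded_linear_sum bounded_linear_scaleR_const bounded_linear_inner_left)
    show "((\<lambda>y. norm (y - \<xi>) * (LINT x|lborel. G x)) \<longlongrightarrow> 0) (at \<xi>)"
      by (intro tendsto_mult_left_zero tendsto_norm_zero) (simp add: LIM_zero)
    fix y assume y: "y \<noteq> \<xi>"
    let ?e = "\<lambda>x. (iexp (y \<bullet> x) - iexp (\<xi> \<bullet> x) - \<i> * of_real ((y - \<xi>) \<bullet> x) * iexp (\<xi> \<bullet> x)) * f x"
    have e_eq: "?e x = iexp (y \<bullet> x) * f x - iexp (\<xi> \<bullet> x) * f x -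
        \<i> * of_real ((y - \<xi>) \<bullet> x) * (iexp (\<xi> \<bullet> x) * f x)" for x
      by (simp add: algebra_simps)
    have e_le: "cmod (?e x) \<le> (norm (y - \<xi>))\<^sup>2 * G x" for x
    proof -
      let ?t = "(y - \<xi>) \<bullet> x"
      have "iexp (y \<bullet> x) = iexp (\<xi> \<bullet> x) * iexp ?t"
        by (simp add: exp_add[symmetric] inner_diff_left distrib_left[symmetric] right_diff_distrib)
      then have "?e x = iexp (\<xi> \<bullet> x) * (iexp ?t - (1 + \<i> * of_real ?t)) * f x"
        by (simp only:) (simp add: algebra_simps)
      then have "cmod (?e x) = cmod (iexp ?t - (1 + \<i> * of_real ?t)) * cmod (f x)"
        by (simp only: norm_mult norm_exp_i_times mult_1_left)
      also have "cmod (iexp ?t - (1 + \<i> * of_real ?t)) \<le> ?t\<^sup>2 / 2"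
        using iexp_approx1[of ?t 1] by (simp add: eval_nat_numeral)
      also have "?t\<^sup>2 \<le> (norm (y - \<xi>) * norm x)\<^sup>2"
        using Cauchy_Schwarz_ineq2[of "y - \<xi>" x] abs_le_square_iff by (metis abs_mult abs_norm_cancel)
      finally show ?thesis
        by (simp add: G_def power_mult_distrib mult_right_mono divide_right_mono mult.assoc)
    qed
    have "ft f y - ft f \<xi> - ?D (y - \<xi>) = (LINT x|lborel. ?e x)"
      unfolding e_eq D_eq unfolding ft_def
      using intf by (subst Bochner_Integration.integral_diff)
        (auto intro!: integrable_iexp_mult D_int Bochner_Integration.integrable_diff
          simp: Bochner_Integration.integral_diff integrable_iexp_mult)
    also have "cmod \<dots> \<le> (LINT x|lborel. (norm (y - \<xi>))\<^sup>2 * G x)"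
    proof (rule Bochner_Integration.integral_norm_bound_integral)
      show "integrable lborel ?e"
        unfolding e_eq by (intro Bochner_Integration.integrable_diff integrable_iexp_mult D_int intf)
    qed (auto intro!: integrable_mult_right G e_le)
    finally show "norm (ft f y - ft f \<xi> - ?D (y - \<xi>)) / norm (y - \<xi>) \<le> norm (y - \<xi>) * (LINT x|lborel. G x)"
      using y by (simp add: divide_le_eq power2_eq_square mult_ac)
  qed simp
qed

lemma pd_ft:
  assumes "f \<in> schwartz_functions" "b \<in> Basis"
  shows "pd b (ft f) = ft (\<lambda>x. \<i> * (of_real (x \<bullet> b) * f x))"
proof
  fix \<xi>
  have "(\<Sum>c\<in>Basis. (b \<bullet> c) *\<^sub>R ft (\<lambda>x. \<i> * (of_real (x \<bullet> c) * f x)) \<xi>) =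
      (\<Sum>c\<in>Basis. if c = b then ft (\<lambda>x. \<i> * (of_real (x \<bullet> b) * f x)) \<xi> else 0)"
    using assms(2) by (intro sum.cong) (auto simp: inner_Basis)
  then show "pd b (ft f) \<xi> = ft (\<lambda>x. \<i> * (of_real (x \<bullet> b) * f x)) \<xi>"
    using assms(2) by (simp add: pd_eq[OF ft_has_derivative[OF assms(1)]])
qed

text \<open>Integration by parts: the partial derivative of
  \<open>iexp (\<xi> \<bullet> x) * f x\<close> has integral 0, and the product rule splits it into
  the two sides.\<close>

lemma ft_pd:
  fixes f :: "'a::euclidean_space \<Rightarrow> complex"
  assumes f: "f \<in> schwartz_functions" and b: "b \<in> Basis"
  shows "ft (pd b f) \<xi> = - \<i> * of_real (\<xi> \<bullet> b) * ft f \<xi>"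
proof -
  let ?h = "\<lambda>x. iexp (\<xi> \<bullet> x) * f x"
  have D: "(?h has_derivative (\<lambda>v. iexp (\<xi> \<bullet> x) * pd v f x + \<i> * of_real (\<xi> \<bullet> v) * iexp (\<xi> \<bullet> x) * f x)) (at x)" for x
  proof -
    have "((\<lambda>x. \<i> * of_real (\<xi> \<bullet> x)) has_derivative (\<lambda>v. \<i> * of_real (\<xi> \<bullet> v))) (at x)"
      by (intro derivative_intros)
    from has_derivative_compose[OF this DERIV_exp[unfolded has_field_derivative_def]]
    have "((\<lambda>x. iexp (\<xi> \<bullet> x)) has_derivative (\<lambda>v. \<i> * of_real (\<xi> \<bullet> v) * iexp (\<xi> \<bullet> x))) (at x)"
      by (simp add: mult_ac)
    then show ?thesis
      by (rule has_derivative_mult[OF _ has_derivative_pd[OF schwartz_differentiable[OF f]]])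
  qed
  have pd_h: "pd b ?h x = iexp (\<xi> \<bullet> x) * (pd b f x + (\<i> * of_real (\<xi> \<bullet> b)) * f x)" for x
    by (subst pd_eq[OF D]) (simp add: algebra_simps)
  have g: "(\<lambda>x. pd b f x + (\<i> * of_real (\<xi> \<bullet> b)) * f x) \<in> schwartz_functions"
    by (intro schwartz_add schwartz_scale schwartz_pd f b)
  obtain C where C: "\<And>x. (1 + norm x) ^ (2 * DIM('a)) * cmod (pd b f x + (\<i> * of_real (\<xi> \<bullet> b)) * f x) \<le> C"
    using rapid_bound[OF schwartz_rapid[OF g]] by metis
  have "(LINT x|lborel. pd b ?h x) = 0"
  proof (rule integral_pd_eq_0[OF b])
    show "integrable lborel ?h"
      by (intro integrable_iexp_mult schwartz_integrable f)
    show "?h differentiable (at x)" for x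
      using D unfolding differentiable_def by blast
    show "(1 + norm x) ^ (2 * DIM('a)) * cmod (pd b ?h x) \<le> C" for x
      using C[of x] unfolding pd_h by (simp add: norm_mult)
  qed
  also have "(LINT x|lborel. pd b ?h x) = (LINT x|lborel. iexp (\<xi> \<bullet> x) * pd b f x + \<i> * of_real (\<xi> \<bullet> b) * (iexp (\<xi> \<bullet> x) * f x))"
    unfolding pd_h by (simp add: algebra_simps)
  also have "\<dots> = ft (pd b f) \<xi> + \<i> * of_real (\<xi> \<bullet> b) * ft f \<xi>"
    unfolding ft_def
    using integrable_iexp_mult[OF schwartz_integrable[OF schwartz_pd[OF f b]]]
      integrable_iexp_mult[OF schwartz_integrable[OF f]]
    by (subst Bochner_Integration.integral_add) auto
  finally show ?thesis by (simp add: add_eq_0_iff)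
qed

text \<open>Each further factor \<open>1 + norm \<xi>\<close> is bounded by 1 plus the sum of the
  coordinates, and a coordinate of \<open>\<xi>\<close> costs one derivative of \<open>f\<close> by
  \<open>ft_pd\<close>; this multiplies the constant by \<open>1 + DIM('a)\<close>. The weight of
  exponent \<open>2 * DIM('a)\<close> only secures integrability. As \<open>C\<close> is obtained
  before \<open>f\<close>, the bound gives both rapid decay of a single transform and continuity of
  the transform.\<close>

lemma ft_bound:
  obtains C where "C \<ge> 0"
    "\<And>f A \<xi>. f \<in> schwartz_functions \<Longrightarrow>
      (\<And>bs x. bs \<in> lists Basis \<Longrightarrow> length bs \<le> k \<Longrightarrow>
        (1 + norm x) ^ (2 * DIM('a)) * cmod (iter_pd bs f x) \<le> A) \<Longrightarrow>
      (1 + norm \<xi>) ^ k * cmod (ft f (\<xi>::'a::euclidean_space)) \<le> C * A"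
proof (induction k arbitrary: thesis)
  case 0
  let ?K = "LINT x|lborel. decay (x::'a)"
  show ?case
  proof (rule 0)
    show "?K \<ge> 0" by (simp add: less_imp_le[OF decay_pos])
    fix f :: "'a \<Rightarrow> complex" and A and \<xi> :: 'a
    assume f: "f \<in> schwartz_functions"
      and "\<And>bs x. bs \<in> lists Basis \<Longrightarrow> length bs \<le> 0 \<Longrightarrow> (1 + norm x) ^ (2 * DIM('a)) * cmod (iter_pd bs f x) \<le> A"
    from this(2)[of "[]"] have A: "(1 + norm x) ^ (2 * DIM('a)) * cmod (f x) \<le> A" for x
      by simp
    have "cmod (ft f \<xi>) \<le> (LINT x|lborel. cmod (f x))"
      by (intro norm_ft_le schwartz_integrable f)
    also have "\<dots> \<le> A * ?K"
      by (intro integral_norm_le_decay A schwartz_measurable f)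
    finally show "(1 + norm \<xi>) ^ 0 * cmod (ft f \<xi>) \<le> ?K * A"
      by (simp add: mult.commute)
  qed
next
  case (Suc k)
  obtain C where C: "C \<ge> 0"
    "\<And>f A \<xi>. f \<in> schwartz_functions \<Longrightarrow>
      (\<And>bs x. bs \<in> lists Basis \<Longrightarrow> length bs \<le> k \<Longrightarrow>
        (1 + norm x) ^ (2 * DIM('a)) * cmod (iter_pd bs f x) \<le> A) \<Longrightarrow>
      (1 + norm \<xi>) ^ k * cmod (ft f (\<xi>::'a)) \<le> C * A"
    using Suc.IH by blast
  show ?case
  proof (rule Suc.prems)
    show "C * (1 + real DIM('a)) \<ge> 0" using C(1) by simp
    fix f :: "'a \<Rightarrow> complex" and A and \<xi> :: 'a
    assume f: "f \<in> schwartz_functions"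
      and A: "\<And>bs x. bs \<in> lists Basis \<Longrightarrow> length bs \<le> Suc k \<Longrightarrow> (1 + norm x) ^ (2 * DIM('a)) * cmod (iter_pd bs f x) \<le> A"
    have 0: "(1 + norm \<xi>) ^ k * cmod (ft f \<xi>) \<le> C * A"
      using A by (intro C(2) f) auto
    have 1: "(1 + norm \<xi>) ^ k * (\<bar>\<xi> \<bullet> b\<bar> * cmod (ft f \<xi>)) \<le> C * A" if b: "b \<in> Basis" for b
    proof -
      have "(1 + norm \<xi>) ^ k * cmod (ft (pd b f) \<xi>) \<le> C * A"
      proof (rule C(2))
        fix bs :: "'a list" and x assume bs: "bs \<in> lists Basis" "length bs \<le> k"
        have "iter_pd bs (pd b f) = iter_pd (bs @ [b]) f" by (simp add: iter_pd_append)
        moreover have "bs @ [b] \<in> lists Basis" using bs b by simp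
        ultimately show "(1 + norm x) ^ (2 * DIM('a)) * cmod (iter_pd bs (pd b f) x) \<le> A"
          using A[of "bs @ [b]" x] bs by simp
      qed (intro schwartz_pd f b)
      then show ?thesis by (simp add: ft_pd[OF f b] norm_mult)
    qed
    have "(1 + norm \<xi>) ^ Suc k * cmod (ft f \<xi>) = (1 + norm \<xi>) ^ k * ((1 + norm \<xi>) * cmod (ft f \<xi>))"
      by (simp add: mult_ac)
    also have "\<dots> \<le> (1 + norm \<xi>) ^ k * ((1 + (\<Sum>b\<in>Basis. \<bar>\<xi> \<bullet> b\<bar>)) * cmod (ft f \<xi>))"
      by (intro mult_left_mono mult_right_mono add_left_mono norm_le_l1) auto
    also have "\<dots> = (1 + norm \<xi>) ^ k * cmod (ft f \<xi>) + (\<Sum>b\<in>Basis. (1 + norm \<xi>) ^ k * (\<bar>\<xi> \<bullet> b\<bar> * cmod (ft f \<xi>)))"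
      by (simp add: distrib_left distrib_right sum_distrib_left sum_distrib_right)
    also have "\<dots> \<le> C * A + (\<Sum>b\<in>(Basis::'a set). C * A)"
      by (intro add_mono sum_mono 0 1)
    also have "\<dots> = C * (1 + real DIM('a)) * A"
      by (simp add: algebra_simps)
    finally show "(1 + norm \<xi>) ^ Suc k * cmod (ft f \<xi>) \<le> C * (1 + real DIM('a)) * A" .
  qed
qed

lemma finite_short_basis_lists: "finite {bs \<in> lists (Basis :: 'a::euclidean_space set). length bs \<le> k}"
  using finite_lists_length_le[of "Basis :: 'a set" k] by (simp add: lists_eq_set Int_def conj_commute in_lists_conv_set subset_iff)

lemma rapid_ft:
  fixes f :: "'a::euclidean_space \<Rightarrow> complex"
  assumes f: "f \<in> schwartz_functions" shows "rapid (ft f)"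
  unfolding rapid_def
proof
  fix k
  let ?T = "{bs \<in> lists (Basis :: 'a set). length bs \<le> k}"
  obtain C where "C \<ge> 0" and C: "\<And>f A \<xi>. f \<in> schwartz_functions \<Longrightarrow>
      (\<And>bs x. bs \<in> lists Basis \<Longrightarrow> length bs \<le> k \<Longrightarrow>
        (1 + norm x) ^ (2 * DIM('a)) * cmod (iter_pd bs f x) \<le> A) \<Longrightarrow>
      (1 + norm \<xi>) ^ k * cmod (ft f (\<xi>::'a)) \<le> C * A"
    using ft_bound[where k = k and 'a = 'a] by blast
  have "\<forall>bs\<in>?T. \<exists>c. c \<ge> 0 \<and> (\<forall>x. (1 + norm x) ^ (2 * DIM('a)) * cmod (iter_pd bs f x) \<le> c)"
  proof
    fix bs assume "bs \<in> ?T"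
    then have "rapid (iter_pd bs f)" using f unfolding schwartz_iff by blast
    then obtain c where "c \<ge> 0" "\<And>x. (1 + norm x) ^ (2 * DIM('a)) * cmod (iter_pd bs f x) \<le> c"
      by (rule rapid_bound) (rule that)
    then show "\<exists>c. c \<ge> 0 \<and> (\<forall>x. (1 + norm x) ^ (2 * DIM('a)) * cmod (iter_pd bs f x) \<le> c)" by blast
  qed
  from bchoice[OF this] obtain c
    where c: "\<forall>bs\<in>?T. c bs \<ge> 0 \<and> (\<forall>x. (1 + norm x) ^ (2 * DIM('a)) * cmod (iter_pd bs f x) \<le> c bs)" ..
  have "(1 + norm \<xi>) ^ k * cmod (ft f \<xi>) \<le> C * (\<Sum>bs\<in>?T. c bs)" for \<xi>
  proof (rule C[OF f])
    fix bs :: "'a list" and x assume "bs \<in> lists Basis" "length bs \<le> k"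
    then have "bs \<in> ?T" by simp
    have "(1 + norm x) ^ (2 * DIM('a)) * cmod (iter_pd bs f x) \<le> c bs"
      using c \<open>bs \<in> ?T\<close> by blast
    also have "\<dots> \<le> (\<Sum>bs\<in>?T. c bs)"
      by (rule member_le_sum[OF \<open>bs \<in> ?T\<close> _ finite_short_basis_lists]) (use c in blast)
    finally show "(1 + norm x) ^ (2 * DIM('a)) * cmod (iter_pd bs f x) \<le> (\<Sum>bs\<in>?T. c bs)" .
  qed
  then show "\<exists>C. \<forall>\<xi>. (1 + norm \<xi>) ^ k * cmod (ft f \<xi>) \<le> C" by blast
qed

lemma schwartz_ft: "f \<in> schwartz_functions \<Longrightarrow> ft f \<in> schwartz_functions"
proof (rule schwartz_coinduct)
  let ?S = "ft ` schwartz_functions"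
  show "f \<in> schwartz_functions \<Longrightarrow> ft f \<in> ?S" by blast
  fix h :: "'a \<Rightarrow> complex" assume "h \<in> ?S"
  then obtain g where g: "g \<in> schwartz_functions" "h = ft g" by blast
  show "h differentiable at x" for x
    using ft_has_derivative[OF g(1)] g(2) unfolding differentiable_def by blast
  show "rapid h" using g rapid_ft by blast
  show "pd b h \<in> ?S" if "b \<in> Basis" for b
    unfolding g(2) pd_ft[OF g(1) that] by (intro imageI schwartz_scale schwartz_coord g that)
qed

text \<open>The double integral does not converge absolutely, so a Gaussian factor is inserted.
  Fubini then turns the regularised integral \<open>?I k\<close> into an average of \<open>f\<close>
  around \<open>x\<close> over a narrow Gaussian. As the inserted factor tends to 1,
  \<open>?I k\<close> tends to the left-hand side and, by \<open>gauss_kernel_limit\<close>, to the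
  right-hand side.\<close>

lemma ft_inversion:
  fixes f :: "'a::euclidean_space \<Rightarrow> complex"
  assumes f: "f \<in> schwartz_functions"
  shows "ft (\<lambda>\<xi>. ft f (- \<xi>)) x = of_real ((2 * pi) ^ DIM('a)) * f x"
proof -
  \<comment> \<open>This constant enters twice, from the transform of the inserted Gaussian and from
    the mass of the averaging kernel; the two make up \<open>(2 * pi) ^ DIM('a)\<close>.\<close>
  let ?c = "sqrt (2 * pi) ^ DIM('a)"
  note [measurable] = schwartz_measurable[OF f]
  have F: "(\<lambda>\<xi>. ft f (- \<xi>)) \<in> schwartz_functions" by (intro schwartz_reflect schwartz_ft f)
  note intF = schwartz_integrable[OF F]
  note [measurable] = schwartz_measurable[OF F]
  define e where "e k = 1 / real (Suc k)" for k
  have e: "e k > 0" for k by (simp add: e_def)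
  let ?I = "\<lambda>k. LINT \<xi>|lborel. (iexp (x \<bullet> \<xi>) * ft f (- \<xi>)) * of_real (gauss (e k *\<^sub>R \<xi>))"
  have "?I k = of_real ?c * (LINT z|lborel. f (x + e k *\<^sub>R z) * of_real (gauss z))" for k
  proof -
    let ?g = "\<lambda>\<xi>::'a. iexp (x \<bullet> \<xi>) * of_real (gauss (e k *\<^sub>R \<xi>))"
    have intg: "integrable lborel ?g" by (rule integrable_fourier_gauss_scaled[OF e])
    have "?I k = (LINT \<xi>|lborel. ?g \<xi> * (LINT y|lborel. f y * iexp (- \<xi> \<bullet> y)))"
      by (simp add: ft_def mult_ac)
    also have "\<dots> = (LINT y|lborel. f y * (LINT \<xi>|lborel. ?g \<xi> * iexp (- \<xi> \<bullet> y)))"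
      using Fubini_bounded_kernel[OF intg schwartz_integrable[OF f], of "\<lambda>(\<xi>, y). iexp (- \<xi> \<bullet> y)" 1] by simp
    also have "\<dots> = (LINT y|lborel. f y * of_real (?c / e k ^ DIM('a) * gauss ((x - y) /\<^sub>R e k)))"
    proof -
      have "?g \<xi> * iexp (- \<xi> \<bullet> y) = iexp ((x - y) \<bullet> \<xi>) * of_real (gauss (e k *\<^sub>R \<xi>))" for \<xi> y
      proof -
        have "x \<bullet> \<xi> + (- \<xi> \<bullet> y) = (x - y) \<bullet> \<xi>"
          by (simp add: inner_diff_left inner_diff_right inner_commute)
        moreover have "iexp (r + t) = iexp r * iexp t" for r t
          by (simp add: exp_add distrib_left)
        ultimately have "iexp ((x - y) \<bullet> \<xi>) = iexp (x \<bullet> \<xi>) * iexp (- \<xi> \<bullet> y)"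
          by metis
        then show ?thesis by (simp only: mult_ac)
      qed
      then show ?thesis
        by (simp only: integral_fourier_gauss_scaled[OF e])
    qed
    also have "\<dots> = e k ^ DIM('a) *\<^sub>R (LINT z|lborel. f (x + e k *\<^sub>R z) *
        of_real (?c / e k ^ DIM('a) * gauss ((x - (x + e k *\<^sub>R z)) /\<^sub>R e k)))"
    proof -
      have "integrable lborel (\<lambda>y. f y * of_real (?c / e k ^ DIM('a) * gauss ((x - y) /\<^sub>R e k)))"
      proof (rule integrable_dominated)
        show "integrable lborel (\<lambda>y. cmod (f y) * (?c / e k ^ DIM('a)))"
          by (intro integrable_mult_left integrable_norm schwartz_integrable f)
        have "?c / e k ^ DIM('a) \<ge> 0" using e[of k] by simp
        then have "\<bar>?c / e k ^ DIM('a) * gauss ((x - y) /\<^sub>R e k)\<bar> \<le> ?c / e k ^ DIM('a)" for y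
          using gauss_pos[of "(x - y) /\<^sub>R e k"] gauss_le_1[of "(x - y) /\<^sub>R e k"]
          by (subst abs_of_nonneg) (simp_all only: mult_left_le mult_nonneg_nonneg less_imp_le)
        then show "cmod (f y * of_real (?c / e k ^ DIM('a) * gauss ((x - y) /\<^sub>R e k))) \<le> cmod (f y) * (?c / e k ^ DIM('a))" for y
          unfolding norm_mult norm_of_real by (rule mult_left_mono) simp
      qed measurable
      from lborel_integral_affine[OF _ this, of "e k" x] show ?thesis
        using e[of k] by simp
    qed
    also have "\<dots> = of_real ?c * (LINT z|lborel. f (x + e k *\<^sub>R z) * of_real (gauss z))"
    proof -
      have "f (x + e k *\<^sub>R z) * of_real (?c / e k ^ DIM('a) * gauss ((x - (x + e k *\<^sub>R z)) /\<^sub>R e k))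
        = of_real (?c / e k ^ DIM('a)) * (f (x + e k *\<^sub>R z) * of_real (gauss z))" for z
        using e[of k] by (simp add: gauss_minus)
      then show ?thesis
        using e[of k] by (simp only: integral_mult_right_zero) (simp add: scaleR_conv_of_real)
    qed
    finally show ?thesis .
  qed
  moreover obtain B where B: "\<And>x. cmod (f x) \<le> B"
    using rapid_bounded[OF schwartz_rapid[OF f]] by blast
  have "(\<lambda>k. of_real ?c * (LINT z|lborel. f (x + e k *\<^sub>R z) * of_real (gauss z))) \<longlonglongrightarrow> of_real ?c * (f x * of_real ?c)"
    unfolding e_def by (intro tendsto_mult_left gauss_kernel_limit[OF schwartz_continuous[OF f] B])
  ultimately have "?I \<longlonglongrightarrow> of_real ?c * (f x * of_real ?c)" by simp
  moreover have "?I \<longlonglongrightarrow> (LINT \<xi>|lborel. iexp (x \<bullet> \<xi>) * ft f (- \<xi>))"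
  proof (rule integral_dominated_convergence[where w="\<lambda>\<xi>. cmod (ft f (- \<xi>))"])
    show "integrable lborel (\<lambda>\<xi>. cmod (ft f (- \<xi>)))" by (rule integrable_norm[OF intF])
    show "AE \<xi> in lborel. norm (iexp (x \<bullet> \<xi>) * ft f (- \<xi>) * of_real (gauss (e k *\<^sub>R \<xi>))) \<le> cmod (ft f (- \<xi>))" for k
      by (auto simp: norm_mult abs_of_pos[OF gauss_pos] intro!: mult_left_le gauss_le_1)
    have "(\<lambda>k. gauss (e k *\<^sub>R \<xi>)) \<longlonglongrightarrow> 1" for \<xi> :: 'a
    proof -
      have "(\<lambda>k. exp (- (norm (e k *\<^sub>R \<xi>))\<^sup>2 / 2)) \<longlonglongrightarrow> exp (- (norm (0 *\<^sub>R \<xi>))\<^sup>2 / 2)"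
        unfolding e_def by (intro tendsto_intros LIMSEQ_inverse_real_of_nat[unfolded inverse_eq_divide]) simp
      then show ?thesis by (simp add: gauss_def)
    qed
    then have "(\<lambda>k. iexp (x \<bullet> \<xi>) * ft f (- \<xi>) * of_real (gauss (e k *\<^sub>R \<xi>))) \<longlonglongrightarrow> iexp (x \<bullet> \<xi>) * ft f (- \<xi>) * of_real 1" for \<xi>
      by (intro tendsto_mult tendsto_const tendsto_of_real)
    then show "AE \<xi> in lborel. (\<lambda>k. iexp (x \<bullet> \<xi>) * ft f (- \<xi>) * of_real (gauss (e k *\<^sub>R \<xi>))) \<longlonglongrightarrow> iexp (x \<bullet> \<xi>) * ft f (- \<xi>)"
      by simp
  qed measurable
  ultimately have "(LINT \<xi>|lborel. iexp (x \<bullet> \<xi>) * ft f (- \<xi>)) = of_real ?c * (f x * of_real ?c)"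
    by (rule LIMSEQ_unique[symmetric])
  also have "\<dots> = of_real ((2 * pi) ^ DIM('a)) * f x"
  proof -
    have "?c * ?c = (sqrt (2 * pi) * sqrt (2 * pi)) ^ DIM('a)" by (simp only: power_mult_distrib)
    also have "sqrt (2 * pi) * sqrt (2 * pi) = 2 * pi" by simp
    finally have "of_real ?c * of_real ?c = (of_real ((2 * pi) ^ DIM('a)) :: complex)"
      by (simp only: of_real_mult[symmetric])
    then show ?thesis by (metis mult.assoc mult.commute)
  qed
  finally show ?thesis by (simp add: ft_def)
qed

section \<open>Tempered distributions and their Fourier densities\<close>

definition fourier_const :: "'a::euclidean_space itself \<Rightarrow> real" where
  "fourier_const _ = (2 * pi) powr (- real DIM('a) / 2)"

lemma fourier_const_square: "fourier_const TYPE('a::euclidean_space) * fourier_const TYPE('a) * (2 * pi) ^ DIM('a) = 1"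
proof -
  have "fourier_const TYPE('a) * fourier_const TYPE('a) * (2 * pi) ^ DIM('a) =
      (2 * pi) powr (- real DIM('a) / 2 + - real DIM('a) / 2 + real DIM('a))"
    by (simp only: fourier_const_def powr_add powr_realpow[of "2 * pi", OF mult_pos_pos[OF _ pi_gt_zero]] zero_less_numeral)
  also have "\<dots> = 1" by simp
  finally show ?thesis .
qed

lemma fourier_eq: "fourier f \<xi> = of_real (fourier_const TYPE('a)) * ft f (- \<xi>)"
  for f :: "'a::euclidean_space \<Rightarrow> complex"
  unfolding fourier_def ft_def fourier_const_def scaleR_conv_of_real by simp

lemma schwartz_fourier: "f \<in> schwartz_functions \<Longrightarrow> fourier f \<in> schwartz_functions"
  unfolding fourier_eq[abs_def] by (intro schwartz_scale schwartz_reflect[OF schwartz_ft])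

lemma schwartz_inverse_fourier: "f \<in> schwartz_functions \<Longrightarrow> (\<lambda>x. fourier f (- x)) \<in> schwartz_functions"
  by (rule schwartz_reflect[OF schwartz_fourier])

lemma ft_mult_left: "ft (\<lambda>x. c * f x) \<xi> = c * ft f \<xi>"
  unfolding ft_def by (simp add: mult.left_commute)

lemma inverse_fourier_fourier:
  fixes f :: "'a::euclidean_space \<Rightarrow> complex"
  assumes "f \<in> schwartz_functions" shows "fourier (fourier f) (- x) = f x"
proof -
  let ?c = "fourier_const TYPE('a)"
  have "fourier (fourier f) (- x) = of_real ?c * (of_real ?c * (of_real ((2 * pi) ^ DIM('a)) * f x))"
  proof -
    have "fourier f = (\<lambda>\<xi>. of_real ?c * ft f (- \<xi>))"
      by (rule ext) (rule fourier_eq)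
    then show ?thesis
      by (subst fourier_eq) (simp only: ft_mult_left ft_inversion[OF assms] minus_minus)
  qed
  also have "\<dots> = of_real (?c * ?c * (2 * pi) ^ DIM('a)) * f x"
    by (simp only: of_real_mult mult.assoc)
  finally show ?thesis unfolding fourier_const_square by simp
qed

text \<open>This order of composition evaluates \<open>fourier_dist\<close> on a functional that is
  itself defined through \<open>fourier\<close>, as in
  \<open>weighted_L2_is_fourier_density\<close>.\<close>

lemma fourier_inverse_fourier:
  fixes f :: "'a::euclidean_space \<Rightarrow> complex"
  assumes f: "f \<in> schwartz_functions" shows "fourier (\<lambda>x. fourier f (- x)) \<xi> = f \<xi>"
proof -
  have "integrable lborel (\<lambda>x. iexp (- \<xi> \<bullet> x) * fourier f (- x))"
    by (intro integrable_iexp_mult schwartz_integrable schwartz_inverse_fourier f)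
  from lborel_integral_affine[OF _ this, of "-1" 0]
  have "ft (\<lambda>x. fourier f (- x)) (- \<xi>) = ft (fourier f) \<xi>"
    by (simp add: ft_def)
  then have "fourier (\<lambda>x. fourier f (- x)) \<xi> = fourier (fourier f) (- \<xi>)"
    by (simp add: fourier_eq)
  then show ?thesis by (simp add: inverse_fourier_fourier[OF f])
qed

text \<open>This identity makes the transform by duality agree with the integral formula:
  \<open>fourier f\<close> is a density of \<open>fourier_dist (fun_dist f)\<close>.\<close>

lemma integral_fourier_mult_cnj:
  fixes f g :: "'a::euclidean_space \<Rightarrow> complex"
  assumes f: "f \<in> schwartz_functions" and g: "g \<in> schwartz_functions"
  shows "(LINT \<xi>|lborel. fourier f \<xi> * cnj (g \<xi>)) = (LINT x|lborel. f x * cnj (fourier g (- x)))"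
proof -
  let ?c = "of_real (fourier_const TYPE('a)) :: complex"
  have ig: "integrable lborel (\<lambda>\<xi>. cnj (g \<xi>))"
    using schwartz_integrable[OF g] by simp
  have "fourier f \<xi> * cnj (g \<xi>) = ?c * (cnj (g \<xi>) * (LINT x|lborel. f x * iexp (- \<xi> \<bullet> x)))" for \<xi>
    by (simp add: fourier_eq ft_def mult_ac)
  then have "(LINT \<xi>|lborel. fourier f \<xi> * cnj (g \<xi>)) =
      ?c * (LINT \<xi>|lborel. cnj (g \<xi>) * (LINT x|lborel. f x * iexp (- \<xi> \<bullet> x)))"
    by (simp only: integral_mult_right_zero)
  also have "(LINT \<xi>|lborel. cnj (g \<xi>) * (LINT x|lborel. f x * iexp (- \<xi> \<bullet> x))) =
      (LINT x|lborel. f x * (LINT \<xi>|lborel. cnj (g \<xi>) * iexp (- \<xi> \<bullet> x)))"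
    using Fubini_bounded_kernel[OF ig schwartz_integrable[OF f], of "\<lambda>(\<xi>, x). iexp (- \<xi> \<bullet> x)" 1] by simp
  also have "?c * \<dots> = (LINT x|lborel. f x * (?c * (LINT \<xi>|lborel. cnj (g \<xi>) * iexp (- \<xi> \<bullet> x))))"
    unfolding integral_mult_right_zero[symmetric]
    by (intro Bochner_Integration.integral_cong refl mult.left_commute)
  also have "\<dots> = (LINT x|lborel. f x * cnj (fourier g (- x)))"
  proof -
    have "?c * (LINT \<xi>|lborel. cnj (g \<xi>) * iexp (- \<xi> \<bullet> x)) = cnj (fourier g (- x))" for x
    proof -
      have "cnj (iexp (x \<bullet> \<xi>) * g \<xi>) = cnj (g \<xi>) * iexp (- \<xi> \<bullet> x)" for \<xi>
        by (simp add: exp_cnj inner_commute mult.commute)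
      then have "(LINT \<xi>|lborel. cnj (g \<xi>) * iexp (- \<xi> \<bullet> x)) = cnj (LINT \<xi>|lborel. iexp (x \<bullet> \<xi>) * g \<xi>)"
        by (simp only: Bochner_Integration.integral_cnj[symmetric])
      then show ?thesis
        by (simp only: fourier_eq ft_def minus_minus complex_cnj_mult complex_cnj_complex_of_real)
    qed
    then show ?thesis by simp
  qed
  finally show ?thesis .
qed

text \<open>Continuity of the transform in each weighted supremum norm: the uniform constant of
  \<open>ft_bound\<close> is applied to the differences, which involve only finitely many
  derivatives.\<close>

lemma ft_converges:
  fixes \<phi> :: "nat \<Rightarrow> 'a::euclidean_space \<Rightarrow> complex"
  assumes conv: "schwartz_converges \<phi> \<psi>" and e: "e > 0"
  shows "\<forall>\<^sub>F j in sequentially. \<forall>\<xi>. (1 + norm \<xi>) ^ k * cmod (ft (\<phi> j) \<xi> - ft \<psi> \<xi>) \<le> e"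
proof -
  let ?n = "2 * DIM('a)"
  let ?T = "{bs \<in> lists (Basis :: 'a set). length bs \<le> k}"
  have \<phi>: "\<phi> j \<in> schwartz_functions" and \<psi>: "\<psi> \<in> schwartz_functions" for j
    using conv by (auto simp: schwartz_converges_def)
  obtain C where C: "C \<ge> 0" "\<And>f A \<xi>. f \<in> schwartz_functions \<Longrightarrow>
      (\<And>bs x. bs \<in> lists Basis \<Longrightarrow> length bs \<le> k \<Longrightarrow>
        (1 + norm x) ^ ?n * cmod (iter_pd bs f x) \<le> A) \<Longrightarrow>
      (1 + norm \<xi>) ^ k * cmod (ft f (\<xi>::'a)) \<le> C * A"
    using ft_bound[where k = k and 'a = 'a] by blast
  \<comment> \<open>The added 1 covers the case \<open>C = 0\<close>.\<close>
  define d where "d = e / (C + 1)"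
  have d: "d > 0" "C * d \<le> e"
    using e C(1) by (auto simp: d_def field_simps)
  have "\<forall>\<^sub>F j in sequentially. \<forall>bs\<in>?T. \<forall>x. (1 + norm x) ^ ?n * cmod (iter_pd bs (\<phi> j) x - iter_pd bs \<psi> x) \<le> d"
  proof (rule eventually_ball_finite[OF finite_short_basis_lists], rule ballI)
    fix bs assume "bs \<in> ?T"
    then have "uniform_limit UNIV (\<lambda>j x. (1 + norm x) ^ ?n *\<^sub>R iter_pd bs (\<phi> j) x)
          (\<lambda>x. (1 + norm x) ^ ?n *\<^sub>R iter_pd bs \<psi> x) sequentially"
      using conv unfolding schwartz_converges_def by blast
    from uniform_limitD[OF this d(1)]
    show "\<forall>\<^sub>F j in sequentially. \<forall>x. (1 + norm x) ^ ?n * cmod (iter_pd bs (\<phi> j) x - iter_pd bs \<psi> x) \<le> d"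
    proof eventually_elim
      case (elim j)
      show ?case
      proof
        fix x
        have "dist ((1 + norm x) ^ ?n *\<^sub>R iter_pd bs (\<phi> j) x) ((1 + norm x) ^ ?n *\<^sub>R iter_pd bs \<psi> x) < d"
          using elim by simp
        then show "(1 + norm x) ^ ?n * cmod (iter_pd bs (\<phi> j) x - iter_pd bs \<psi> x) \<le> d"
          unfolding dist_norm scaleR_diff_right[symmetric] norm_scaleR by simp
      qed
    qed
  qed
  then show ?thesis
  proof eventually_elim
    case (elim j)
    have "(1 + norm \<xi>) ^ k * cmod (ft (\<lambda>x. \<phi> j x - \<psi> x) \<xi>) \<le> C * d" for \<xi>
    proof (rule C(2)[OF schwartz_diff[OF \<phi> \<psi>]])
      fix bs :: "'a list" and x assume "bs \<in> lists Basis" "length bs \<le> k"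
      then show "(1 + norm x) ^ ?n * cmod (iter_pd bs (\<lambda>x. \<phi> j x - \<psi> x) x) \<le> d"
        using elim by (simp add: iter_pd_diff[OF \<phi> \<psi>])
    qed
    then show ?case
      using d(2) by (auto simp: ft_diff schwartz_integrable[OF \<phi>] schwartz_integrable[OF \<psi>] intro: order_trans)
  qed
qed

text \<open>By completing the square, the product is again a Gaussian.\<close>

lemma schwartz_gauss_mult:
  fixes y :: "'a::euclidean_space"
  assumes e: "e > 0"
  shows "(\<lambda>x. of_real (gauss x * gauss ((x - y) /\<^sub>R e))) \<in> schwartz_functions"
proof -
  \<comment> \<open>\<open>p\<close> is the coefficient of the second exponent, \<open>a\<close> the
    sum of both coefficients, and \<open>c\<close> the mean of the centres 0 and \<open>y\<close>
    with weights \<open>1 / 2\<close> and \<open>p\<close>.\<close>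
  define p where "p = 1 / (2 * e\<^sup>2)"
  define a where "a = 1 / 2 + p"
  define c where "c = (p / a) *\<^sub>R y"
  have p: "p > 0" using e by (simp add: p_def)
  then have a: "a > 0" by (simp add: a_def)
  have "gauss x * gauss ((x - y) /\<^sub>R e) = exp (a * (c \<bullet> c) - p * (y \<bullet> y)) * exp (- a * ((x - c) \<bullet> (x - c)))" for x
  proof -
    have 1: "(norm ((x - y) /\<^sub>R e))\<^sup>2 / 2 = p * ((x - y) \<bullet> (x - y))"
    proof -
      have *: "norm ((x - y) /\<^sub>R e) = norm (x - y) / e"
        using e by (simp add: divide_inverse mult.commute)
      show ?thesis
        unfolding * power2_norm_eq_inner[symmetric] by (simp add: p_def power_divide)
    qed
    have 2: "a * (x \<bullet> c) = p * (x \<bullet> y)" using a by (simp add: c_def)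
    have "x \<bullet> x / 2 + p * ((x - y) \<bullet> (x - y)) = a * ((x - c) \<bullet> (x - c)) - (a * (c \<bullet> c) - p * (y \<bullet> y))"
    proof -
      have "a * ((x - c) \<bullet> (x - c)) = a * (x \<bullet> x) - 2 * (a * (x \<bullet> c)) + a * (c \<bullet> c)"
        by (simp add: inner_diff_left inner_diff_right inner_commute algebra_simps)
      moreover have "p * ((x - y) \<bullet> (x - y)) = p * (x \<bullet> x) - 2 * (p * (x \<bullet> y)) + p * (y \<bullet> y)"
        by (simp add: inner_diff_left inner_diff_right inner_commute algebra_simps)
      ultimately show ?thesis unfolding 2 by (simp add: a_def algebra_simps)
    qed
    moreover have "gauss x * gauss ((x - y) /\<^sub>R e) = exp (- (x \<bullet> x / 2 + p * ((x - y) \<bullet> (x - y))))"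
    proof -
      have 3: "- (norm ((x - y) /\<^sub>R e))\<^sup>2 / 2 = - (p * ((x - y) \<bullet> (x - y)))"
        using 1 by linarith
      have 4: "- (norm x)\<^sup>2 / 2 = - (x \<bullet> x / 2)"
        by (simp add: power2_norm_eq_inner)
      show ?thesis
        by (simp only: gauss_def 3 4 exp_add[symmetric] minus_add_distrib)
    qed
    ultimately show ?thesis
      by (simp add: exp_add[symmetric])
  qed
  then show ?thesis
    using schwartz_scale[OF schwartz_gaussian[OF a, of c], of "of_real (exp (a * (c \<bullet> c) - p * (y \<bullet> y)))"]
    by simp
qed

lemma schwartz_gauss: "(\<lambda>x. of_real (gauss x)) \<in> (schwartz_functions :: ('a::euclidean_space \<Rightarrow> complex) set)"
  using schwartz_gaussian[of "1/2" "0::'a"] by (simp add: gauss_def[abs_def] power2_norm_eq_inner)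

text \<open>A density is known to be integrable only against Schwartz functions, so the difference
  is first multiplied by \<open>gauss\<close>. Testing the product with a further Gaussian amounts
  to testing the difference with a Schwartz function, where both densities give the value of
  \<open>T\<close>. Since \<open>gauss\<close> is positive, the factor can be removed at the
  end.\<close>

lemma dist_density_unique:
  fixes T :: "'a::euclidean_space functional"
  assumes g: "dist_density T g" and g': "dist_density T g'"
  shows "AE x in lborel. g x = g' x"
proof -
  note int = conjunct1[OF bspec[OF conjunct2[OF g[unfolded dist_density_def]]]]
    conjunct1[OF bspec[OF conjunct2[OF g'[unfolded dist_density_def]]]]
  note val = conjunct2[OF bspec[OF conjunct2[OF g[unfolded dist_density_def]]]]
    conjunct2[OF bspec[OF conjunct2[OF g'[unfolded dist_density_def]]]]
  let ?h = "\<lambda>x. (g x - g' x) * of_real (gauss x)"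
  have "AE x in lborel. ?h x = 0"
  proof (rule AE_zero_if_gauss_integrals_zero)
    show "integrable lborel ?h"
      using Bochner_Integration.integrable_diff[OF int(1)[OF schwartz_gauss] int(2)[OF schwartz_gauss]]
      by (simp add: left_diff_distrib)
    fix y :: 'a and e :: real assume e: "e > 0"
    let ?\<psi> = "\<lambda>x. of_real (gauss x * gauss ((x - y) /\<^sub>R e)) :: complex"
    note \<psi> = schwartz_gauss_mult[OF e, of y]
    have "(LINT x|lborel. ?h x * of_real (gauss ((x - y) /\<^sub>R e))) = (LINT x|lborel. g x * cnj (?\<psi> x) - g' x * cnj (?\<psi> x))"
      by (simp add: left_diff_distrib mult.assoc)
    also have "\<dots> = (LINT x|lborel. g x * cnj (?\<psi> x)) - (LINT x|lborel. g' x * cnj (?\<psi> x))"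
      by (rule Bochner_Integration.integral_diff[OF int(1)[OF \<psi>] int(2)[OF \<psi>]])
    also have "\<dots> = T ?\<psi> - T ?\<psi>"
      by (simp only: val(1)[OF \<psi>, symmetric] val(2)[OF \<psi>, symmetric])
    finally show "(LINT x|lborel. ?h x * of_real (gauss ((x - y) /\<^sub>R e))) = 0" by simp
  qed
  then show ?thesis
    by eventually_elim (use gauss_pos in \<open>auto simp: less_le\<close>)
qed

lemma dist_density_add:
  assumes "dist_density T g" "dist_density T' g'"
  shows "dist_density (T + T') (\<lambda>x. g x + g' x)"
  using assms unfolding dist_density_def by (simp add: distrib_right borel_measurable_add)

lemma dist_density_scale:
  assumes "dist_density T g" shows "dist_density (\<lambda>\<phi>. c * T \<phi>) (\<lambda>x. c * g x)"
  using assms unfolding dist_density_def by (simp add: mult.assoc borel_measurable_times)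

lemma fourier_dist_add: "fourier_dist (u + v) = fourier_dist u + fourier_dist v"
  by (auto simp: fourier_dist_def)

lemma fourier_dist_scale: "fourier_dist (\<lambda>\<phi>. c * u \<phi>) = (\<lambda>\<phi>. c * fourier_dist u \<phi>)"
  by (auto simp: fourier_dist_def)

lemma tempered_add:
  "u \<in> tempered_distributions \<Longrightarrow> v \<in> tempered_distributions \<Longrightarrow> u + v \<in> tempered_distributions"
  by (auto simp: tempered_distributions_def antilinear_on_def algebra_simps intro!: tendsto_add)

lemma tempered_scale:
  "u \<in> tempered_distributions \<Longrightarrow> (\<lambda>\<phi>. c * u \<phi>) \<in> tempered_distributions"
  by (auto simp: tempered_distributions_def antilinear_on_def algebra_simps intro!: tendsto_mult_left)

section \<open>Sobolev weights and weighted square-integrable functions\<close>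

definition weight :: "real \<Rightarrow> 'a::euclidean_space \<Rightarrow> real" where
  "weight s \<xi> = (1 + (norm \<xi>)\<^sup>2) powr s"

lemma weight_pos: "weight s \<xi> > 0"
proof -
  have "1 + (norm \<xi>)\<^sup>2 > 0" by (simp add: add_pos_nonneg)
  then show ?thesis by (simp add: weight_def)
qed

lemma weight_measurable [measurable]: "weight s \<in> borel_measurable borel"
  unfolding weight_def[abs_def] by measurable

lemma weight_inverse: "weight (- s) \<xi> = 1 / weight s \<xi>"
  by (simp add: weight_def powr_minus divide_inverse)

text \<open>With the absolute value in the assumption, the bound also applies at \<open>- s\<close>,
  where by \<open>weight_inverse\<close> it bounds \<open>weight s\<close> from below.\<close>

lemma weight_growth:
  assumes "\<bar>s\<bar> \<le> real k" shows "weight s \<xi> \<le> (1 + norm \<xi>) ^ (2 * k)"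
proof -
  have "weight s \<xi> \<le> (1 + (norm \<xi>)\<^sup>2) powr real k"
    unfolding weight_def using assms by (intro powr_mono) auto
  also have "\<dots> = (1 + (norm \<xi>)\<^sup>2) ^ k"
    by (intro powr_realpow) (simp add: add_pos_nonneg)
  also have "\<dots> \<le> ((1 + norm \<xi>)\<^sup>2) ^ k"
    by (intro power_mono) (simp_all add: power2_sum)
  finally show ?thesis by (simp add: power_mult)
qed

text \<open>With \<open>t = cmod (g \<xi>)\<close>, the arithmetic-geometric mean inequality bounds
  \<open>2 * (t / q)\<close> by \<open>w * t^2 + 1 / (w * q^2)\<close>. The exponent
  \<open>DIM('a) + k\<close> of \<open>q\<close> splits accordingly: \<open>k\<close> absorbs the
  inverse weight and \<open>DIM('a)\<close>, once squared, leaves exactly \<open>decay\<close>. So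
  \<open>g\<close> grows slowly enough to be paired with rapidly decreasing functions.\<close>

lemma weighted_L2_imp_L1:
  fixes g :: "'a::euclidean_space \<Rightarrow> complex"
  assumes [measurable]: "g \<in> borel_measurable borel"
    and int: "integrable lborel (\<lambda>\<xi>. weight s \<xi> * (cmod (g \<xi>))\<^sup>2)"
  obtains K where "integrable lborel (\<lambda>\<xi>. cmod (g \<xi>) / (1 + norm \<xi>) ^ K)"
proof -
  obtain k :: nat where k: "\<bar>s\<bar> \<le> real k" using real_arch_simple by blast
  have "norm (cmod (g \<xi>) / (1 + norm \<xi>) ^ (DIM('a) + k)) \<le> weight s \<xi> * (cmod (g \<xi>))\<^sup>2 + decay \<xi>" for \<xi>
  proof -
    define w where "w = weight s \<xi>"
    define q where "q = (1 + norm \<xi>) ^ (DIM('a) + k)"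
    define t where "t = cmod (g \<xi>)"
    have w: "w > 0" by (simp add: w_def weight_pos)
    have q: "q > 0" by (simp add: q_def add_pos_nonneg)
    have t: "t \<ge> 0" by (simp add: t_def)
    have "1 / w \<le> (1 + norm \<xi>) ^ (2 * k)"
      using weight_growth[of "- s" k \<xi>] k by (simp add: weight_inverse w_def)
    then have "1 / w / q\<^sup>2 \<le> (1 + norm \<xi>) ^ (2 * k) / q\<^sup>2"
      by (rule divide_right_mono) simp
    also have "\<dots> = decay \<xi>"
    proof -
      have "q\<^sup>2 = (1 + norm \<xi>) ^ (2 * DIM('a)) * (1 + norm \<xi>) ^ (2 * k)"
        unfolding q_def by (simp add: power_add[symmetric] power_mult[symmetric] algebra_simps)
      moreover have "(1 + norm \<xi>) ^ (2 * k) \<noteq> 0"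
        using norm_ge_zero[of \<xi>] by (simp add: add_nonneg_eq_0_iff)
      ultimately show ?thesis by (simp add: decay_def)
    qed
    finally have *: "1 / w / q\<^sup>2 \<le> decay \<xi>" .
    have "0 \<le> (w * t - 1 / q)\<^sup>2 / w" using w by simp
    also have "\<dots> = w * t\<^sup>2 + 1 / w / q\<^sup>2 - 2 * (t / q)"
      using w q by (simp add: power2_diff field_simps power2_eq_square)
    finally have "2 * (t / q) \<le> w * t\<^sup>2 + decay \<xi>" using * by linarith
    moreover have "t / q \<ge> 0" using t q by simp
    ultimately show ?thesis by (simp add: w_def[symmetric] q_def[symmetric] t_def[symmetric])
  qed
  then have "integrable lborel (\<lambda>\<xi>. cmod (g \<xi>) / (1 + norm \<xi>) ^ (DIM('a) + k))"
    by (intro integrable_dominated[OF Bochner_Integration.integrable_add[OF int integrable_decay]]) auto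
  then show ?thesis by (rule that)
qed

lemma integrable_mult_rapid:
  fixes g :: "'a::euclidean_space \<Rightarrow> complex"
  assumes K: "integrable lborel (\<lambda>\<xi>. cmod (g \<xi>) / (1 + norm \<xi>) ^ K)"
    and [measurable]: "g \<in> borel_measurable borel" "f \<in> borel_measurable borel"
    and f: "\<And>\<xi>. (1 + norm \<xi>) ^ K * cmod (f \<xi>) \<le> C"
  shows "integrable lborel (\<lambda>\<xi>. g \<xi> * f \<xi>)"
    and "cmod (LINT \<xi>|lborel. g \<xi> * f \<xi>) \<le> C * (LINT \<xi>|lborel. cmod (g \<xi>) / (1 + norm \<xi>) ^ K)"
proof -
  have le: "cmod (g \<xi> * f \<xi>) \<le> C * (cmod (g \<xi>) / (1 + norm \<xi>) ^ K)" for \<xi>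
  proof -
    have pos: "(1 + norm \<xi>) ^ K > 0" by (simp add: add_pos_nonneg)
    then have "cmod (f \<xi>) \<le> C / (1 + norm \<xi>) ^ K" using f[of \<xi>] by (simp add: field_simps)
    then have "cmod (g \<xi>) * cmod (f \<xi>) \<le> cmod (g \<xi>) * (C / (1 + norm \<xi>) ^ K)"
      by (rule mult_left_mono) simp
    then show ?thesis by (simp add: norm_mult mult.commute)
  qed
  show i: "integrable lborel (\<lambda>\<xi>. g \<xi> * f \<xi>)"
    by (rule integrable_dominated[OF integrable_mult_right[OF K] _ le]) measurable
  have "cmod (LINT \<xi>|lborel. g \<xi> * f \<xi>) \<le> (LINT \<xi>|lborel. C * (cmod (g \<xi>) / (1 + norm \<xi>) ^ K))"
    by (rule Bochner_Integration.integral_norm_bound_integral[OF i integrable_mult_right[OF K] le])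
  then show "cmod (LINT \<xi>|lborel. g \<xi> * f \<xi>) \<le> C * (LINT \<xi>|lborel. cmod (g \<xi>) / (1 + norm \<xi>) ^ K)"
    by (simp only: integral_mult_right_zero)
qed

lemma integrable_weight_rapid:
  fixes f :: "'a::euclidean_space \<Rightarrow> complex"
  assumes [measurable]: "f \<in> borel_measurable borel" and f: "rapid f"
  shows "integrable lborel (\<lambda>\<xi>. weight s \<xi> * (cmod (f \<xi>))\<^sup>2)"
proof -
  obtain k :: nat where k: "\<bar>s\<bar> \<le> real k" using real_arch_simple by blast
  obtain C where C: "C \<ge> 0" "\<And>\<xi>. (1 + norm \<xi>) ^ (DIM('a) + k) * cmod (f \<xi>) \<le> C"
    by (rule rapid_bound[OF f, where k = "DIM('a) + k"]) (rule that)
  show ?thesis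
  proof (rule integrable_of_decay)
    fix \<xi> :: 'a
    have "(1 + norm \<xi>) ^ (2 * DIM('a)) * norm (weight s \<xi> * (cmod (f \<xi>))\<^sup>2) \<le>
        (1 + norm \<xi>) ^ (2 * DIM('a)) * ((1 + norm \<xi>) ^ (2 * k) * (cmod (f \<xi>))\<^sup>2)"
      using weight_pos[of s \<xi>] weight_growth[OF k, of \<xi>]
      by (intro mult_left_mono) (auto simp: abs_mult intro!: mult_right_mono)
    also have "\<dots> = ((1 + norm \<xi>) ^ (DIM('a) + k) * cmod (f \<xi>))\<^sup>2"
      by (simp add: power_mult_distrib power_add power_mult power2_eq_square[of "(1 + norm \<xi>) ^ k"] mult_ac
        power_even_eq)
    also have "\<dots> \<le> C\<^sup>2"
      by (intro power_mono C(2)) simp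
    finally show "(1 + norm \<xi>) ^ (2 * DIM('a)) * norm (weight s \<xi> * (cmod (f \<xi>))\<^sup>2) \<le> C\<^sup>2" .
  qed measurable
qed

section \<open>The Hilbert space structure of Sobolev spaces\<close>

lemma fourier_density_dist:
  "u \<in> H_space s \<Longrightarrow> dist_density (fourier_dist u) (fourier_density u)"
  unfolding H_space_def fourier_density_def
  using someI_ex[of "dist_density (fourier_dist u)"] by simp

lemma fourier_density_measurable: "u \<in> H_space s \<Longrightarrow> fourier_density u \<in> borel_measurable borel"
  using fourier_density_dist unfolding dist_density_def by blast

lemma H_space_tempered: "u \<in> H_space s \<Longrightarrow> u \<in> tempered_distributions"
  by (simp add: H_space_def)

lemma H_space_integrable:
  "u \<in> H_space s \<Longrightarrow> integrable lborel (\<lambda>\<xi>. weight s \<xi> * (cmod (fourier_density u \<xi>))\<^sup>2)"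
  by (simp add: H_space_def weight_def)

text \<open>Any density with a finite weighted integral may stand in for the chosen
  \<open>fourier_density u\<close>: uniqueness almost everywhere transfers both measure-theoretic
  identities and membership in \<open>H_space s\<close>.\<close>

lemma
  assumes u: "u \<in> tempered_distributions" and g: "dist_density (fourier_dist u) g"
    and int: "integrable lborel (\<lambda>\<xi>. weight s \<xi> * (cmod (g \<xi>))\<^sup>2)"
  shows H_spaceI: "u \<in> H_space s"
    and fourier_density_AE_eq: "AE \<xi> in lborel. fourier_density u \<xi> = g \<xi>"
proof -
  have d: "dist_density (fourier_dist u) (fourier_density u)"
    unfolding fourier_density_def
    using someI[of "dist_density (fourier_dist u)", OF g] by simp
  then have [measurable]: "fourier_density u \<in> borel_measurable borel" "g \<in> borel_measurable borel"
    using g unfolding dist_density_def by blast+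
  show AE: "AE \<xi> in lborel. fourier_density u \<xi> = g \<xi>"
    by (rule dist_density_unique[OF d g])
  have "integrable lborel (\<lambda>\<xi>. weight s \<xi> * (cmod (fourier_density u \<xi>))\<^sup>2)"
    by (rule integrable_cong_AE_imp[OF int]) (use AE in \<open>auto elim: eventually_mono\<close>)
  then show "u \<in> H_space s"
    using u g unfolding H_space_def weight_def by blast
qed

lemma integrable_weight_add:
  fixes f g :: "'a::euclidean_space \<Rightarrow> complex"
  assumes [measurable]: "f \<in> borel_measurable borel" "g \<in> borel_measurable borel"
    and "integrable lborel (\<lambda>\<xi>. weight s \<xi> * (cmod (f \<xi>))\<^sup>2)"
    and "integrable lborel (\<lambda>\<xi>. weight s \<xi> * (cmod (g \<xi>))\<^sup>2)"
  shows "integrable lborel (\<lambda>\<xi>. weight s \<xi> * (cmod (f \<xi> + g \<xi>))\<^sup>2)"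
proof (rule integrable_dominated)
  show "integrable lborel (\<lambda>\<xi>. 2 * (weight s \<xi> * (cmod (f \<xi>))\<^sup>2) + 2 * (weight s \<xi> * (cmod (g \<xi>))\<^sup>2))"
    using assms by simp
  show "norm (weight s \<xi> * (cmod (f \<xi> + g \<xi>))\<^sup>2) \<le>
      2 * (weight s \<xi> * (cmod (f \<xi>))\<^sup>2) + 2 * (weight s \<xi> * (cmod (g \<xi>))\<^sup>2)" for \<xi>
    using mult_left_mono[OF cmod_add_square_le[of "f \<xi>" "g \<xi>"] less_imp_le[OF weight_pos[of s \<xi>]]]
      weight_pos[of s \<xi>] by (simp add: abs_mult distrib_left mult.left_commute)
qed measurable

lemma
  assumes u: "u \<in> H_space s" and v: "v \<in> H_space s"
  shows H_space_add: "u + v \<in> H_space s"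
    and fourier_density_add:
      "AE \<xi> in lborel. fourier_density (u + v) \<xi> = fourier_density u \<xi> + fourier_density v \<xi>"
proof -
  note * = tempered_add[OF H_space_tempered[OF u] H_space_tempered[OF v]]
    dist_density_add[OF fourier_density_dist[OF u] fourier_density_dist[OF v], folded fourier_dist_add]
    integrable_weight_add[OF fourier_density_measurable[OF u] fourier_density_measurable[OF v]
      H_space_integrable[OF u] H_space_integrable[OF v]]
  show "u + v \<in> H_space s" by (rule H_spaceI[OF *])
  show "AE \<xi> in lborel. fourier_density (u + v) \<xi> = fourier_density u \<xi> + fourier_density v \<xi>"
    by (rule fourier_density_AE_eq[OF *])
qed

lemma
  assumes u: "u \<in> H_space s"
  shows H_space_scale: "(\<lambda>\<phi>. c * u \<phi>) \<in> H_space s"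
    and fourier_density_scale: "AE \<xi> in lborel. fourier_density (\<lambda>\<phi>. c * u \<phi>) \<xi> = c * fourier_density u \<xi>"
proof -
  have "integrable lborel (\<lambda>\<xi>. (cmod c)\<^sup>2 * (weight s \<xi> * (cmod (fourier_density u \<xi>))\<^sup>2))"
    using H_space_integrable[OF u] by simp
  then have "integrable lborel (\<lambda>\<xi>. weight s \<xi> * (cmod (c * fourier_density u \<xi>))\<^sup>2)"
    by (simp add: norm_mult power_mult_distrib mult_ac)
  note * = tempered_scale[OF H_space_tempered[OF u], of c]
    dist_density_scale[OF fourier_density_dist[OF u], of c, folded fourier_dist_scale] this
  show "(\<lambda>\<phi>. c * u \<phi>) \<in> H_space s" by (rule H_spaceI[OF *])
  show "AE \<xi> in lborel. fourier_density (\<lambda>\<phi>. c * u \<phi>) \<xi> = c * fourier_density u \<xi>"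
    by (rule fourier_density_AE_eq[OF *])
qed

lemma diff_eq_add_scale: "u - v = u + (\<lambda>\<phi>. - 1 * v \<phi>)" for u v :: "'a \<Rightarrow> complex"
  by (simp add: fun_eq_iff)

lemma
  assumes u: "u \<in> H_space s" and v: "v \<in> H_space s"
  shows H_space_diff: "u - v \<in> H_space s"
    and fourier_density_diff:
      "AE \<xi> in lborel. fourier_density (u - v) \<xi> = fourier_density u \<xi> - fourier_density v \<xi>"
proof -
  note v' = H_space_scale[OF v, of "-1"]
  show "u - v \<in> H_space s"
    unfolding diff_eq_add_scale by (rule H_space_add[OF u v'])
  show "AE \<xi> in lborel. fourier_density (u - v) \<xi> = fourier_density u \<xi> - fourier_density v \<xi>"
    unfolding diff_eq_add_scale
    using fourier_density_add[OF u v'] fourier_density_scale[OF v, of "-1"] by eventually_elim simp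
qed

section \<open>Elements of Sobolev spaces from Schwartz functions and from densities\<close>

lemma integrable_schwartz_mult_cnj:
  fixes f :: "'a::euclidean_space \<Rightarrow> complex"
  assumes f: "f \<in> schwartz_functions" and \<psi>: "\<psi> \<in> schwartz_functions"
  shows "integrable lborel (\<lambda>x. f x * cnj (\<psi> x))"
proof -
  note [measurable] = schwartz_measurable[OF f] schwartz_measurable[OF \<psi>]
  obtain B where B: "\<And>x. cmod (\<psi> x) \<le> B"
    by (rule rapid_bounded[OF schwartz_rapid[OF \<psi>]]) (rule that)
  show ?thesis
    by (rule integrable_dominated[of _ "\<lambda>x. cmod (f x) * B"])
      (use B in \<open>auto simp: norm_mult intro!: integrable_mult_left integrable_norm schwartz_integrable f mult_left_mono\<close>)
qed

text \<open>As \<open>f\<close> is integrable, uniform convergence of the test functions suffices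
  for continuity; it is the seminorm with no derivative and exponent 0.\<close>

lemma fun_dist_tempered:
  fixes f :: "'a::euclidean_space \<Rightarrow> complex"
  assumes f: "f \<in> schwartz_functions" shows "fun_dist f \<in> tempered_distributions"
proof -
  note int = integrable_schwartz_mult_cnj[OF f]
  have "(\<lambda>j. LINT x|lborel. f x * cnj (\<phi> j x)) \<longlonglongrightarrow> (LINT x|lborel. f x * cnj (\<psi> x))"
    if conv: "schwartz_converges \<phi> \<psi>" for \<phi> \<psi>
  proof -
    have \<phi>: "\<phi> j \<in> schwartz_functions" and \<psi>: "\<psi> \<in> schwartz_functions" for j
      using conv by (auto simp: schwartz_converges_def)
    note [measurable] = schwartz_measurable[OF f] schwartz_measurable[OF \<psi>] schwartz_measurable[OF \<phi>]
    have lim: "uniform_limit UNIV \<phi> \<psi> sequentially"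
      using conv[unfolded schwartz_converges_def, THEN conjunct2, THEN conjunct2, rule_format, of "[]" 0]
      by simp
    show ?thesis
    proof (rule LIMSEQ_I)
      fix r :: real assume r: "r > 0"
      define I where "I = (LINT x|lborel. cmod (f x))"
      have I: "I \<ge> 0" by (simp add: I_def)
      define d where "d = r / (I + 1)"
      have d: "d > 0" using r I by (simp add: d_def)
      obtain N where N: "\<And>j x. j \<ge> N \<Longrightarrow> dist (\<phi> j x) (\<psi> x) < d"
        using uniform_limitD[OF lim d] unfolding eventually_sequentially by auto
      have "norm ((LINT x|lborel. f x * cnj (\<phi> j x)) - (LINT x|lborel. f x * cnj (\<psi> x))) < r" if "j \<ge> N" for j
      proof -
        have "(LINT x|lborel. f x * cnj (\<phi> j x)) - (LINT x|lborel. f x * cnj (\<psi> x)) =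
            (LINT x|lborel. f x * cnj (\<phi> j x) - f x * cnj (\<psi> x))"
          by (rule Bochner_Integration.integral_diff[OF int int, symmetric]) (rule \<phi> \<psi>)+
        also have "norm \<dots> \<le> (LINT x|lborel. cmod (f x) * d)"
        proof (rule Bochner_Integration.integral_norm_bound_integral)
          fix x
          have "f x * cnj (\<phi> j x) - f x * cnj (\<psi> x) = f x * cnj (\<phi> j x - \<psi> x)"
            by (simp add: right_diff_distrib)
          then show "norm (f x * cnj (\<phi> j x) - f x * cnj (\<psi> x)) \<le> cmod (f x) * d"
            using less_imp_le[OF N[OF that, of x]] by (simp only: norm_mult complex_mod_cnj dist_norm mult_left_mono norm_ge_zero)
        qed (intro Bochner_Integration.integrable_diff int \<phi> \<psi> integrable_mult_left integrable_norm schwartz_integrable f)+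
        also have "\<dots> = I * d" by (simp add: I_def)
        also have "\<dots> < r"
          using r I by (simp add: d_def field_simps)
        finally show ?thesis .
      qed
      then show "\<exists>N. \<forall>j\<ge>N. norm ((LINT x|lborel. f x * cnj (\<phi> j x)) - (LINT x|lborel. f x * cnj (\<psi> x))) < r"
        by blast
    qed
  qed
  moreover have "\<phi> + \<psi> \<in> schwartz_functions" if "\<phi> \<in> schwartz_functions" "\<psi> \<in> schwartz_functions"
    for \<phi> \<psi> :: "'a \<Rightarrow> complex"
    using schwartz_add[OF that] by (simp add: plus_fun_def)
  ultimately show ?thesis
    unfolding tempered_distributions_def antilinear_on_def fun_dist_def
    by (auto simp: schwartz_scale int distrib_left mult.left_commute schwartz_converges_def)
qed

lemma fun_dist_H_space:
  fixes f :: "'a::euclidean_space \<Rightarrow> complex"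
  assumes f: "f \<in> schwartz_functions"
  shows "fun_dist f \<in> H_space s"
proof (rule H_spaceI[OF fun_dist_tempered[OF f]])
  note F = schwartz_fourier[OF f]
  note [measurable] = schwartz_measurable[OF F]
  show "integrable lborel (\<lambda>\<xi>. weight s \<xi> * (cmod (fourier f \<xi>))\<^sup>2)"
    by (intro integrable_weight_rapid schwartz_rapid F schwartz_measurable)
  show "dist_density (fourier_dist (fun_dist f)) (fourier f)"
    unfolding dist_density_def fourier_dist_def fun_dist_def
    by (auto simp: schwartz_inverse_fourier integral_fourier_mult_cnj[OF f] integrable_schwartz_mult_cnj[OF F])
qed

text \<open>The surjectivity half of identifying \<open>H_space s\<close> with a weighted space of
  square-integrable functions. The polynomial weight \<open>K\<close> from
  \<open>weighted_L2_imp_L1\<close> makes the pairing with \<open>g\<close> continuous in a single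
  Schwartz seminorm, and \<open>ft_converges\<close> controls that seminorm.\<close>

lemma weighted_L2_is_fourier_density:
  fixes g :: "'a::euclidean_space \<Rightarrow> complex"
  assumes [measurable]: "g \<in> borel_measurable borel"
    and int: "integrable lborel (\<lambda>\<xi>. weight s \<xi> * (cmod (g \<xi>))\<^sup>2)"
  obtains u where "u \<in> H_space s" "AE \<xi> in lborel. fourier_density u \<xi> = g \<xi>"
proof -
  \<comment> \<open>The inverse transform of \<open>g\<close>, written by duality: \<open>g\<close>
    is paired with the transform of the test function.\<close>
  define u :: "'a functional" where
    "u = (\<lambda>\<psi>. if \<psi> \<in> schwartz_functions then LINT \<xi>|lborel. g \<xi> * cnj (fourier \<psi> \<xi>) else 0)"
  obtain K where K: "integrable lborel (\<lambda>\<xi>. cmod (g \<xi>) / (1 + norm \<xi>) ^ K)"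
    by (rule weighted_L2_imp_L1[OF assms]) (rule that)
  define I where "I = (LINT \<xi>|lborel. cmod (g \<xi>) / (1 + norm \<xi>) ^ K)"
  have I: "I \<ge> 0" by (simp add: I_def)
  have i: "integrable lborel (\<lambda>\<xi>. g \<xi> * cnj (\<psi> \<xi>))" if \<psi>: "\<psi> \<in> schwartz_functions" for \<psi>
  proof -
    note [measurable] = schwartz_measurable[OF \<psi>]
    obtain C where "C \<ge> 0" "\<And>x. (1 + norm x) ^ K * cmod (\<psi> x) \<le> C"
      by (rule rapid_bound[OF schwartz_rapid[OF \<psi>], where k = K]) (rule that)
    then show ?thesis
      by (intro integrable_mult_rapid(1)[OF K]) auto
  qed
  let ?c = "fourier_const TYPE('a)"
  have c: "?c \<ge> 0" by (simp add: fourier_const_def)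
  have cont: "(\<lambda>j. u (\<phi> j)) \<longlonglongrightarrow> u \<psi>" if conv: "schwartz_converges \<phi> \<psi>" for \<phi> \<psi>
  proof (rule LIMSEQ_I)
    fix r :: real assume r: "r > 0"
    have \<phi>: "\<phi> j \<in> schwartz_functions" and \<psi>: "\<psi> \<in> schwartz_functions" for j
      using conv by (auto simp: schwartz_converges_def)
    note [measurable] = schwartz_measurable[OF schwartz_fourier[OF \<phi>]] schwartz_measurable[OF schwartz_fourier[OF \<psi>]]
    define d where "d = r / (?c * I + 1)"
    have "?c * I \<ge> 0" using c I by simp
    then have d: "d > 0" "(?c * d) * I < r" using r by (auto simp: d_def field_simps)
    obtain N where N: "\<And>j \<xi>. j \<ge> N \<Longrightarrow> (1 + norm \<xi>) ^ K * cmod (ft (\<phi> j) \<xi> - ft \<psi> \<xi>) \<le> d"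
      using ft_converges[OF conv d(1), of K] unfolding eventually_sequentially by blast
    have "norm (u (\<phi> j) - u \<psi>) < r" if "j \<ge> N" for j
    proof -
      let ?d = "\<lambda>\<xi>. cnj (fourier (\<phi> j) \<xi> - fourier \<psi> \<xi>)"
      have "u (\<phi> j) - u \<psi> = (LINT \<xi>|lborel. g \<xi> * cnj (fourier (\<phi> j) \<xi>) - g \<xi> * cnj (fourier \<psi> \<xi>))"
        unfolding u_def if_P[OF \<phi>] if_P[OF \<psi>]
        by (rule Bochner_Integration.integral_diff[OF i i, symmetric]) (rule schwartz_fourier \<phi> \<psi>)+
      also have "\<dots> = (LINT \<xi>|lborel. g \<xi> * ?d \<xi>)"
        by (simp add: right_diff_distrib)
      also have "norm \<dots> \<le> (?c * d) * I"
        unfolding I_def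
      proof (rule integrable_mult_rapid(2)[OF K])
        fix \<xi> :: 'a
        have "fourier (\<phi> j) \<xi> - fourier \<psi> \<xi> = of_real ?c * (ft (\<phi> j) (- \<xi>) - ft \<psi> (- \<xi>))"
          by (simp add: fourier_eq right_diff_distrib)
        then have "(1 + norm \<xi>) ^ K * cmod (?d \<xi>) = ?c * ((1 + norm \<xi>) ^ K * cmod (ft (\<phi> j) (- \<xi>) - ft \<psi> (- \<xi>)))"
          using c by (simp only: complex_mod_cnj norm_mult norm_of_real abs_of_nonneg mult_ac)
        also have "\<dots> \<le> ?c * d"
          using N[OF that, of "- \<xi>"] c by (intro mult_left_mono) auto
        finally show "(1 + norm \<xi>) ^ K * cmod (?d \<xi>) \<le> ?c * d" .
      qed measurable
      also note d(2)
      finally show ?thesis .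
    qed
    then show "\<exists>N. \<forall>j\<ge>N. norm (u (\<phi> j) - u \<psi>) < r" by blast
  qed
  have f_add: "fourier (\<phi> + \<psi>) \<xi> = fourier \<phi> \<xi> + fourier \<psi> \<xi>"
    if "\<phi> \<in> schwartz_functions" "\<psi> \<in> schwartz_functions" for \<phi> \<psi> and \<xi> :: 'a
    using integrable_iexp_mult[OF schwartz_integrable[OF that(1)]] integrable_iexp_mult[OF schwartz_integrable[OF that(2)]]
    by (simp only: fourier_eq ft_def plus_fun_def distrib_left Bochner_Integration.integral_add)
  have f_scale: "fourier (\<lambda>x. c * \<phi> x) \<xi> = c * fourier \<phi> \<xi>" for \<phi> c and \<xi> :: 'a
    unfolding fourier_eq ft_mult_left by (simp add: mult.left_commute)
  have s_add: "\<phi> + \<psi> \<in> schwartz_functions" if "\<phi> \<in> schwartz_functions" "\<psi> \<in> schwartz_functions"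
    for \<phi> \<psi> :: "'a \<Rightarrow> complex"
    using schwartz_add[OF that] by (simp add: plus_fun_def)
  have "antilinear_on schwartz_functions u"
    unfolding antilinear_on_def u_def
    by (auto simp: s_add f_add f_scale schwartz_scale distrib_left i schwartz_fourier mult.left_commute)
  with cont have "u \<in> tempered_distributions"
    unfolding tempered_distributions_def by (auto simp: u_def)
  moreover have "dist_density (fourier_dist u) g"
    unfolding dist_density_def fourier_dist_def
    by (auto simp: i u_def schwartz_inverse_fourier fourier_inverse_fourier)
  ultimately show ?thesis
    using that[OF H_spaceI[OF _ _ int] fourier_density_AE_eq[OF _ _ int]] by blast
qed

section \<open>Inner product, norm and completeness of \<open>H_space s\<close>\<close>

lemma integrable_H_inner:
  assumes u: "u \<in> H_space s" and v: "v \<in> H_space s"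
  shows "integrable lborel (\<lambda>\<xi>. weight s \<xi> *\<^sub>R (fourier_density u \<xi> * cnj (fourier_density v \<xi>)))"
proof (rule integrable_dominated)
  note [measurable] = fourier_density_measurable[OF u] fourier_density_measurable[OF v]
  let ?f = "\<lambda>w \<xi>. weight s \<xi> * (cmod (fourier_density w \<xi>))\<^sup>2"
  show "integrable lborel (\<lambda>\<xi>. ?f u \<xi> + ?f v \<xi>)"
    by (intro Bochner_Integration.integrable_add H_space_integrable u v)
  show "(\<lambda>\<xi>. weight s \<xi> *\<^sub>R (fourier_density u \<xi> * cnj (fourier_density v \<xi>))) \<in> borel_measurable lborel"
    by measurable
  fix \<xi>
  define a b w where "a = cmod (fourier_density u \<xi>)" and "b = cmod (fourier_density v \<xi>)" and "w = weight s \<xi>"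
  have "0 \<le> a * b" by (simp add: a_def b_def)
  then have "a * b \<le> a\<^sup>2 + b\<^sup>2"
    using sum_squares_bound[of a b] by linarith
  then have "w * (a * b) \<le> w * (a\<^sup>2 + b\<^sup>2)"
    by (rule mult_left_mono) (simp add: w_def less_imp_le[OF weight_pos])
  moreover have "norm (weight s \<xi> *\<^sub>R (fourier_density u \<xi> * cnj (fourier_density v \<xi>))) = w * (a * b)"
    by (simp add: a_def b_def w_def norm_mult abs_of_pos[OF weight_pos])
  ultimately show "norm (weight s \<xi> *\<^sub>R (fourier_density u \<xi> * cnj (fourier_density v \<xi>))) \<le> ?f u \<xi> + ?f v \<xi>"
    by (simp add: a_def b_def w_def distrib_left)
qed

lemma H_inner_weight:
  "H_inner s u v = (LINT \<xi>|lborel. weight s \<xi> *\<^sub>R (fourier_density u \<xi> * cnj (fourier_density v \<xi>)))"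
  by (simp add: H_inner_def weight_def)

lemma H_inner_add_left:
  assumes u: "u \<in> H_space s" and v: "v \<in> H_space s" and w: "w \<in> H_space s"
  shows "H_inner s (u + v) w = H_inner s u w + H_inner s v w"
proof -
  note [measurable] = fourier_density_measurable[OF u] fourier_density_measurable[OF v]
    fourier_density_measurable[OF w] fourier_density_measurable[OF H_space_add[OF u v]]
  have "H_inner s (u + v) w = (LINT \<xi>|lborel. weight s \<xi> *\<^sub>R (fourier_density u \<xi> * cnj (fourier_density w \<xi>)) +
      weight s \<xi> *\<^sub>R (fourier_density v \<xi> * cnj (fourier_density w \<xi>)))"
    unfolding H_inner_weight
    by (rule integral_cong_AE) (measurable, use fourier_density_add[OF u v] in eventually_elim, simp add: distrib_right scaleR_add_right)
  then show ?thesis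
    using integrable_H_inner[OF u w] integrable_H_inner[OF v w] by (simp add: H_inner_weight)
qed

lemma H_inner_scale_left:
  assumes u: "u \<in> H_space s" and v: "v \<in> H_space s"
  shows "H_inner s (\<lambda>\<phi>. c * u \<phi>) v = c * H_inner s u v"
proof -
  note [measurable] = fourier_density_measurable[OF u] fourier_density_measurable[OF v]
    fourier_density_measurable[OF H_space_scale[OF u]]
  have "H_inner s (\<lambda>\<phi>. c * u \<phi>) v = (LINT \<xi>|lborel. c * (weight s \<xi> *\<^sub>R (fourier_density u \<xi> * cnj (fourier_density v \<xi>))))"
    unfolding H_inner_weight
    by (rule integral_cong_AE) (measurable, use fourier_density_scale[OF u, of c] in eventually_elim, simp)
  also have "\<dots> = c * H_inner s u v"
    unfolding H_inner_weight by (rule integral_mult_right_zero)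
  finally show ?thesis .
qed

lemma H_inner_commute: "H_inner s v u = cnj (H_inner s u v)"
  unfolding H_inner_weight Bochner_Integration.integral_cnj[symmetric] by (simp add: mult.commute)

lemma H_inner_self:
  "H_inner s u u = of_real (LINT \<xi>|lborel. weight s \<xi> * (cmod (fourier_density u \<xi>))\<^sup>2)"
  unfolding H_inner_weight scaleR_conv_of_real complex_norm_square[symmetric]
  by (simp only: of_real_mult[symmetric] integral_complex_of_real)

lemma H_norm_eq: "H_norm s u = sqrt (Re (H_inner s u u))"
  by (simp add: H_inner_self H_norm_def weight_def)

lemma H_norm_square: "(H_norm s u)\<^sup>2 = (LINT \<xi>|lborel. weight s \<xi> * (cmod (fourier_density u \<xi>))\<^sup>2)"
  by (simp add: H_norm_eq H_inner_self less_imp_le[OF weight_pos])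

lemma H_norm_nonneg: "H_norm s u \<ge> 0"
  by (simp add: H_norm_eq H_inner_self less_imp_le[OF weight_pos])

text \<open>By inversion every Schwartz function is the inverse transform of a Schwartz function, so
  the density determines all values of \<open>u\<close> there. Elsewhere \<open>u\<close> is 0 by
  the convention for functionals, which makes the conclusion an equality of total functions.\<close>

lemma fourier_density_AE_zero:
  assumes u: "u \<in> H_space s" and "AE \<xi> in lborel. fourier_density u \<xi> = 0"
  shows "u = 0"
proof
  fix \<phi>
  show "u \<phi> = 0 \<phi>"
  proof (cases "\<phi> \<in> schwartz_functions")
    case True
    have "u \<phi> = u (\<lambda>x. fourier (fourier \<phi>) (- x))"
      by (simp add: inverse_fourier_fourier[OF True])
    also have "\<dots> = fourier_dist u (fourier \<phi>)"
      by (simp add: fourier_dist_def schwartz_fourier[OF True])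
    also have "\<dots> = (LINT \<xi>|lborel. fourier_density u \<xi> * cnj (fourier \<phi> \<xi>))"
      using fourier_density_dist[OF u] schwartz_fourier[OF True] unfolding dist_density_def by blast
    also have "\<dots> = 0"
      by (rule integral_eq_zero_AE) (use assms(2) in eventually_elim, simp)
    finally show ?thesis by simp
  next
    case False
    then show ?thesis using H_space_tempered[OF u] by (simp add: tempered_distributions_def)
  qed
qed

lemma H_inner_pos:
  assumes u: "u \<in> H_space s" and "u \<noteq> 0"
  shows "Re (H_inner s u u) > 0"
proof (rule ccontr)
  let ?f = "\<lambda>\<xi>. weight s \<xi> * (cmod (fourier_density u \<xi>))\<^sup>2"
  assume "\<not> Re (H_inner s u u) > 0"
  moreover have "(LINT \<xi>|lborel. ?f \<xi>) \<ge> 0" by (simp add: less_imp_le[OF weight_pos])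
  ultimately have "(LINT \<xi>|lborel. ?f \<xi>) = 0" by (simp add: H_inner_self)
  then have "AE \<xi> in lborel. ?f \<xi> = 0"
    using integral_nonneg_eq_0_iff_AE[OF H_space_integrable[OF u]] by (simp add: less_imp_le[OF weight_pos])
  then have "AE \<xi> in lborel. fourier_density u \<xi> = 0"
    by eventually_elim (use weight_pos[of s] in \<open>auto simp: less_le\<close>)
  with u \<open>u \<noteq> 0\<close> show False using fourier_density_AE_zero by blast
qed

lemma H_norm_scale:
  assumes u: "u \<in> H_space s" shows "H_norm s (\<lambda>\<phi>. c * u \<phi>) = cmod c * H_norm s u"
proof -
  note cu = H_space_scale[OF u, of c]
  have "H_inner s (\<lambda>\<phi>. c * u \<phi>) (\<lambda>\<phi>. c * u \<phi>) = c * cnj c * H_inner s u u"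
  proof -
    have "H_inner s u (\<lambda>\<phi>. c * u \<phi>) = cnj (H_inner s (\<lambda>\<phi>. c * u \<phi>) u)"
      by (rule H_inner_commute)
    also have "\<dots> = cnj c * H_inner s u u"
      by (simp add: H_inner_scale_left[OF u u] H_inner_self)
    finally show ?thesis
      by (simp add: H_inner_scale_left[OF u cu])
  qed
  also have "\<dots> = of_real ((cmod c)\<^sup>2 * (LINT \<xi>|lborel. weight s \<xi> * (cmod (fourier_density u \<xi>))\<^sup>2))"
    by (simp only: H_inner_self complex_norm_square of_real_mult)
  finally show ?thesis
    by (simp add: H_norm_eq H_inner_self real_sqrt_mult)
qed

lemma H_norm_minus_commute:
  assumes u: "u \<in> H_space s" and v: "v \<in> H_space s" shows "H_norm s (u - v) = H_norm s (v - u)"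
proof -
  have "u - v = (\<lambda>\<phi>. - 1 * (v - u) \<phi>)" by (simp add: fun_eq_iff)
  then show ?thesis using H_norm_scale[OF H_space_diff[OF v u], of "-1"] by simp
qed

lemma H_norm_add_square:
  assumes u: "u \<in> H_space s" and v: "v \<in> H_space s"
  shows "(H_norm s (u + v))\<^sup>2 \<le> 2 * (H_norm s u)\<^sup>2 + 2 * (H_norm s v)\<^sup>2"
proof -
  note uv = H_space_add[OF u v]
  have "(H_norm s (u + v))\<^sup>2 \<le> (LINT \<xi>|lborel. 2 * (weight s \<xi> * (cmod (fourier_density u \<xi>))\<^sup>2) +
      2 * (weight s \<xi> * (cmod (fourier_density v \<xi>))\<^sup>2))"
    unfolding H_norm_square
  proof (rule integral_mono_AE[OF H_space_integrable[OF uv]])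
    show "integrable lborel (\<lambda>\<xi>. 2 * (weight s \<xi> * (cmod (fourier_density u \<xi>))\<^sup>2) +
      2 * (weight s \<xi> * (cmod (fourier_density v \<xi>))\<^sup>2))"
      by (intro Bochner_Integration.integrable_add integrable_mult_right H_space_integrable u v)
    show "AE \<xi> in lborel. weight s \<xi> * (cmod (fourier_density (u + v) \<xi>))\<^sup>2 \<le>
      2 * (weight s \<xi> * (cmod (fourier_density u \<xi>))\<^sup>2) + 2 * (weight s \<xi> * (cmod (fourier_density v \<xi>))\<^sup>2)"
      using fourier_density_add[OF u v]
    proof eventually_elim
      case (elim \<xi>)
      show ?case
        using mult_left_mono[OF cmod_add_square_le[of "fourier_density u \<xi>" "fourier_density v \<xi>"]
            less_imp_le[OF weight_pos[of s \<xi>]]]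
        by (simp add: elim distrib_left mult.left_commute)
    qed
  qed
  also have "\<dots> = 2 * (H_norm s u)\<^sup>2 + 2 * (H_norm s v)\<^sup>2"
    using H_space_integrable[OF u] H_space_integrable[OF v] by (simp add: H_norm_square)
  finally show ?thesis .
qed

text \<open>This replaces the triangle inequality in the closure arguments. The constants of
  \<open>H_norm_add_square\<close> fit exactly: twice \<open>(e / 2)^2\<close> for each summand adds
  up to \<open>e^2\<close>.\<close>

lemma H_norm_add_less:
  assumes u: "u \<in> H_space s" and v: "v \<in> H_space s"
    and "H_norm s u < e / 2" "H_norm s v < e / 2"
  shows "H_norm s (u + v) < e"
proof -
  have e: "e > 0" using H_norm_nonneg[of s u] assms(3) by simp
  have "(H_norm s u)\<^sup>2 < (e / 2)\<^sup>2" "(H_norm s v)\<^sup>2 < (e / 2)\<^sup>2"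
    by (rule power_strict_mono[OF assms(3) H_norm_nonneg] power_strict_mono[OF assms(4) H_norm_nonneg], simp)+
  then have "(H_norm s (u + v))\<^sup>2 < e\<^sup>2"
    using H_norm_add_square[OF u v] by (simp add: power_divide)
  then show ?thesis using e by (simp add: power_less_imp_less_base)
qed

text \<open>Multiplying densities by the square root of the weight turns \<open>H_norm\<close> into
  the unweighted norm, so \<open>L2_complete\<close> yields a limit. Dividing by that root again
  gives the density of the sought element.\<close>

lemma H_space_complete:
  fixes X :: "nat \<Rightarrow> 'a::euclidean_space functional"
  assumes X: "\<And>j. X j \<in> H_space s"
    and Cauchy: "\<And>e. e > 0 \<Longrightarrow> \<exists>N. \<forall>i\<ge>N. \<forall>j\<ge>N. H_norm s (X i - X j) < e"
  obtains u where "u \<in> H_space s" "(\<lambda>j. H_norm s (X j - u)) \<longlonglongrightarrow> 0"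
proof -
  define h where "h j \<xi> = of_real (sqrt (weight s \<xi>)) * fourier_density (X j) \<xi>" for j \<xi>
  have w: "weight s \<xi> \<ge> 0" for \<xi> :: 'a by (rule less_imp_le[OF weight_pos])
  have sq: "(cmod (of_real (sqrt (weight s \<xi>)) * z))\<^sup>2 = weight s \<xi> * (cmod z)\<^sup>2" for \<xi> :: 'a and z
    using w[of \<xi>] by (simp add: norm_mult power_mult_distrib)
  note [measurable] = fourier_density_measurable[OF X]
  have hm [measurable]: "h j \<in> borel_measurable lborel" for j unfolding h_def by measurable
  have norm_diff: "(H_norm s (u - v))\<^sup>2 = (LINT \<xi>|lborel. weight s \<xi> * (cmod (fourier_density u \<xi> - fourier_density v \<xi>))\<^sup>2)"
    if u: "u \<in> H_space s" and v: "v \<in> H_space s" for u v :: "'a functional"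
  proof -
    note [measurable] = fourier_density_measurable[OF u] fourier_density_measurable[OF v]
      fourier_density_measurable[OF H_space_diff[OF u v]]
    show ?thesis
      unfolding H_norm_square
      by (rule integral_cong_AE) (measurable, use fourier_density_diff[OF u v] in eventually_elim, simp)
  qed
  obtain H where H [measurable]: "H \<in> borel_measurable lborel"
      and H_int: "integrable lborel (\<lambda>x. (cmod (H x))\<^sup>2)"
      and H_lim: "(\<lambda>j. LINT x|lborel. (cmod (h j x - H x))\<^sup>2) \<longlonglongrightarrow> 0"
  proof (rule L2_complete[OF hm])
    show "integrable lborel (\<lambda>x. (cmod (h j x))\<^sup>2)" for j
      unfolding h_def sq by (rule H_space_integrable[OF X])
    fix e :: real assume "e > 0"
    then obtain N where N: "\<And>i j. i \<ge> N \<Longrightarrow> j \<ge> N \<Longrightarrow> H_norm s (X i - X j) < sqrt e"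
      using Cauchy[of "sqrt e"] by auto
    have "(LINT x|lborel. (cmod (h i x - h j x))\<^sup>2) < e" if "i \<ge> N" "j \<ge> N" for i j
    proof -
      have "(LINT x|lborel. (cmod (h i x - h j x))\<^sup>2) = (H_norm s (X i - X j))\<^sup>2"
        unfolding norm_diff[OF X X] h_def right_diff_distrib[symmetric] sq ..
      also have "\<dots> < (sqrt e)\<^sup>2"
        using N[OF that] H_norm_nonneg by (intro power_strict_mono) auto
      finally show ?thesis using \<open>e > 0\<close> by simp
    qed
    then show "\<exists>N. \<forall>i\<ge>N. \<forall>j\<ge>N. (LINT x|lborel. (cmod (h i x - h j x))\<^sup>2) < e" by blast
  qed (rule that)
  define g where "g \<xi> = H \<xi> / of_real (sqrt (weight s \<xi>))" for \<xi>
  have gH: "H \<xi> = of_real (sqrt (weight s \<xi>)) * g \<xi>" for \<xi>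
    using weight_pos[of s \<xi>] by (simp add: g_def)
  have [measurable]: "g \<in> borel_measurable borel"
    unfolding g_def using H by simp
  have "integrable lborel (\<lambda>\<xi>. weight s \<xi> * (cmod (g \<xi>))\<^sup>2)"
    using H_int unfolding gH sq .
  then obtain u where u: "u \<in> H_space s" and ug: "AE \<xi> in lborel. fourier_density u \<xi> = g \<xi>"
    using weighted_L2_is_fourier_density[OF \<open>g \<in> borel_measurable borel\<close>] by blast
  note [measurable] = fourier_density_measurable[OF u]
  have "(H_norm s (X j - u))\<^sup>2 = (LINT x|lborel. (cmod (h j x - H x))\<^sup>2)" for j
    unfolding norm_diff[OF X u] h_def gH right_diff_distrib[symmetric] sq
    by (rule integral_cong_AE) (measurable, use ug in eventually_elim, simp)
  with H_lim have "(\<lambda>j. (H_norm s (X j - u))\<^sup>2) \<longlonglongrightarrow> 0" by simp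
  from tendsto_real_sqrt[OF this] have "(\<lambda>j. H_norm s (X j - u)) \<longlonglongrightarrow> 0"
    by (simp add: H_norm_nonneg)
  with u show ?thesis by (rule that)
qed

lemma H_space_zero: "0 \<in> H_space s"
  using H_space_scale[OF fun_dist_H_space[OF schwartz_gauss], of 0 s] by (simp add: zero_fun_def)

section \<open>Closed subspaces and isometric images of Hilbert spaces\<close>

lemma hilbert_spaceI:
  fixes V :: "('x \<Rightarrow> complex) set"
  assumes "0 \<in> V" "\<And>u v. u \<in> V \<Longrightarrow> v \<in> V \<Longrightarrow> u + v \<in> V"
    "\<And>u c. u \<in> V \<Longrightarrow> (\<lambda>x. c * u x) \<in> V"
    "\<And>u v w. u \<in> V \<Longrightarrow> v \<in> V \<Longrightarrow> w \<in> V \<Longrightarrow> ip (u + v) w = ip u w + ip v w"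
    "\<And>u v c. u \<in> V \<Longrightarrow> v \<in> V \<Longrightarrow> ip (\<lambda>x. c * u x) v = c * ip u v"
    "\<And>u v. u \<in> V \<Longrightarrow> v \<in> V \<Longrightarrow> ip v u = cnj (ip u v)"
    "\<And>u. u \<in> V \<Longrightarrow> u \<noteq> 0 \<Longrightarrow> Re (ip u u) > 0"
    "\<And>u. u \<in> V \<Longrightarrow> nrm u = sqrt (Re (ip u u))"
    "\<And>X :: nat \<Rightarrow> 'x \<Rightarrow> complex. \<forall>j. X j \<in> V \<Longrightarrow>
      \<forall>e>0. \<exists>N. \<forall>i\<ge>N. \<forall>j\<ge>N. nrm (X i - X j) < e \<Longrightarrow> \<exists>u\<in>V. (\<lambda>j. nrm (X j - u)) \<longlonglongrightarrow> 0"
  shows "hilbert_space V ip nrm"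
  unfolding hilbert_space_def
  by (intro conjI ballI allI impI; (elim conjE)?; (rule assms; assumption))

lemma hilbert_space_H_subspace:
  assumes V: "V \<subseteq> H_space s" and zero: "0 \<in> V"
    and add: "\<And>u v. u \<in> V \<Longrightarrow> v \<in> V \<Longrightarrow> u + v \<in> V"
    and scale: "\<And>u c. u \<in> V \<Longrightarrow> (\<lambda>x. c * u x) \<in> V"
    and closed: "\<And>X u. (\<And>j. X j \<in> V) \<Longrightarrow> u \<in> H_space s \<Longrightarrow> (\<lambda>j. H_norm s (X j - u)) \<longlonglongrightarrow> 0 \<Longrightarrow> u \<in> V"
  shows "hilbert_space V (H_inner s) (H_norm s)"
proof -
  have "\<exists>u\<in>V. (\<lambda>j. H_norm s (X j - u)) \<longlonglongrightarrow> 0"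
    if X: "\<forall>j. X j \<in> V" and C: "\<forall>e>0. \<exists>N. \<forall>i\<ge>N. \<forall>j\<ge>N. H_norm s (X i - X j) < e" for X
  proof -
    obtain u where u: "u \<in> H_space s" "(\<lambda>j. H_norm s (X j - u)) \<longlonglongrightarrow> 0"
      using H_space_complete[of X s] X C V by blast
    with closed[of X u] X show ?thesis by blast
  qed
  note complete = this
  note VH = subsetD[OF V]
  show ?thesis
  proof (rule hilbert_spaceI)
    show "H_inner s (u + v) w = H_inner s u w + H_inner s v w" if "u \<in> V" "v \<in> V" "w \<in> V" for u v w
      using that by (intro H_inner_add_left VH)
    show "H_inner s (\<lambda>x. c * u x) v = c * H_inner s u v" if "u \<in> V" "v \<in> V" for u v c
      using that by (intro H_inner_scale_left VH)
    show "H_inner s v u = cnj (H_inner s u v)" for u v :: "'a functional"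
      by (rule H_inner_commute)
    show "Re (H_inner s u u) > 0" if "u \<in> V" "u \<noteq> 0" for u
      using that by (intro H_inner_pos VH)
    show "H_norm s u = sqrt (Re (H_inner s u u))" for u :: "'a functional"
      by (rule H_norm_eq)
  qed (fact zero add scale complete)+
qed

text \<open>Isometries transport the Hilbert space structure: a Cauchy sequence in the image is
  lifted to \<open>V\<close>, converges there, and its limit is mapped back. The space
  \<open>H_zero s \<Omega>\<close> obtains completeness in this way.\<close>

lemma hilbert_space_image:
  assumes H: "hilbert_space V ip n"
    and add: "\<And>u v. u \<in> V \<Longrightarrow> v \<in> V \<Longrightarrow> T (u + v) = T u + T v"
    and scale: "\<And>u c. u \<in> V \<Longrightarrow> T (\<lambda>x. c * u x) = (\<lambda>y. c * T u y)"
    and ip: "\<And>u v. u \<in> V \<Longrightarrow> v \<in> V \<Longrightarrow> ip' (T u) (T v) = ip u v"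
    and nrm: "\<And>u. u \<in> V \<Longrightarrow> n' (T u) = n u"
  shows "hilbert_space (T ` V) ip' n'"
proof -
  have zero: "0 \<in> V"
    and Vadd: "\<forall>u\<in>V. \<forall>v\<in>V. u + v \<in> V"
    and Vscale: "\<forall>u\<in>V. \<forall>c. (\<lambda>x. c * u x) \<in> V"
    and ip_add: "\<forall>u\<in>V. \<forall>v\<in>V. \<forall>w\<in>V. ip (u + v) w = ip u w + ip v w"
    and ip_scale: "\<forall>u\<in>V. \<forall>v\<in>V. \<forall>c. ip (\<lambda>x. c * u x) v = c * ip u v"
    and ip_commute: "\<forall>u\<in>V. \<forall>v\<in>V. ip v u = cnj (ip u v)"
    and ip_pos: "\<forall>u\<in>V. u \<noteq> 0 \<longrightarrow> Re (ip u u) > 0"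
    and n_eq: "\<forall>u\<in>V. n u = sqrt (Re (ip u u))"
    and V_complete: "\<forall>X :: nat \<Rightarrow> 'a \<Rightarrow> complex.
        (\<forall>j. X j \<in> V) \<and> (\<forall>\<epsilon>>0. \<exists>N. \<forall>i\<ge>N. \<forall>j\<ge>N. n (X i - X j) < \<epsilon>) \<longrightarrow>
        (\<exists>u\<in>V. (\<lambda>j. n (X j - u)) \<longlonglongrightarrow> 0)"
    using H unfolding hilbert_space_def by - (elim conjE, assumption)+
  have T0: "T 0 = 0" using scale[OF zero, of 0] by (simp add: zero_fun_def)
  have diff_eq: "f - g = f + (\<lambda>x. - 1 * g x)" for f g :: "'z \<Rightarrow> complex" by (simp add: fun_eq_iff)
  have Vdiff: "u - v \<in> V" if "u \<in> V" "v \<in> V" for u v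
    unfolding diff_eq using Vadd Vscale that by blast
  have Tdiff: "T (u - v) = T u - T v" if "u \<in> V" "v \<in> V" for u v
    unfolding diff_eq using Vscale that by (simp only: add scale)
  have complete: "\<exists>w\<in>T ` V. (\<lambda>j. n' (Y j - w)) \<longlonglongrightarrow> 0"
    if Y: "\<forall>j. Y j \<in> T ` V" and C: "\<forall>e>0. \<exists>N. \<forall>i\<ge>N. \<forall>j\<ge>N. n' (Y i - Y j) < e" for Y :: "nat \<Rightarrow> 'b \<Rightarrow> complex"
  proof -
    obtain X where X: "X j \<in> V" "Y j = T (X j)" for j
      using Y unfolding image_iff by metis
    have eq: "n' (Y j - T u) = n (X j - u)" if "u \<in> V" for j u
      using that X by (simp add: Tdiff[symmetric] nrm Vdiff)
    have "\<forall>e>0. \<exists>N. \<forall>i\<ge>N. \<forall>j\<ge>N. n (X i - X j) < e"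
      using C unfolding X(2)[of i for i] by (simp add: Tdiff[symmetric] nrm Vdiff X(1))
    then obtain u where u: "u \<in> V" "(\<lambda>j. n (X j - u)) \<longlonglongrightarrow> 0"
      using V_complete[rule_format, of X] X(1) by blast
    then show ?thesis by (intro bexI[of _ "T u"]) (simp_all add: eq)
  qed
  show ?thesis
  proof (rule hilbert_spaceI)
    show "0 \<in> T ` V" using T0 zero by (metis image_eqI)
  next
    fix a b assume "a \<in> T ` V" "b \<in> T ` V"
    then show "a + b \<in> T ` V" using Vadd by (auto simp: add[symmetric])
  next
    fix a c assume "a \<in> T ` V"
    then show "(\<lambda>x. c * a x) \<in> T ` V" using Vscale by (auto simp: scale[symmetric])
  next
    fix a b c assume "a \<in> T ` V" "b \<in> T ` V" "c \<in> T ` V"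
    then obtain u v w where "u \<in> V" "v \<in> V" "w \<in> V" "a = T u" "b = T v" "c = T w" by blast
    then show "ip' (a + b) c = ip' a c + ip' b c"
      using ip_add Vadd by (simp add: add[symmetric] ip)
  next
    fix a b c assume "a \<in> T ` V" "b \<in> T ` V"
    then obtain u v where "u \<in> V" "v \<in> V" "a = T u" "b = T v" by blast
    then show "ip' (\<lambda>x. c * a x) b = c * ip' a b"
      using ip_scale Vscale by (simp add: scale[symmetric] ip)
  next
    fix a b assume "a \<in> T ` V" "b \<in> T ` V"
    then obtain u v where "u \<in> V" "v \<in> V" "a = T u" "b = T v" by blast
    moreover from this have "ip v u = cnj (ip u v)" using ip_commute by blast
    ultimately show "ip' b a = cnj (ip' a b)" by (simp add: ip)
  next
    fix a assume "a \<in> T ` V" "a \<noteq> 0"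
    then obtain u where "u \<in> V" "a = T u" "u \<noteq> 0" using T0 by blast
    then show "0 < Re (ip' a a)" using ip_pos by (simp add: ip)
  next
    fix a assume "a \<in> T ` V"
    then obtain u where "u \<in> V" "a = T u" by blast
    then show "n' a = sqrt (Re (ip' a a))" using n_eq by (simp add: ip nrm)
  next
    fix Y :: "nat \<Rightarrow> 'b \<Rightarrow> complex"
    assume "\<forall>j. Y j \<in> T ` V" "\<forall>e>0. \<exists>N. \<forall>i\<ge>N. \<forall>j\<ge>N. n' (Y i - Y j) < e"
    then show "\<exists>w\<in>T ` V. (\<lambda>j. n' (Y j - w)) \<longlonglongrightarrow> 0" by (rule complete)
  qed
qed

section \<open>Test functions and restriction\<close>

lemma iter_pd_eq_0_off_supp: "x \<notin> fun_supp f \<Longrightarrow> iter_pd bs f x = 0"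
proof (induction bs arbitrary: x)
  case Nil
  then show ?case using closure_subset[of "{x. f x \<noteq> 0}"] by (auto simp: fun_supp_def)
next
  case (Cons b bs)
  have "open (- fun_supp f)"
    by (simp add: fun_supp_def open_Compl)
  then have "(iter_pd bs f has_derivative (\<lambda>_. 0)) (at x)"
    by (rule has_derivative_transform_within_open[OF has_derivative_const]) (use Cons in auto)
  from pd_eq[OF this] show ?case by simp
qed

lemma test_subset_schwartz: "f \<in> test_functions \<Omega> \<Longrightarrow> f \<in> schwartz_functions"
  unfolding schwartz_iff
proof (intro ballI conjI allI)
  fix bs :: "'a list" assume f: "f \<in> test_functions \<Omega>" and bs: "bs \<in> lists Basis"
  then show diff: "iter_pd bs f differentiable at x" for x
    by (simp add: test_functions_def smooth_def)
  show "rapid (iter_pd bs f)"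
    unfolding rapid_def
  proof
    fix k :: nat
    let ?g = "\<lambda>x. (1 + norm x) ^ k * cmod (iter_pd bs f x)"
    have "continuous_on (fun_supp f) (iter_pd bs f)"
      using diff by (simp add: continuous_at_imp_continuous_on differentiable_imp_continuous_within)
    then have "continuous_on (fun_supp f) ?g"
      by (intro continuous_intros)
    moreover have "compact (fun_supp f)" using f by (simp add: test_functions_def)
    ultimately have "bounded (?g ` fun_supp f)"
      by (intro compact_imp_bounded compact_continuous_image)
    then obtain C where "\<forall>y\<in>?g ` fun_supp f. norm y \<le> C"
      unfolding bounded_iff by blast
    then have C: "?g x \<le> C" if "x \<in> fun_supp f" for x
      using that by auto
    have "?g x \<le> max C 0" for x
      using C[of x] iter_pd_eq_0_off_supp[of x f bs] by (cases "x \<in> fun_supp f") auto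
    then show "\<exists>C. \<forall>x. ?g x \<le> C" by blast
  qed
qed

text \<open>All supports lie in one compact set, on which the polynomial weights are bounded. Hence
  tempered distributions restrict to distributions.\<close>

lemma test_converges_imp_schwartz_converges:
  assumes conv: "test_converges \<Omega> \<phi> \<psi>" shows "schwartz_converges \<phi> \<psi>"
  unfolding schwartz_converges_def
proof (intro conjI allI ballI)
  have \<phi>: "\<phi> j \<in> test_functions \<Omega>" and \<psi>: "\<psi> \<in> test_functions \<Omega>" for j
    using conv by (auto simp: test_converges_def)
  then show "\<phi> j \<in> schwartz_functions" "\<psi> \<in> schwartz_functions" for j
    using test_subset_schwartz by blast+
  obtain K where K: "compact K" "\<And>j. fun_supp (\<phi> j) \<subseteq> K"
    using conv unfolding test_converges_def by blast
  \<comment> \<open>The definition of convergence places only the supports of the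
    \<open>\<phi> j\<close> in \<open>K\<close>, so the support of the limit is adjoined.\<close>
  define L where "L = K \<union> fun_supp \<psi>"
  have "compact L" using K(1) \<psi> by (auto simp: L_def test_functions_def intro: compact_Un)
  then obtain B where B: "B > 0" "\<And>x. x \<in> L \<Longrightarrow> norm x \<le> B"
    using compact_imp_bounded bounded_pos by metis
  fix bs :: "'a list" and k :: nat assume bs: "bs \<in> lists Basis"
  then have lim: "uniform_limit UNIV (\<lambda>j. iter_pd bs (\<phi> j)) (iter_pd bs \<psi>) sequentially"
    using conv unfolding test_converges_def by blast
  show "uniform_limit UNIV (\<lambda>j x. (1 + norm x) ^ k *\<^sub>R iter_pd bs (\<phi> j) x)
          (\<lambda>x. (1 + norm x) ^ k *\<^sub>R iter_pd bs \<psi> x) sequentially"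
  proof (rule uniform_limitI)
    fix e :: real assume e: "e > 0"
    define d where "d = e / (1 + B) ^ k"
    have P: "(1 + B) ^ k > 0" using B(1) by simp
    then have d: "d > 0" using e by (simp add: d_def)
    from uniform_limitD[OF lim this]
    show "\<forall>\<^sub>F j in sequentially. \<forall>x\<in>UNIV. dist ((1 + norm x) ^ k *\<^sub>R iter_pd bs (\<phi> j) x) ((1 + norm x) ^ k *\<^sub>R iter_pd bs \<psi> x) < e"
    proof eventually_elim
      case (elim j)
      show ?case
      proof
        fix x
        show "dist ((1 + norm x) ^ k *\<^sub>R iter_pd bs (\<phi> j) x) ((1 + norm x) ^ k *\<^sub>R iter_pd bs \<psi> x) < e"
        proof (cases "x \<in> L")
          case True
          have "dist ((1 + norm x) ^ k *\<^sub>R iter_pd bs (\<phi> j) x) ((1 + norm x) ^ k *\<^sub>R iter_pd bs \<psi> x) =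
              (1 + norm x) ^ k * dist (iter_pd bs (\<phi> j) x) (iter_pd bs \<psi> x)"
            unfolding dist_norm scaleR_diff_right[symmetric] norm_scaleR by simp
          also have "\<dots> \<le> (1 + B) ^ k * dist (iter_pd bs (\<phi> j) x) (iter_pd bs \<psi> x)"
            using B(2)[OF True] by (intro mult_right_mono power_mono) auto
          also have "\<dots> < (1 + B) ^ k * d"
            using elim P by (intro mult_strict_left_mono) auto
          also have "\<dots> = e" using B(1) by (simp add: d_def)
          finally show ?thesis .
        next
          case False
          then have "x \<notin> fun_supp (\<phi> j)" "x \<notin> fun_supp \<psi>" using K(2) by (auto simp: L_def)
          then show ?thesis using e by (simp add: iter_pd_eq_0_off_supp)
        qed
      qed
    qed
  qed
qed

lemma schwartz_smooth: "f \<in> schwartz_functions \<Longrightarrow> smooth f"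
  by (simp add: schwartz_functions_def)

lemma test_functionsI:
  assumes "f \<in> schwartz_functions" "compact K" "K \<subseteq> \<Omega>" "\<And>x. x \<notin> K \<Longrightarrow> f x = 0"
  shows "f \<in> test_functions \<Omega>"
proof -
  have "fun_supp f \<subseteq> K"
    unfolding fun_supp_def using assms by (intro closure_minimal compact_imp_closed) auto
  moreover from this have "compact (fun_supp f)"
    using assms(2) by (metis compact_Int_closed closed_closure fun_supp_def inf.absorb_iff2)
  ultimately show ?thesis
    using assms schwartz_smooth by (auto simp: test_functions_def)
qed

lemma not_in_fun_supp: "x \<notin> fun_supp f \<Longrightarrow> f x = 0"
  using iter_pd_eq_0_off_supp[of x f "[]"] by simp

lemma test_zero: "0 \<in> test_functions \<Omega>"
  using schwartz_scale[OF schwartz_gauss, of 0]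
  by (intro test_functionsI[where K = "{}"]) (auto simp: zero_fun_def)

lemma test_add:
  assumes "f \<in> test_functions \<Omega>" "g \<in> test_functions \<Omega>" shows "f + g \<in> test_functions \<Omega>"
proof (rule test_functionsI[where K = "fun_supp f \<union> fun_supp g"])
  show "f + g \<in> schwartz_functions"
    using schwartz_add[OF assms[THEN test_subset_schwartz]] by (simp add: plus_fun_def)
qed (use assms in \<open>auto simp: test_functions_def not_in_fun_supp intro: compact_Un\<close>)

lemma test_scale:
  assumes "f \<in> test_functions \<Omega>" shows "(\<lambda>x. c * f x) \<in> test_functions \<Omega>"
proof (rule test_functionsI[where K = "fun_supp f"])
  show "(\<lambda>x. c * f x) \<in> schwartz_functions"
    by (rule schwartz_scale[OF test_subset_schwartz[OF assms]])
qed (use assms in \<open>auto simp: test_functions_def not_in_fun_supp\<close>)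

section \<open>The closure of the test functions\<close>

lemma fun_dist_add:
  assumes "f \<in> schwartz_functions" "g \<in> schwartz_functions"
  shows "fun_dist (f + g) = fun_dist f + fun_dist g"
  using integrable_schwartz_mult_cnj[OF assms(1)] integrable_schwartz_mult_cnj[OF assms(2)]
  by (auto simp: fun_dist_def fun_eq_iff distrib_right)

lemma fun_dist_scale: "fun_dist (\<lambda>x. c * f x) = (\<lambda>\<psi>. c * fun_dist f \<psi>)"
  by (auto simp: fun_dist_def mult.assoc)

lemma fun_dist_zero: "fun_dist 0 = 0"
  by (simp add: fun_dist_def fun_eq_iff)

lemma fun_dist_test_H_space: "\<phi> \<in> test_functions \<Omega> \<Longrightarrow> fun_dist \<phi> \<in> H_space s"
  by (intro fun_dist_H_space test_subset_schwartz)

lemma H_norm_zero: "H_norm s 0 = 0"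
  using H_norm_scale[OF H_space_zero, of s 0] by (simp add: zero_fun_def)

lemma H_tilde_subset: "H_tilde s \<Omega> \<subseteq> H_space s"
  by (auto simp: H_tilde_def)

lemma hilbert_space_H_tilde: "hilbert_space (H_tilde s \<Omega>) (H_inner s) (H_norm s)"
proof (rule hilbert_space_H_subspace[OF H_tilde_subset])
  have "H_norm s (0 - fun_dist (0 :: 'a \<Rightarrow> complex)) < e" if "e > 0" for e
    using that by (simp add: H_norm_zero fun_dist_zero)
  then show "0 \<in> H_tilde s \<Omega>"
    unfolding H_tilde_def using H_space_zero test_zero by blast
next
  fix u v assume u: "u \<in> H_tilde s \<Omega>" and v: "v \<in> H_tilde s \<Omega>"
  note uv = subsetD[OF H_tilde_subset u] subsetD[OF H_tilde_subset v]
  have "\<exists>\<phi>\<in>test_functions \<Omega>. H_norm s (u + v - fun_dist \<phi>) < e" if "e > 0" for e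
  proof -
    obtain \<phi> \<psi> where *: "\<phi> \<in> test_functions \<Omega>" "H_norm s (u - fun_dist \<phi>) < e / 2"
      "\<psi> \<in> test_functions \<Omega>" "H_norm s (v - fun_dist \<psi>) < e / 2"
      using u v \<open>e > 0\<close> unfolding H_tilde_def by (auto dest!: spec[of _ "e / 2"])
    have "u + v - fun_dist (\<phi> + \<psi>) = (u - fun_dist \<phi>) + (v - fun_dist \<psi>)"
      using * by (simp add: fun_dist_add test_subset_schwartz fun_eq_iff)
    moreover have "H_norm s ((u - fun_dist \<phi>) + (v - fun_dist \<psi>)) < e"
      using * by (intro H_norm_add_less H_space_diff uv fun_dist_test_H_space)
    ultimately show ?thesis using test_add[OF *(1,3)] by metis
  qed
  then show "u + v \<in> H_tilde s \<Omega>"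
    unfolding H_tilde_def using H_space_add[OF uv] by blast
next
  fix u c assume u: "u \<in> H_tilde s \<Omega>"
  note uH = subsetD[OF H_tilde_subset u]
  have "\<exists>\<phi>\<in>test_functions \<Omega>. H_norm s ((\<lambda>x. c * u x) - fun_dist \<phi>) < e" if "e > 0" for e
  proof -
    have "e / (cmod c + 1) > 0" using \<open>e > 0\<close> by (intro divide_pos_pos add_nonneg_pos) auto
    then obtain \<phi> where *: "\<phi> \<in> test_functions \<Omega>" "H_norm s (u - fun_dist \<phi>) < e / (cmod c + 1)"
      using u unfolding H_tilde_def by blast
    have "(\<lambda>x. c * u x) - fun_dist (\<lambda>x. c * \<phi> x) = (\<lambda>x. c * (u - fun_dist \<phi>) x)"
      by (simp add: fun_dist_scale fun_eq_iff right_diff_distrib)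
    then have "H_norm s ((\<lambda>x. c * u x) - fun_dist (\<lambda>x. c * \<phi> x)) = cmod c * H_norm s (u - fun_dist \<phi>)"
      using H_norm_scale[OF H_space_diff[OF uH fun_dist_test_H_space[OF *(1)]]] by simp
    also have "\<dots> \<le> (cmod c + 1) * H_norm s (u - fun_dist \<phi>)"
      by (intro mult_right_mono H_norm_nonneg) simp
    also have "\<dots> < e"
    proof -
      have "cmod c + 1 > 0" by (intro add_nonneg_pos) auto
      with *(2) show ?thesis by (simp add: pos_less_divide_eq mult.commute)
    qed
    finally show ?thesis using test_scale[OF *(1)] by blast
  qed
  then show "(\<lambda>x. c * u x) \<in> H_tilde s \<Omega>"
    unfolding H_tilde_def using H_space_scale[OF uH] by blast
next
  fix X u assume X: "\<And>j. X j \<in> H_tilde s \<Omega>" and u: "u \<in> H_space s"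
    and lim: "(\<lambda>j. H_norm s (X j - u)) \<longlonglongrightarrow> 0"
  note XH = subsetD[OF H_tilde_subset X]
  have "\<exists>\<phi>\<in>test_functions \<Omega>. H_norm s (u - fun_dist \<phi>) < e" if "e > 0" for e
  proof -
    have "\<forall>\<^sub>F j in sequentially. H_norm s (X j - u) < e / 2"
      using lim \<open>e > 0\<close> by (intro order_tendstoD) auto
    then obtain j where j: "H_norm s (X j - u) < e / 2"
      by (auto simp: eventually_sequentially)
    have "\<exists>\<phi>\<in>test_functions \<Omega>. H_norm s (X j - fun_dist \<phi>) < e / 2"
      using X[of j] \<open>e > 0\<close> unfolding H_tilde_def by (auto dest!: spec[of _ "e / 2"])
    then obtain \<phi> where \<phi>: "\<phi> \<in> test_functions \<Omega>" "H_norm s (X j - fun_dist \<phi>) < e / 2" ..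
    have "H_norm s ((u - X j) + (X j - fun_dist \<phi>)) < e"
      using j \<phi> by (intro H_norm_add_less H_space_diff u XH fun_dist_test_H_space)
        (simp_all add: H_norm_minus_commute[OF u XH])
    then show ?thesis using \<phi>(1) by (auto simp: fun_eq_iff)
  qed
  then show "u \<in> H_tilde s \<Omega>"
    unfolding H_tilde_def using u by blast
qed

section \<open>Restriction to \<open>\<Omega>\<close> when the complement is null\<close>

lemma restrict_dist_add: "restrict_dist \<Omega> (u + v) = restrict_dist \<Omega> u + restrict_dist \<Omega> v"
  by (auto simp: restrict_dist_def)

lemma restrict_dist_diff: "restrict_dist \<Omega> (u - v) = restrict_dist \<Omega> u - restrict_dist \<Omega> v"
  by (auto simp: restrict_dist_def)

lemma restrict_dist_scale: "restrict_dist \<Omega> (\<lambda>x. c * u x) = (\<lambda>y. c * restrict_dist \<Omega> u y)"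
  by (auto simp: restrict_dist_def)

lemma restrict_dist_H_dom:
  assumes "U \<in> H_space s" shows "restrict_dist \<Omega> U \<in> H_dom s \<Omega>"
proof -
  have U: "U \<in> tempered_distributions" by (rule H_space_tempered[OF assms])
  have "antilinear_on (test_functions \<Omega>) (restrict_dist \<Omega> U)"
    using U by (auto simp: antilinear_on_def tempered_distributions_def restrict_dist_def test_add test_scale
        test_subset_schwartz)
  moreover have "(\<lambda>j. restrict_dist \<Omega> U (\<phi> j)) \<longlonglongrightarrow> restrict_dist \<Omega> U \<psi>"
    if conv: "test_converges \<Omega> \<phi> \<psi>" for \<phi> \<psi>
  proof -
    have "\<phi> j \<in> test_functions \<Omega>" "\<psi> \<in> test_functions \<Omega>" for j
      using conv by (auto simp: test_converges_def)
    moreover have "(\<lambda>j. U (\<phi> j)) \<longlonglongrightarrow> U \<psi>"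
      using U test_converges_imp_schwartz_converges[OF conv] unfolding tempered_distributions_def by blast
    ultimately show ?thesis by (simp add: restrict_dist_def)
  qed
  ultimately have "restrict_dist \<Omega> U \<in> distributions \<Omega>"
    unfolding distributions_def by (simp add: restrict_dist_def)
  with assms show ?thesis unfolding H_dom_def by blast
qed

lemma restrict_dist_inj:
  assumes "open \<Omega>" "s_null s (- \<Omega>)"
    and U: "U \<in> H_space s" and V: "V \<in> H_space s" and eq: "restrict_dist \<Omega> U = restrict_dist \<Omega> V"
  shows "U = V"
proof -
  have "(U - V) \<phi> = 0" if "\<phi> \<in> test_functions \<Omega>" for \<phi>
    using fun_cong[OF eq, of \<phi>] that by (simp add: restrict_dist_def)
  \<comment> \<open>\<open>\<Omega>\<close> is itself one of the open sets whose union is removed in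
    \<open>dist_supp\<close>.\<close>
  then have "dist_supp (U - V) \<subseteq> - \<Omega>"
    unfolding dist_supp_def using \<open>open \<Omega>\<close> by blast
  then have "U - V \<in> H_supp s (- \<Omega>)"
    using H_space_diff[OF U V] by (simp add: H_supp_def)
  also have "H_supp s (- \<Omega>) = {0}"
    using assms(1,2) by (simp add: s_null_def closed_Compl)
  finally show ?thesis by (simp add: fun_eq_iff)
qed

lemma H_dom_norm_restrict:
  assumes "open \<Omega>" "s_null s (- \<Omega>)" and U: "U \<in> H_space s"
  shows "H_dom_norm s \<Omega> (restrict_dist \<Omega> U) = H_norm s U"
proof -
  have "{H_norm s V | V. V \<in> H_space s \<and> restrict_dist \<Omega> V = restrict_dist \<Omega> U} = {H_norm s U}"
    using restrict_dist_inj[OF assms(1,2) _ U] U by blast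
  then show ?thesis by (simp add: H_dom_norm_def)
qed

lemma Q_proj_eq:
  fixes U :: "'a::euclidean_space functional"
  assumes "open \<Omega>" "s_null s (- \<Omega>)" and U: "U \<in> H_space s"
  shows "Q_proj s \<Omega> U = U"
proof -
  have null: "H_supp s (- \<Omega>) = {0}"
    using assms(1,2) by (simp add: s_null_def closed_Compl)
  have zero_left: "H_inner s 0 v = 0" if "v \<in> H_space s" for v :: "'a functional"
    using H_inner_scale_left[OF H_space_zero that, of 0] by (simp add: zero_fun_def)
  have "H_inner s u 0 = 0" if "u \<in> H_space s" for u :: "'a functional"
    using H_inner_commute[of s u 0] zero_left[OF that] by simp
  then have perp: "H_perp s (H_supp s (- \<Omega>)) = H_space s"
    by (auto simp: null H_perp_def)
  \<comment> \<open>The orthogonal complement of \<open>{0}\<close> is the whole space. The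
    description is unique there because an element orthogonal to everything is orthogonal to itself,
    hence 0.\<close>
  have "(THE w. w \<in> H_space s \<and> (\<forall>v\<in>H_space s. H_inner s (U - w) v = 0)) = U"
  proof (rule the_equality)
    show "U \<in> H_space s \<and> (\<forall>v\<in>H_space s. H_inner s (U - U) v = 0)"
      using U zero_left by simp
    fix w assume w: "w \<in> H_space s \<and> (\<forall>v\<in>H_space s. H_inner s (U - w) v = 0)"
    then have d: "U - w \<in> H_space s" by (intro H_space_diff U) auto
    with w have "H_inner s (U - w) (U - w) = 0" by blast
    with H_inner_pos[OF d] have "U - w = 0" by fastforce
    then show "w = U" by (simp add: fun_eq_iff)
  qed
  then show ?thesis by (simp add: Q_proj_def H_proj_def perp)
qed

lemma H_dom_inner_restrict:
  assumes "open \<Omega>" "s_null s (- \<Omega>)" and U: "U \<in> H_space s" and V: "V \<in> H_space s"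
  shows "H_dom_inner s \<Omega> (restrict_dist \<Omega> U) (restrict_dist \<Omega> V) = H_inner s U V"
proof -
  have "H_ext s \<Omega> (restrict_dist \<Omega> W) = W" if W: "W \<in> H_space s" for W
    unfolding H_ext_def using W restrict_dist_inj[OF assms(1,2) _ W]
    by (intro some_equality) auto
  then show ?thesis
    by (simp add: H_dom_inner_def Q_proj_eq[OF assms(1,2)] U V)
qed

text \<open>Approximability by test functions carries over in both directions because distances of
  restrictions equal distances of extensions. Every element of \<open>H_zero s \<Omega>\<close> is a
  restriction by the definition of \<open>H_dom\<close>, so none is missed.\<close>

lemma H_zero_eq:
  assumes "open \<Omega>" "s_null s (- \<Omega>)"
  shows "H_zero s \<Omega> = restrict_dist \<Omega> ` H_tilde s \<Omega>"
proof -
  have norm_eq: "H_dom_norm s \<Omega> (restrict_dist \<Omega> U - restrict_dist \<Omega> (fun_dist \<phi>)) = H_norm s (U - fun_dist \<phi>)"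
    if "U \<in> H_space s" "\<phi> \<in> test_functions \<Omega>" for U \<phi>
    unfolding restrict_dist_diff[symmetric]
    by (intro H_dom_norm_restrict assms H_space_diff that fun_dist_test_H_space[OF that(2)])
  have "restrict_dist \<Omega> U \<in> H_zero s \<Omega> \<longleftrightarrow> U \<in> H_tilde s \<Omega>" if U: "U \<in> H_space s" for U
    unfolding H_zero_def H_tilde_def
    using U restrict_dist_H_dom[OF U, of \<Omega>] by (simp add: norm_eq cong: bex_cong)
  moreover have "H_zero s \<Omega> \<subseteq> restrict_dist \<Omega> ` H_space s"
    by (auto simp: H_zero_def H_dom_def)
  ultimately show ?thesis
    using H_tilde_subset by blast
qed

theorem proposition2p11:
  fixes s :: real and \<Omega> :: "(real ^ 'n) set"
  assumes "open \<Omega>"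
    and "s_null s (- \<Omega>)"
  shows "unitary_isomorphism
           (H_tilde s \<Omega>) (H_inner s) (H_norm s)
           (H_zero s \<Omega>) (H_dom_inner s \<Omega>) (H_dom_norm s \<Omega>)
           (restrict_dist \<Omega>)"
proof -
  note HT = subsetD[OF H_tilde_subset]
  have "hilbert_space (restrict_dist \<Omega> ` H_tilde s \<Omega>) (H_dom_inner s \<Omega>) (H_dom_norm s \<Omega>)"
    using hilbert_space_H_tilde restrict_dist_add restrict_dist_scale
  proof (rule hilbert_space_image)
    show "H_dom_inner s \<Omega> (restrict_dist \<Omega> u) (restrict_dist \<Omega> v) = H_inner s u v"
      if "u \<in> H_tilde s \<Omega>" "v \<in> H_tilde s \<Omega>" for u v
      by (rule H_dom_inner_restrict[OF assms HT[OF that(1)] HT[OF that(2)]])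
    show "H_dom_norm s \<Omega> (restrict_dist \<Omega> u) = H_norm s u" if "u \<in> H_tilde s \<Omega>" for u
      by (rule H_dom_norm_restrict[OF assms HT[OF that]])
  qed
  then show ?thesis
    unfolding unitary_isomorphism_def H_zero_eq[OF assms]
    using hilbert_space_H_tilde[of s \<Omega>] restrict_dist_add restrict_dist_scale H_dom_norm_restrict[OF assms HT]
    by auto
qed

end
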